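(* Let $p\in[1,\infty)$, let $q$ be its Hölder conjugate, let $\mu$ be a measure, let $A\subseteq\mathcal{L}(L^p(\mu))$ be an $L^p$-operator algebra, and let $\nu$ be counting measure on $\mathbb{Z}_{\geq1}$. If $A$ has a contractive approximate identity, then $$\mathcal{K}_A(\ell^q\otimes_pA,\ \ell^p\otimes_pA)=\mathcal{K}(\ell^p)\otimes_pA\subseteq\mathcal{L}(L^p(\nu\times\mu)).$$ If in addition $A$ sits nondegenerately in $\mathcal{L}(L^p(\mu))$, then $$\mathcal{L}_A(\ell^q\otimes_pA,\ \ell^p\otimes_pA)=M(\mathcal{K}(\ell^p)\otimes_pA)\subseteq\mathcal{L}(L^p(\nu\times\mu)).$$
   Context: $\mathcal{L}(E,F)$ denotes the bounded linear maps $E\to F$ with the operator norm, $\mathcal{L}(E)=\mathcal{L}(E,E)$; $\mathcal{K}(\ell^p)$ is the algebra of compact operators on $\ell^p=\ell^p(\mathbb{Z}_{\geq1})$. An $L^p$-operator algebra $A\subseteq\mathcal{L}(L^p(\mu))$ is a norm-closed subalgebra. A contractive approximate identity is a net $(e_\lambda)$ in $A$ with $\|e_\lambda\|\le1$ and $\|ae_\lambda-a\|\to0$, $\|e_\lambda a-a\|\to0$ for all $a\in A$. $A$ sits nondegenerately in $\mathcal{L}(E)$ if the linear span of $\{a\xi\colon a\in A,\xi\in E\}$ is dense in $E$. $L^p$-module: an $L^p$-module over $A\subseteq\mathcal{L}(L^p(\mu_0))$ is a pair $(\mathsf{Y},\mathsf{X})$ of closed subspaces $\mathsf{Y}\subseteq\mathcal{L}(L^p(\mu_1),L^p(\mu_0))$,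 $\mathsf{X}\subseteq\mathcal{L}(L^p(\mu_0),L^p(\mu_1))$ with $xa\in\mathsf{X}$, $ay\in\mathsf{Y}$, $yx\in A$ for all $x\in\mathsf{X},y\in\mathsf{Y},a\in A$ (products are compositions). For such a module, $$\mathcal{L}_A(\mathsf{Y},\mathsf{X})=\{t\in\mathcal{L}(L^p(\mu_1))\colon tx\in\mathsf{X}\text{ and }yt\in\mathsf{Y}\text{ for all }x\in\mathsf{X},y\in\mathsf{Y}\},$$ $$\mathcal{K}_A(\mathsf{Y},\mathsf{X})=\overline{\mathrm{span}}\{\theta_{x,y}\colon x\in\mathsf{X},y\in\mathsf{Y}\}\subseteq\mathcal{L}(L^p(\mu_1)),\qquad\theta_{x,y}=xy.$$ Tensor products: $L^p(\nu)\otimes_pL^p(\mu)=L^p(\nu\times\mu)$ with $(\zeta\otimes\xi)(s,t)=\zeta(s)\xi(t)$; for bounded operators $a,b$ between $L^p$-spaces, $a\otimes b$ is the bounded operator with $(a\otimes b)(\xi\otimes\eta)=a\xi\otimes b\eta$; for spaces $\mathsf{V},\mathsf{X}$ of operators between $L^p$-spaces, $\mathsf{V}\otimes_p\mathsf{X}$ is the operator-norm closed linear span of all $v\otimes x$. Regard $\zeta\in\ell^p$ as the operator $\mathbb{C}=\ell_1^p\to\ell^p$, $z\mapsto z\zeta$, and $\upsilon\in\ell^q$ as the operator $\ell^p\to\mathbb{C}$, $\zeta\mapsto\sum_j\upsilon(j)\zeta(j)$. Thus $\ell^p\otimes_pA\subseteq\mathcal{L}(L^p(\mu),L^p(\nu\times\mu))$,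 $\ell^q\otimes_pA\subseteq\mathcal{L}(L^p(\nu\times\mu),L^p(\mu))$ and $\mathcal{K}(\ell^p)\otimes_pA\subseteq\mathcal{L}(L^p(\nu\times\mu))$; the pair $(\ell^q\otimes_pA,\ell^p\otimes_pA)$ is an $L^p$-module over $A$ (the standard $L^p$-module of $A$, with $\mu_0=\mu$, $\mu_1=\nu\times\mu$). $M(B)$ is the multiplier algebra of a Banach algebra $B$, defined as the algebra of double centralizers. For a nondegenerate $L^p$-operator algebra $B\subseteq\mathcal{L}(E)$ ($E$ an $L^p$-space) with a contractive approximate identity, $M(B)$ is identified isometrically with $\{t\in\mathcal{L}(E)\colon tb\in B,\ bt\in B\text{ for all }b\in B\}$, with $t$ corresponding to the double centralizer $(b\mapsto tb,\ b\mapsto bt)$. The second equality in the claim is under this identification. *)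

theory Defs
  imports "HOL-Analysis.Analysis"
begin

section \<open>Complex normed spaces and algebras on explicit carriers\<close>

text \<open>
  The space \<open>L\<^sup>p(\<mu>)\<close> depends on the term \<open>\<mu>\<close>, so it cannot be a type.  Normed spaces and algebras
  are therefore records with a carrier; an operator is a function that is \<open>undefined\<close> outside the
  carrier of its domain, so that equality of operators is equality of functions.
\<close>

record 'v nspace =
  carr :: "'v set"
  vadd :: "'v \<Rightarrow> 'v \<Rightarrow> 'v"
  vzero :: 'v
  vscale :: "complex \<Rightarrow> 'v \<Rightarrow> 'v"
  vnorm :: "'v \<Rightarrow> real"

record 'v nalg = "'v nspace" +
  amult :: "'v \<Rightarrow> 'v \<Rightarrow> 'v"

definition vdiff :: "('v, 'x) nspace_scheme \<Rightarrow> 'v \<Rightarrow> 'v \<Rightarrow> 'v" where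
  "vdiff E u v = vadd E u (vscale E (-1) v)"

text \<open>The locale \<^locale>\<open>Metric_space\<close> constrains the distance outside the carrier as well (it has to be
  nonnegative and symmetric there), hence the case distinction.\<close>

definition vdist :: "('v, 'x) nspace_scheme \<Rightarrow> 'v \<Rightarrow> 'v \<Rightarrow> real" where
  "vdist E u v = (if u \<in> carr E \<and> v \<in> carr E then vnorm E (vdiff E u v) else 0)"

definition norm_topology :: "('v, 'x) nspace_scheme \<Rightarrow> 'v topology" where
  "norm_topology E = Metric_space.mtopology (carr E) (vdist E)"

definition linear_subspace :: "('v, 'x) nspace_scheme \<Rightarrow> 'v set \<Rightarrow> bool" where
  "linear_subspace E W \<longleftrightarrow> W \<subseteq> carr E \<and> vzero E \<in> W \<and>
     (\<forall>u\<in>W. \<forall>v\<in>W. vadd E u v \<in> W) \<and> (\<forall>c. \<forall>u\<in>W. vscale E c u \<in> W)"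

definition closed_span :: "('v, 'x) nspace_scheme \<Rightarrow> 'v set \<Rightarrow> 'v set" where
  "closed_span E S = norm_topology E closure_of (linear_subspace E hull S)"

definition complex_space :: "complex nspace" where
  "complex_space = \<lparr>carr = UNIV, vadd = (+), vzero = 0, vscale = (*), vnorm = norm\<rparr>"


section \<open>Bounded operators\<close>

definition bounded_linear_maps ::
    "('v, 'x) nspace_scheme \<Rightarrow> ('w, 'y) nspace_scheme \<Rightarrow> ('v \<Rightarrow> 'w) set" where
  "bounded_linear_maps E F = {T \<in> carr E \<rightarrow>\<^sub>E carr F.
     (\<forall>u\<in>carr E. \<forall>v\<in>carr E. T (vadd E u v) = vadd F (T u) (T v)) \<and>
     (\<forall>c. \<forall>u\<in>carr E. T (vscale E c u) = vscale F c (T u)) \<and>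
     (\<exists>C. \<forall>u\<in>carr E. vnorm F (T u) \<le> C * vnorm E u)}"

definition Lop :: "('v, 'x) nspace_scheme \<Rightarrow> ('w, 'y) nspace_scheme \<Rightarrow> ('v \<Rightarrow> 'w) nspace" where
  "Lop E F =
    \<lparr>carr = bounded_linear_maps E F,
     vadd = (\<lambda>S T. \<lambda>u\<in>carr E. vadd F (S u) (T u)),
     vzero = (\<lambda>u\<in>carr E. vzero F),
     vscale = (\<lambda>c T. \<lambda>u\<in>carr E. vscale F c (T u)),
     vnorm = (\<lambda>T. SUP u\<in>{u \<in> carr E. vnorm E u \<le> 1}. vnorm F (T u))\<rparr>"

definition op_algebra :: "('v, 'x) nspace_scheme \<Rightarrow> ('v \<Rightarrow> 'v) nalg" where
  "op_algebra E = nspace.extend (Lop E E) \<lparr>amult = compose (carr E)\<rparr>"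

definition compact_operators :: "('v, 'x) nspace_scheme \<Rightarrow> ('v \<Rightarrow> 'v) set" where
  "compact_operators E = {T \<in> carr (Lop E E).
     compactin (norm_topology E)
       (norm_topology E closure_of (T ` {u \<in> carr E. vnorm E u \<le> 1}))}"

definition closed_subalgebra :: "('v, 'x) nalg_scheme \<Rightarrow> 'v set \<Rightarrow> bool" where
  "closed_subalgebra B A \<longleftrightarrow> linear_subspace B A \<and> closedin (norm_topology B) A \<and>
     (\<forall>a\<in>A. \<forall>b\<in>A. amult B a b \<in> A)"

text \<open>Nets are rendered, as usual, as families along a nontrivial filter on the index type.\<close>

definition contractive_approximate_identity ::
    "('v, 'x) nalg_scheme \<Rightarrow> 'v set \<Rightarrow> ('i \<Rightarrow> 'v) \<Rightarrow> 'i filter \<Rightarrow> bool" where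
  "contractive_approximate_identity B A e \<F> \<longleftrightarrow> \<F> \<noteq> bot \<and>
     (\<forall>i. e i \<in> A \<and> vnorm B (e i) \<le> 1) \<and>
     (\<forall>a\<in>A. ((\<lambda>i. vnorm B (vdiff B (amult B a (e i)) a)) \<longlongrightarrow> 0) \<F> \<and>
            ((\<lambda>i. vnorm B (vdiff B (amult B (e i) a) a)) \<longlongrightarrow> 0) \<F>)"

definition nondegenerate :: "('v, 'x) nspace_scheme \<Rightarrow> ('v \<Rightarrow> 'v) set \<Rightarrow> bool" where
  "nondegenerate E A \<longleftrightarrow> closed_span E {a u | a u. a \<in> A \<and> u \<in> carr E} = carr E"


section \<open>Multiplier algebras\<close>

definition double_centralizers :: "('v, 'x) nalg_scheme \<Rightarrow> (('v \<Rightarrow> 'v) \<times> ('v \<Rightarrow> 'v)) set" where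
  "double_centralizers B = {(L, R). L \<in> carr (Lop B B) \<and> R \<in> carr (Lop B B) \<and>
     (\<forall>a\<in>carr B. \<forall>b\<in>carr B.
        L (amult B a b) = amult B (L a) b \<and>
        R (amult B a b) = amult B a (R b) \<and>
        amult B a (L b) = amult B (R a) b)}"

definition multiplier_algebra :: "('v, 'x) nalg_scheme \<Rightarrow> (('v \<Rightarrow> 'v) \<times> ('v \<Rightarrow> 'v)) nalg" where
  "multiplier_algebra B =
    \<lparr>carr = double_centralizers B,
     vadd = (\<lambda>(L, R) (L', R'). (vadd (Lop B B) L L', vadd (Lop B B) R R')),
     vzero = (vzero (Lop B B), vzero (Lop B B)),
     vscale = (\<lambda>c (L, R). (vscale (Lop B B) c L, vscale (Lop B B) c R)),
     vnorm = (\<lambda>(L, R). max (vnorm (Lop B B) L) (vnorm (Lop B B) R)),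
     amult = (\<lambda>(L, R) (L', R'). (compose (carr B) L L', compose (carr B) R' R))\<rparr>"

definition isometric_algebra_iso ::
    "('v \<Rightarrow> 'w) \<Rightarrow> ('v, 'x) nalg_scheme \<Rightarrow> ('w, 'y) nalg_scheme \<Rightarrow> bool" where
  "isometric_algebra_iso \<Phi> B C \<longleftrightarrow> bij_betw \<Phi> (carr B) (carr C) \<and>
     (\<forall>s\<in>carr B. \<forall>t\<in>carr B. \<Phi> (vadd B s t) = vadd C (\<Phi> s) (\<Phi> t)) \<and>
     (\<forall>c. \<forall>s\<in>carr B. \<Phi> (vscale B c s) = vscale C c (\<Phi> s)) \<and>
     (\<forall>s\<in>carr B. \<forall>t\<in>carr B. \<Phi> (amult B s t) = amult C (\<Phi> s) (\<Phi> t)) \<and>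
     (\<forall>s\<in>carr B. vnorm C (\<Phi> s) = vnorm B s)"

definition spatial_multipliers :: "('v, 'x) nspace_scheme \<Rightarrow> ('v \<Rightarrow> 'v) set \<Rightarrow> ('v \<Rightarrow> 'v) set" where
  "spatial_multipliers E B = {t \<in> carr (Lop E E).
     \<forall>b\<in>B. compose (carr E) t b \<in> B \<and> compose (carr E) b t \<in> B}"

definition centralizer_of ::
    "('v, 'x) nspace_scheme \<Rightarrow> ('v \<Rightarrow> 'v) set \<Rightarrow> ('v \<Rightarrow> 'v)
      \<Rightarrow> (('v \<Rightarrow> 'v) \<Rightarrow> ('v \<Rightarrow> 'v)) \<times> (('v \<Rightarrow> 'v) \<Rightarrow> ('v \<Rightarrow> 'v))" where
  "centralizer_of E B t = (\<lambda>b\<in>B. compose (carr E) t b, \<lambda>b\<in>B. compose (carr E) b t)"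


section \<open>The spaces \<open>L\<^sup>p(\<mu>)\<close>\<close>

definition Lp_fun :: "real \<Rightarrow> 'a measure \<Rightarrow> ('a \<Rightarrow> complex) set" where
  "Lp_fun p M = {f \<in> borel_measurable M. integrable M (\<lambda>x. norm (f x) powr p)}"

definition ae_eq :: "real \<Rightarrow> 'a measure \<Rightarrow> (('a \<Rightarrow> complex) \<times> ('a \<Rightarrow> complex)) set" where
  "ae_eq p M = {(f, g). f \<in> Lp_fun p M \<and> g \<in> Lp_fun p M \<and> (AE x in M. f x = g x)}"

definition Lp_class :: "real \<Rightarrow> 'a measure \<Rightarrow> ('a \<Rightarrow> complex) \<Rightarrow> ('a \<Rightarrow> complex) set" where
  "Lp_class p M f = ae_eq p M `` {f}"

definition rep :: "('a \<Rightarrow> complex) set \<Rightarrow> 'a \<Rightarrow> complex" where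
  "rep u = (SOME f. f \<in> u)"

definition Lp :: "real \<Rightarrow> 'a measure \<Rightarrow> ('a \<Rightarrow> complex) set nspace" where
  "Lp p M =
    \<lparr>carr = Lp_fun p M // ae_eq p M,
     vadd = (\<lambda>u v. Lp_class p M (\<lambda>x. rep u x + rep v x)),
     vzero = Lp_class p M (\<lambda>x. 0),
     vscale = (\<lambda>c u. Lp_class p M (\<lambda>x. c * rep u x)),
     vnorm = (\<lambda>u. (LINT x|M. norm (rep u x) powr p) powr (1 / p))\<rparr>"

type_synonym ('a, 'b) Lp_op = "('a \<Rightarrow> complex) set \<Rightarrow> ('b \<Rightarrow> complex) set"

definition Lp_operator_algebra :: "real \<Rightarrow> 'a measure \<Rightarrow> ('a, 'a) Lp_op set \<Rightarrow> bool" where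
  "Lp_operator_algebra p M A \<longleftrightarrow> closed_subalgebra (op_algebra (Lp p M)) A"


section \<open>Tensor products\<close>

text \<open>A tensor decomposition of \<open>tspace\<close>: \<open>tensor\<close> maps \<open>(\<zeta>, \<xi>)\<close> to \<open>\<zeta> \<otimes> \<xi>\<close>.\<close>

record ('u, 'v, 'w) tdecomp =
  lfactor :: "'u nspace"
  rfactor :: "'v nspace"
  tspace :: "'w nspace"
  tensor :: "'u \<Rightarrow> 'v \<Rightarrow> 'w"

text \<open>
  Below, the left factor \<open>M\<close> is always a counting measure.  The library's product measure is then the
  sum of the measures of the slices, and no sigma-finiteness of \<open>N\<close> is needed.
\<close>

definition Lp_tdecomp :: "real \<Rightarrow> 'a measure \<Rightarrow> 'b measure
    \<Rightarrow> (('a \<Rightarrow> complex) set, ('b \<Rightarrow> complex) set, ('a \<times> 'b \<Rightarrow> complex) set) tdecomp" where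
  "Lp_tdecomp p M N =
    \<lparr>lfactor = Lp p M, rfactor = Lp p N, tspace = Lp p (M \<Otimes>\<^sub>M N),
     tensor = (\<lambda>u v. Lp_class p (M \<Otimes>\<^sub>M N) (\<lambda>(s, t). rep u s * rep v t))\<rparr>"

text \<open>The identification of \<open>\<complex> \<otimes> E\<close> with \<open>E\<close>.\<close>

definition scalar_tdecomp :: "'v nspace \<Rightarrow> (complex, 'v, 'v) tdecomp" where
  "scalar_tdecomp E =
    \<lparr>lfactor = complex_space, rfactor = E, tspace = E, tensor = vscale E\<rparr>"

definition op_tensor :: "('u, 'v, 'w) tdecomp \<Rightarrow> ('u', 'v', 'w') tdecomp
    \<Rightarrow> ('u \<Rightarrow> 'u') \<Rightarrow> ('v \<Rightarrow> 'v') \<Rightarrow> ('w \<Rightarrow> 'w')" where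
  "op_tensor D D' a b = (THE t. t \<in> carr (Lop (tspace D) (tspace D')) \<and>
     (\<forall>\<xi>\<in>carr (lfactor D). \<forall>\<eta>\<in>carr (rfactor D). t (tensor D \<xi> \<eta>) = tensor D' (a \<xi>) (b \<eta>)))"

definition space_tensor :: "('u, 'v, 'w) tdecomp \<Rightarrow> ('u', 'v', 'w') tdecomp
    \<Rightarrow> ('u \<Rightarrow> 'u') set \<Rightarrow> ('v \<Rightarrow> 'v') set \<Rightarrow> ('w \<Rightarrow> 'w') set" where
  "space_tensor D D' V X =
     closed_span (Lop (tspace D) (tspace D')) {op_tensor D D' v x | v x. v \<in> V \<and> x \<in> X}"


section \<open>Adjointable and compact module operators\<close>

text \<open>In both definitions \<open>E\<close> is \<open>L\<^sup>p(\<mu>\<^sub>0)\<close>, on which the coefficient algebra acts, and \<open>F\<close> is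
  \<open>L\<^sup>p(\<mu>\<^sub>1)\<close>; \<open>Y\<close> consists of operators from \<open>F\<close> to \<open>E\<close> and \<open>X\<close> of operators from \<open>E\<close> to \<open>F\<close>.\<close>

definition module_adjointables ::
    "'v nspace \<Rightarrow> 'w nspace \<Rightarrow> ('w \<Rightarrow> 'v) set \<Rightarrow> ('v \<Rightarrow> 'w) set \<Rightarrow> ('w \<Rightarrow> 'w) set" where
  "module_adjointables E F Y X = {t \<in> carr (Lop F F).
     \<forall>x\<in>X. \<forall>y\<in>Y. compose (carr E) t x \<in> X \<and> compose (carr F) y t \<in> Y}"

definition module_compacts ::
    "'v nspace \<Rightarrow> 'w nspace \<Rightarrow> ('w \<Rightarrow> 'v) set \<Rightarrow> ('v \<Rightarrow> 'w) set \<Rightarrow> ('w \<Rightarrow> 'w) set" where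
  "module_compacts E F Y X =
     closed_span (Lop F F) {compose (carr F) x y | x y. x \<in> X \<and> y \<in> Y}"


section \<open>The standard module\<close>

definition counting :: "nat measure" where
  "counting = count_space {1..}"

abbreviation ellp :: "real \<Rightarrow> (nat \<Rightarrow> complex) set nspace" where
  "ellp p \<equiv> Lp p counting"

definition ellq :: "ennreal \<Rightarrow> (nat \<Rightarrow> complex) set" where
  "ellq q = {\<upsilon>. if q = top then bounded (\<upsilon> ` {1..})
                else (\<lambda>j. norm (\<upsilon> j) powr enn2real q) summable_on {1..}}"

definition column_op :: "real \<Rightarrow> (nat \<Rightarrow> complex) set \<Rightarrow> complex \<Rightarrow> (nat \<Rightarrow> complex) set" where
  "column_op p \<zeta> = (\<lambda>z. vscale (ellp p) z \<zeta>)"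

definition row_op :: "real \<Rightarrow> (nat \<Rightarrow> complex) \<Rightarrow> (nat \<Rightarrow> complex) set \<Rightarrow> complex" where
  "row_op p \<upsilon> = (\<lambda>\<zeta>\<in>carr (ellp p). \<Sum>\<^sub>\<infinity>j\<in>{1..}. \<upsilon> j * rep \<zeta> j)"

definition ellp_tensor ::
    "real \<Rightarrow> 'a measure \<Rightarrow> ('a, 'a) Lp_op set \<Rightarrow> ('a, nat \<times> 'a) Lp_op set" where
  "ellp_tensor p \<mu> A = space_tensor (scalar_tdecomp (Lp p \<mu>)) (Lp_tdecomp p counting \<mu>)
     (column_op p ` carr (ellp p)) A"

definition ellq_tensor ::
    "real \<Rightarrow> ennreal \<Rightarrow> 'a measure \<Rightarrow> ('a, 'a) Lp_op set \<Rightarrow> (nat \<times> 'a, 'a) Lp_op set" where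
  "ellq_tensor p q \<mu> A = space_tensor (Lp_tdecomp p counting \<mu>) (scalar_tdecomp (Lp p \<mu>))
     (row_op p ` ellq q) A"

definition compact_tensor ::
    "real \<Rightarrow> 'a measure \<Rightarrow> ('a, 'a) Lp_op set \<Rightarrow> (nat \<times> 'a, nat \<times> 'a) Lp_op set" where
  "compact_tensor p \<mu> A = space_tensor (Lp_tdecomp p counting \<mu>) (Lp_tdecomp p counting \<mu>)
     (compact_operators (ellp p)) A"

end

theory Submission
  imports Defs
begin

text \<open>
  For \<open>\<zeta> \<in> \<ell>\<^sup>p\<close> and \<open>\<upsilon> \<in> \<ell>\<^sup>q\<close> one has
  \<open>(\<zeta> \<otimes> a)(\<upsilon> \<otimes> b) = \<zeta>\<upsilon> \<otimes> ab\<close>, where \<open>\<zeta>\<upsilon>\<close> has rank one.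
  A compact operator \<open>k\<close> on \<open>\<ell>\<^sup>p\<close> is the norm limit of \<open>P\<^sub>n k\<close>, where \<open>P\<^sub>n\<close> cuts off
  after \<open>n\<close> coordinates, and the rows of \<open>k\<close> lie in \<open>\<ell>\<^sup>q\<close> by the converse of Hoelder's
  inequality. Since the approximate identity \<open>(e\<^sub>i)\<close> makes every \<open>a\<close> a limit of products, both algebras
  in the first claim are the closed span of the operators \<open>\<zeta>\<upsilon> \<otimes> a\<close>.

  Let \<open>B\<close> be this algebra, and \<open>(Y, X)\<close> the standard module. A \<open>t\<close> that multiplies \<open>X\<close> and
  \<open>Y\<close> into themselves does so for \<open>B\<close>, the closed span of \<open>XY\<close>; the converse follows from factorizations such
  as \<open>\<zeta> \<otimes> e\<^sub>i a = (\<zeta>\<delta>\<^sub>1 \<otimes> e\<^sub>i)(\<delta>\<^sub>1 \<otimes> a)\<close> and \<open>BX \<subseteq> X\<close>.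

  The operators \<open>P\<^sub>n \<otimes> e\<^sub>i\<close> form a contractive left approximate identity of \<open>B\<close> and, when \<open>A\<close> is
  nondegenerate, converge strongly to the identity. That suffices to implement every double centralizer
  \<open>(L, R)\<close> by the strong limit of the operators \<open>L (P\<^sub>n \<otimes> e\<^sub>i)\<close>; a right approximate identity,
  which the \<open>P\<^sub>n \<otimes> e\<^sub>i\<close> do not give for \<open>p = 1\<close>, is never used.
\<close>

section \<open>Complex normed spaces on carriers and their operators\<close>

text \<open>\<open>op_tensor\<close> is a definite description, so a tensor operator can be computed
  with only after existence and uniqueness are shown. For existence, \<open>k\<close> tensor
  \<open>a\<close> is split into \<open>k\<close> tensor 1, acting on the columns
  \<open>f(., t)\<close> by the matrix of \<open>k\<close>, and 1 tensor \<open>a\<close>, acting on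
  the slices \<open>f(j, .)\<close>. As there are countably many slices, integrals and null sets
  pass between the two views for arbitrary \<open>\<mu>\<close>. Uniqueness is density of the
  elementary tensors, which also reduces every product formula to a check on them.

  Passage from generators to closed spans works because the set where a property holds is a closed
  subspace. For strong convergence this takes a uniform bound, supplied by contractivity.

  The asymmetry of left and right comes from the dual of \<open>l^1\<close>, which is
  \<open>l^\<infinity>\<close>: the functional summing all coordinates stays at distance 1 from each
  of its truncations, so \<open>k P_n\<close> need not tend to \<open>k\<close>. On the left,
  \<open>P_n k\<close> tends to \<open>k\<close> for compact \<open>k\<close>, because strong
  convergence of contractions is uniform on the relatively compact image of the unit ball.\<close>

locale cnspace =
  fixes E :: "('v, 'x) nspace_scheme"
  assumes add_closed [simp, intro]: "u \<in> carr E \<Longrightarrow> v \<in> carr E \<Longrightarrow> vadd E u v \<in> carr E"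
    and zero_closed [simp, intro]: "vzero E \<in> carr E"
    and scale_closed [simp, intro]: "u \<in> carr E \<Longrightarrow> vscale E c u \<in> carr E"
    and add_assoc: "u \<in> carr E \<Longrightarrow> v \<in> carr E \<Longrightarrow> w \<in> carr E \<Longrightarrow>
      vadd E (vadd E u v) w = vadd E u (vadd E v w)"
    and add_commute: "u \<in> carr E \<Longrightarrow> v \<in> carr E \<Longrightarrow> vadd E u v = vadd E v u"
    and add_zero [simp]: "u \<in> carr E \<Longrightarrow> vadd E u (vzero E) = u"
    and scale_add_right: "u \<in> carr E \<Longrightarrow> v \<in> carr E \<Longrightarrow>
      vscale E c (vadd E u v) = vadd E (vscale E c u) (vscale E c v)"
    and scale_add_left: "u \<in> carr E \<Longrightarrow>
      vscale E (c + d) u = vadd E (vscale E c u) (vscale E d u)"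
    and scale_scale [simp]: "u \<in> carr E \<Longrightarrow> vscale E c (vscale E d u) = vscale E (c * d) u"
    and scale_one [simp]: "u \<in> carr E \<Longrightarrow> vscale E 1 u = u"
    and scale_zero [simp]: "u \<in> carr E \<Longrightarrow> vscale E 0 u = vzero E"
    and norm_scale: "u \<in> carr E \<Longrightarrow> vnorm E (vscale E c u) = norm c * vnorm E u"
    and norm_triangle: "u \<in> carr E \<Longrightarrow> v \<in> carr E \<Longrightarrow>
      vnorm E (vadd E u v) \<le> vnorm E u + vnorm E v"
    and norm_eq_zeroD: "u \<in> carr E \<Longrightarrow> vnorm E u = 0 \<Longrightarrow> u = vzero E"
begin

lemma add_left_commute: "u \<in> carr E \<Longrightarrow> v \<in> carr E \<Longrightarrow> w \<in> carr E \<Longrightarrow>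
    vadd E u (vadd E v w) = vadd E v (vadd E u w)"
  by (metis add_assoc add_commute)

lemmas add_ac = add_assoc add_commute add_left_commute

lemma zero_add [simp]: "u \<in> carr E \<Longrightarrow> vadd E (vzero E) u = u"
  by (metis add_commute add_zero zero_closed)

lemma scale_vzero [simp]: "vscale E c (vzero E) = vzero E"
  by (metis mult_zero_right scale_scale scale_zero zero_closed)

lemma diff_closed [simp, intro]: "u \<in> carr E \<Longrightarrow> v \<in> carr E \<Longrightarrow> vdiff E u v \<in> carr E"
  by (simp add: vdiff_def)

lemma add_neg [simp]: "u \<in> carr E \<Longrightarrow> vadd E u (vscale E (-1) u) = vzero E"
  using scale_add_left[of u 1 "-1"] by simp

lemma add_add_neg [simp]: "u \<in> carr E \<Longrightarrow> v \<in> carr E \<Longrightarrow>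
    vadd E u (vadd E (vscale E (-1) u) v) = v"
  by (metis add_assoc add_neg scale_closed zero_add)

lemma diff_self [simp]: "u \<in> carr E \<Longrightarrow> vdiff E u u = vzero E"
  by (simp add: vdiff_def)

lemma diff_zero [simp]: "u \<in> carr E \<Longrightarrow> vdiff E u (vzero E) = u"
  by (simp add: vdiff_def)

lemma add_diff_cancel: "u \<in> carr E \<Longrightarrow> v \<in> carr E \<Longrightarrow> vadd E v (vdiff E u v) = u"
  by (simp add: vdiff_def add_left_commute)

lemma diff_add_diff: "u \<in> carr E \<Longrightarrow> v \<in> carr E \<Longrightarrow> w \<in> carr E \<Longrightarrow>
    vadd E (vdiff E u v) (vdiff E v w) = vdiff E u w"
proof -
  assume *: "u \<in> carr E" "v \<in> carr E" "w \<in> carr E"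
  have "vadd E (vdiff E u v) (vdiff E v w)
      = vadd E (vadd E v (vscale E (-1) v)) (vadd E u (vscale E (-1) w))"
    using * by (simp add: vdiff_def add_ac del: add_neg add_add_neg)
  then show ?thesis using * by (simp add: vdiff_def)
qed

lemma diff_add_add: "u \<in> carr E \<Longrightarrow> v \<in> carr E \<Longrightarrow> u' \<in> carr E \<Longrightarrow> v' \<in> carr E \<Longrightarrow>
    vdiff E (vadd E u v) (vadd E u' v') = vadd E (vdiff E u u') (vdiff E v v')"
  by (simp add: vdiff_def scale_add_right add_ac)

lemma diff_scale: "u \<in> carr E \<Longrightarrow> v \<in> carr E \<Longrightarrow>
    vdiff E (vscale E c u) (vscale E c v) = vscale E c (vdiff E u v)"
  by (simp add: vdiff_def scale_add_right)

lemma scale_minus_diff: "u \<in> carr E \<Longrightarrow> v \<in> carr E \<Longrightarrow>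
    vscale E (-1) (vdiff E u v) = vdiff E v u"
  by (simp add: vdiff_def scale_add_right add_commute)

lemma norm_zero [simp]: "vnorm E (vzero E) = 0"
  using norm_scale[of "vzero E" 0] by simp

lemma norm_diff_commute: "u \<in> carr E \<Longrightarrow> v \<in> carr E \<Longrightarrow>
    vnorm E (vdiff E u v) = vnorm E (vdiff E v u)"
  using norm_scale[of "vdiff E u v" "-1"] by (simp add: scale_minus_diff)

lemma norm_nonneg [simp]: "u \<in> carr E \<Longrightarrow> 0 \<le> vnorm E u"
  using norm_triangle[of u "vscale E (-1) u"] norm_scale[of u "-1"] by simp

lemma norm_diff_triangle: "u \<in> carr E \<Longrightarrow> v \<in> carr E \<Longrightarrow> w \<in> carr E \<Longrightarrow>
    vnorm E (vdiff E u w) \<le> vnorm E (vdiff E u v) + vnorm E (vdiff E v w)"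
  by (metis diff_add_diff diff_closed norm_triangle)

lemma norm_le_add_diff: "u \<in> carr E \<Longrightarrow> v \<in> carr E \<Longrightarrow>
    vnorm E u \<le> vnorm E v + vnorm E (vdiff E u v)"
  by (metis add_diff_cancel diff_closed norm_triangle)

lemma eq_if_norm_diff: "u \<in> carr E \<Longrightarrow> v \<in> carr E \<Longrightarrow> vnorm E (vdiff E u v) = 0 \<Longrightarrow> u = v"
  by (metis add_diff_cancel add_zero diff_closed norm_eq_zeroD)

lemma eq_if_norm_diff_le:
  assumes "u \<in> carr E" "v \<in> carr E" "\<And>\<epsilon>. \<epsilon> > 0 \<Longrightarrow> vnorm E (vdiff E u v) \<le> \<epsilon>"
  shows "u = v"
proof (rule eq_if_norm_diff[OF assms(1,2)])
  have "vnorm E (vdiff E u v) \<le> 0"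
    by (rule field_le_epsilon) (use assms(3) in simp)
  then show "vnorm E (vdiff E u v) = 0"
    using norm_nonneg[OF diff_closed[OF assms(1,2)]] by linarith
qed

lemma metric: "Metric_space (carr E) (vdist E)"
proof
  fix x y z
  show "0 \<le> vdist E x y" by (simp add: vdist_def)
  show "vdist E x y = vdist E y x" by (simp add: vdist_def norm_diff_commute)
  show "vdist E x y = 0 \<longleftrightarrow> x = y" if "x \<in> carr E" "y \<in> carr E"
    using that eq_if_norm_diff by (auto simp: vdist_def)
  show "vdist E x z \<le> vdist E x y + vdist E y z"
    if "x \<in> carr E" "y \<in> carr E" "z \<in> carr E"
    using that norm_diff_triangle by (auto simp: vdist_def)
qed

lemma closure_of_iff: "S \<subseteq> carr E \<Longrightarrow> u \<in> norm_topology E closure_of S \<longleftrightarrow>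
    u \<in> carr E \<and> (\<forall>\<epsilon>>0. \<exists>s\<in>S. vnorm E (vdiff E u s) < \<epsilon>)"
  unfolding norm_topology_def Metric_space.metric_closure_of[OF metric]
  by (fastforce simp: Metric_space.in_mball[OF metric] vdist_def)

lemma topspace_norm_topology [simp]: "topspace (norm_topology E) = carr E"
  unfolding norm_topology_def by (simp add: Metric_space.topspace_mtopology[OF metric])

lemma closedin_iff: "W \<subseteq> carr E \<Longrightarrow> closedin (norm_topology E) W \<longleftrightarrow>
    (\<forall>u\<in>carr E. (\<forall>\<epsilon>>0. \<exists>w\<in>W. vnorm E (vdiff E u w) < \<epsilon>) \<longrightarrow> u \<in> W)"
proof -
  assume W: "W \<subseteq> carr E"
  have "closedin (norm_topology E) W \<longleftrightarrow> norm_topology E closure_of W \<subseteq> W"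
    using closure_of_subset_eq[of W "norm_topology E"] W by simp
  then show ?thesis unfolding subset_iff closure_of_iff[OF W] by blast
qed

lemma subset_carr: "linear_subspace E W \<Longrightarrow> W \<subseteq> carr E"
  by (simp add: linear_subspace_def)

end

section \<open>Closed subspaces and norm limits along filters\<close>

definition closed_subspace :: "('v, 'x) nspace_scheme \<Rightarrow> 'v set \<Rightarrow> bool" where
  "closed_subspace E W \<longleftrightarrow> linear_subspace E W \<and> closedin (norm_topology E) W"

text \<open>Stated through the norm alone, without carrier or topology, so that passing to a
  subalgebra with the same operations leaves the notion unchanged (\<open>vlim_BB\<close>).\<close>

definition vlim :: "('v, 'x) nspace_scheme \<Rightarrow> ('i \<Rightarrow> 'v) \<Rightarrow> 'v \<Rightarrow> 'i filter \<Rightarrow> bool" where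
  "vlim E x l G \<longleftrightarrow> ((\<lambda>i. vnorm E (vdiff E (x i) l)) \<longlongrightarrow> 0) G"

context cnspace
begin

lemma closed_subspaceI:
  assumes "linear_subspace E W"
    and "\<And>u. u \<in> carr E \<Longrightarrow> (\<And>\<epsilon>. \<epsilon> > 0 \<Longrightarrow> \<exists>w\<in>W. vnorm E (vdiff E u w) < \<epsilon>) \<Longrightarrow> u \<in> W"
  shows "closed_subspace E W"
  using assms subset_carr[OF assms(1)] by (auto simp: closed_subspace_def closedin_iff)

lemma closed_subspaceD:
  assumes "closed_subspace E W" "u \<in> carr E"
    and "\<And>\<epsilon>. \<epsilon> > 0 \<Longrightarrow> \<exists>w\<in>W. vnorm E (vdiff E u w) < \<epsilon>"
  shows "u \<in> W"
  using assms subset_carr[of W] by (auto simp: closed_subspace_def closedin_iff)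

lemma closed_span_props:
  assumes "S \<subseteq> carr E"
  shows closed_subspace_closed_span: "closed_subspace E (closed_span E S)"
    and closed_span_superset: "S \<subseteq> closed_span E S"
proof -
  let ?H = "linear_subspace E hull S"
  have sub: "linear_subspace E ?H"
  proof -
    have H: "u \<in> ?H \<longleftrightarrow> (\<forall>t. linear_subspace E t \<longrightarrow> S \<subseteq> t \<longrightarrow> u \<in> t)" for u
      by (auto simp: hull_def)
    have "linear_subspace E (carr E)" by (simp add: linear_subspace_def)
    then have "?H \<subseteq> carr E" using H assms by blast
    moreover have "vadd E u v \<in> ?H" if "u \<in> ?H" "v \<in> ?H" for u v
      using that by (simp add: H) (simp add: linear_subspace_def)
    moreover have "vscale E c u \<in> ?H" if "u \<in> ?H" for c u
      using that by (simp add: H) (simp add: linear_subspace_def)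
    moreover have "vzero E \<in> ?H" by (simp add: H) (simp add: linear_subspace_def)
    ultimately show ?thesis by (simp add: linear_subspace_def[of E ?H])
  qed
  have Hc: "?H \<subseteq> carr E" using sub subset_carr by blast
  have Scl: "?H \<subseteq> closed_span E S"
    unfolding closed_span_def by (rule closure_of_subset) (simp add: Hc)
  then show "S \<subseteq> closed_span E S"
    using hull_subset[of S "linear_subspace E"] by blast
  have mem: "u \<in> closed_span E S \<longleftrightarrow>
      u \<in> carr E \<and> (\<forall>\<epsilon>>0. \<exists>s\<in>?H. vnorm E (vdiff E u s) < \<epsilon>)" for u
    unfolding closed_span_def using closure_of_iff[OF Hc] by simp
  have "linear_subspace E (closed_span E S)"
    unfolding linear_subspace_def
  proof (intro conjI ballI allI)
    show "closed_span E S \<subseteq> carr E" using mem by blast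
    show "vzero E \<in> closed_span E S"
      using sub Scl by (auto simp: linear_subspace_def)
  next
    fix u v assume uv: "u \<in> closed_span E S" "v \<in> closed_span E S"
    have "\<exists>s\<in>?H. vnorm E (vdiff E (vadd E u v) s) < \<epsilon>" if "\<epsilon> > 0" for \<epsilon>
    proof -
      obtain s t where st: "s \<in> ?H" "vnorm E (vdiff E u s) < \<epsilon>/2" "t \<in> ?H" "vnorm E (vdiff E v t) < \<epsilon>/2"
        using uv half_gt_zero[OF \<open>\<epsilon> > 0\<close>] unfolding mem by blast
      have c: "u \<in> carr E" "v \<in> carr E" "s \<in> carr E" "t \<in> carr E"
        using uv st mem Hc by auto
      have "vnorm E (vdiff E (vadd E u v) (vadd E s t)) < \<epsilon>"
        using norm_triangle[of "vdiff E u s" "vdiff E v t"] c st by (simp add: diff_add_add)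
      then show ?thesis using sub st by (auto simp: linear_subspace_def)
    qed
    then show "vadd E u v \<in> closed_span E S" using uv mem by auto
  next
    fix c u assume u: "u \<in> closed_span E S"
    have "\<exists>s\<in>?H. vnorm E (vdiff E (vscale E c u) s) < \<epsilon>" if "\<epsilon> > 0" for \<epsilon>
    proof -
      \<comment> \<open>The added 1 covers \<open>c = 0\<close>.\<close>
      have "\<epsilon> / (norm c + 1) > 0" using that by (simp add: add_nonneg_pos)
      then obtain s where s: "s \<in> ?H" "vnorm E (vdiff E u s) < \<epsilon> / (norm c + 1)"
        using u mem by blast
      have cc: "u \<in> carr E" "s \<in> carr E" using u s mem Hc by auto
      have "norm c * vnorm E (vdiff E u s) \<le> norm c * (\<epsilon> / (norm c + 1))"
        using s by (intro mult_left_mono) auto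
      also have "\<dots> < \<epsilon>" using \<open>\<epsilon> > 0\<close>
        by (simp add: field_simps pos_divide_less_eq add_pos_nonneg)
      finally have "vnorm E (vdiff E (vscale E c u) (vscale E c s)) < \<epsilon>"
        using cc by (simp add: diff_scale norm_scale)
      then show ?thesis using sub s by (auto simp: linear_subspace_def)
    qed
    then show "vscale E c u \<in> closed_span E S" using u mem by auto
  qed
  then show "closed_subspace E (closed_span E S)"
    by (simp add: closed_subspace_def closed_span_def)
qed

lemma closed_span_minimal:
  assumes "closed_subspace E W" "S \<subseteq> W"
  shows "closed_span E S \<subseteq> W"
  using assms unfolding closed_span_def closed_subspace_def
  by (intro closure_of_minimal hull_minimal) auto

text \<open>The principle behind most density arguments below. Its closed subspace is supplied by
  \<open>closed_subspace_vimage\<close> for memberships, by \<open>closed_subspace_equalizer\<close>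
  for identities of operators and by \<open>closed_subspace_vlim_Lop\<close> for strong
  limits.\<close>

lemma closed_span_induct [consumes 2, case_names subspace generator]:
  assumes "u \<in> closed_span E S" "S \<subseteq> carr E"
    and "closed_subspace E {u \<in> carr E. P u}" "\<And>s. s \<in> S \<Longrightarrow> P s"
  shows "P u"
  using closed_span_minimal[OF assms(3), of S] assms by blast

lemma closed_span_mono:
  assumes "S \<subseteq> closed_span E T" "T \<subseteq> carr E"
  shows "closed_span E S \<subseteq> closed_span E T"
  using assms by (intro closed_span_minimal closed_subspace_closed_span)

lemma vlimD: "vlim E x l G \<Longrightarrow> \<epsilon> > 0 \<Longrightarrow> (\<forall>\<^sub>F i in G. vnorm E (vdiff E (x i) l) < \<epsilon>)"
  unfolding vlim_def by (auto dest: order_tendstoD(2))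

lemma vlimI:
  assumes "\<And>\<epsilon>. \<epsilon> > 0 \<Longrightarrow> (\<forall>\<^sub>F i in G. vnorm E (vdiff E (x i) l) < \<epsilon>)"
    "\<And>i. x i \<in> carr E" "l \<in> carr E"
  shows "vlim E x l G"
  unfolding vlim_def using assms(1) by (intro tendstoI) (simp add: assms)

lemma vlim_bound:
  assumes "(f \<longlongrightarrow> (0::real)) G" "\<forall>\<^sub>F i in G. vnorm E (vdiff E (x i) l) \<le> f i"
    "\<And>i. x i \<in> carr E" "l \<in> carr E"
  shows "vlim E x l G"
  unfolding vlim_def using assms 
  by (intro tendsto_sandwich[OF _ assms(2) tendsto_const assms(1)]) auto

lemma vlim_unique:
  assumes "vlim E x l G" "vlim E x m G" "G \<noteq> bot"
    "\<And>i. x i \<in> carr E" "l \<in> carr E" "m \<in> carr E"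
  shows "l = m"
proof (rule eq_if_norm_diff_le)
  fix \<epsilon> :: real assume "\<epsilon> > 0"
  then have "\<forall>\<^sub>F i in G. vnorm E (vdiff E (x i) l) < \<epsilon>/2 \<and> vnorm E (vdiff E (x i) m) < \<epsilon>/2"
    using vlimD[OF assms(1), of "\<epsilon>/2"] vlimD[OF assms(2), of "\<epsilon>/2"] by (simp add: eventually_conj)
  then obtain i where "vnorm E (vdiff E (x i) l) < \<epsilon>/2" "vnorm E (vdiff E (x i) m) < \<epsilon>/2"
    using assms(3) eventually_happens by blast
  then show "vnorm E (vdiff E l m) \<le> \<epsilon>"
    using norm_diff_triangle[of l "x i" m] norm_diff_commute[of l "x i"] assms by force
qed (use assms in auto)

lemma vlim_add:
  assumes "vlim E x l G" "vlim E y m G"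
    "\<And>i. x i \<in> carr E" "l \<in> carr E" "\<And>i. y i \<in> carr E" "m \<in> carr E"
  shows "vlim E (\<lambda>i. vadd E (x i) (y i)) (vadd E l m) G"
proof (rule vlim_bound)
  show "((\<lambda>i. vnorm E (vdiff E (x i) l) + vnorm E (vdiff E (y i) m)) \<longlongrightarrow> 0) G"
    using tendsto_add[OF assms(1,2)[unfolded vlim_def]] by simp
qed (use assms in \<open>auto simp: diff_add_add intro!: always_eventually norm_triangle\<close>)

lemma vlim_scale:
  assumes "vlim E x l G" "\<And>i. x i \<in> carr E" "l \<in> carr E"
  shows "vlim E (\<lambda>i. vscale E c (x i)) (vscale E c l) G"
proof (rule vlim_bound)
  show "((\<lambda>i. norm c * vnorm E (vdiff E (x i) l)) \<longlongrightarrow> 0) G"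
    using tendsto_mult[OF tendsto_const assms(1)[unfolded vlim_def]] by simp
qed (use assms in \<open>auto simp: diff_scale norm_scale\<close>)

lemma vlim_const: "l \<in> carr E \<Longrightarrow> vlim E (\<lambda>i. l) l G"
  by (simp add: vlim_def)

lemma closed_subspace_vlim:
  assumes "closed_subspace E W" "vlim E x l G" "G \<noteq> bot" "\<And>i. x i \<in> W" "l \<in> carr E"
  shows "l \<in> W"
proof (rule closed_subspaceD[OF assms(1) assms(5)])
  fix \<epsilon> :: real assume "\<epsilon> > 0"
  then obtain i where "vnorm E (vdiff E (x i) l) < \<epsilon>"
    using vlimD[OF assms(2)] assms(3) eventually_happens by blast
  moreover have "x i \<in> carr E" using assms by (auto simp: closed_subspace_def linear_subspace_def)
  ultimately show "\<exists>w\<in>W. vnorm E (vdiff E l w) < \<epsilon>"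
    using assms norm_diff_commute by metis
qed

lemma norm_vlim_le:
  assumes "vlim E x l G" "G \<noteq> bot" "\<And>i. x i \<in> carr E" "l \<in> carr E" "\<And>i. vnorm E (x i) \<le> C"
  shows "vnorm E l \<le> C"
proof (rule field_le_epsilon)
  fix \<epsilon> :: real assume "\<epsilon> > 0"
  then obtain i where "vnorm E (vdiff E (x i) l) < \<epsilon>"
    using vlimD[OF assms(1)] assms(2) eventually_happens by blast
  then show "vnorm E l \<le> C + \<epsilon>"
    using norm_le_add_diff[of l "x i"] norm_diff_commute[of l "x i"] assms(3,4) assms(5)[of i] by force
qed

end

lemma cnspace_cong:
  assumes "cnspace E" "carr E' = carr E" "vadd E' = vadd E" "vzero E' = vzero E"
    "vscale E' = vscale E" "vnorm E' = vnorm E"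
  shows "cnspace E'"
  using assms(1) unfolding cnspace_def assms(2-) .

lemma cnspace_subspace:
  assumes "cnspace E" "linear_subspace E W"
  shows "cnspace (E\<lparr>carr := W\<rparr>)"
proof -
  interpret cnspace E by fact
  have W: "w \<in> W \<Longrightarrow> w \<in> carr E" for w using assms(2) by (auto simp: linear_subspace_def)
  show ?thesis
    by unfold_locales
      (use assms(2) W in \<open>auto simp: linear_subspace_def add_assoc scale_add_right scale_add_left
        norm_scale norm_triangle intro: add_commute norm_eq_zeroD\<close>)
qed

lemma cnspace_complex: "cnspace complex_space"
  by unfold_locales (auto simp: complex_space_def algebra_simps norm_mult norm_triangle_ineq)

section \<open>The normed space of bounded operators\<close>

lemma Lop_simps:
  "carr (Lop E F) = bounded_linear_maps E F"
  "vadd (Lop E F) S T = (\<lambda>u\<in>carr E. vadd F (S u) (T u))"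
  "vzero (Lop E F) = (\<lambda>u\<in>carr E. vzero F)"
  "vscale (Lop E F) c T = (\<lambda>u\<in>carr E. vscale F c (T u))"
  "vnorm (Lop E F) T = (SUP u\<in>{u \<in> carr E. vnorm E u \<le> 1}. vnorm F (T u))"
  by (simp_all add: Lop_def)

lemma op_algebra_simps [simp]:
  "carr (op_algebra E) = carr (Lop E E)"
  "vadd (op_algebra E) = vadd (Lop E E)"
  "vzero (op_algebra E) = vzero (Lop E E)"
  "vscale (op_algebra E) = vscale (Lop E E)"
  "vnorm (op_algebra E) = vnorm (Lop E E)"
  "amult (op_algebra E) = compose (carr E)"
  by (simp_all add: op_algebra_def nspace.extend_def)

locale cnspace_pair = E: cnspace E + F: cnspace F
  for E :: "('v, 'x) nspace_scheme" and F :: "('w, 'y) nspace_scheme"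
begin

lemma Lop_closed [simp]: "T \<in> carr (Lop E F) \<Longrightarrow> u \<in> carr E \<Longrightarrow> T u \<in> carr F"
  by (auto simp: Lop_simps bounded_linear_maps_def)

lemma Lop_add: "T \<in> carr (Lop E F) \<Longrightarrow> u \<in> carr E \<Longrightarrow> v \<in> carr E \<Longrightarrow>
    T (vadd E u v) = vadd F (T u) (T v)"
  by (auto simp: Lop_simps bounded_linear_maps_def)

lemma Lop_scale: "T \<in> carr (Lop E F) \<Longrightarrow> u \<in> carr E \<Longrightarrow> T (vscale E c u) = vscale F c (T u)"
  by (auto simp: Lop_simps bounded_linear_maps_def)

lemma Lop_diff: "T \<in> carr (Lop E F) \<Longrightarrow> u \<in> carr E \<Longrightarrow> v \<in> carr E \<Longrightarrow>
    T (vdiff E u v) = vdiff F (T u) (T v)"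
  by (simp add: vdiff_def Lop_add Lop_scale)

lemma Lop_zero: "T \<in> carr (Lop E F) \<Longrightarrow> T (vzero E) = vzero F"
  by (metis E.scale_zero E.zero_closed F.scale_zero Lop_closed Lop_scale)

lemma Lop_extensional: "T \<in> carr (Lop E F) \<Longrightarrow> T \<in> extensional (carr E)"
  unfolding Lop_simps bounded_linear_maps_def PiE_def by blast

lemma Lop_ext: "S \<in> carr (Lop E F) \<Longrightarrow> T \<in> carr (Lop E F) \<Longrightarrow>
    (\<And>u. u \<in> carr E \<Longrightarrow> S u = T u) \<Longrightarrow> S = T"
  by (rule extensionalityI[of S "carr E" T]) (simp_all add: Lop_extensional)

lemma Lop_memI:
  assumes "T \<in> extensional (carr E)" "\<And>u. u \<in> carr E \<Longrightarrow> T u \<in> carr F"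
    "\<And>u v. u \<in> carr E \<Longrightarrow> v \<in> carr E \<Longrightarrow> T (vadd E u v) = vadd F (T u) (T v)"
    "\<And>c u. u \<in> carr E \<Longrightarrow> T (vscale E c u) = vscale F c (T u)"
    "\<And>u. u \<in> carr E \<Longrightarrow> vnorm F (T u) \<le> C * vnorm E u"
  shows "T \<in> carr (Lop E F)"
  unfolding Lop_simps bounded_linear_maps_def PiE_def using assms by blast

lemma Lop_bdd:
  assumes "T \<in> carr (Lop E F)"
  obtains C where "C \<ge> 0" "\<And>u. u \<in> carr E \<Longrightarrow> vnorm F (T u) \<le> C * vnorm E u"
proof -
  have "\<exists>C. \<forall>u\<in>carr E. vnorm F (T u) \<le> C * vnorm E u"
    using assms unfolding Lop_simps bounded_linear_maps_def by blast
  then obtain C where C: "\<And>u. u \<in> carr E \<Longrightarrow> vnorm F (T u) \<le> C * vnorm E u" by blast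
  \<comment> \<open>The constant in the definition of boundedness may be negative if
    \<open>E\<close> is the zero space.\<close>
  have "vnorm F (T u) \<le> max C 0 * vnorm E u" if "u \<in> carr E" for u
    using C[OF that] mult_right_mono[of C "max C 0" "vnorm E u"] that by force
  then show ?thesis using that[of "max C 0"] by auto
qed

lemma Lop_bdd_above:
  assumes T: "T \<in> carr (Lop E F)"
  shows "bdd_above ((\<lambda>u. vnorm F (T u)) ` {u \<in> carr E. vnorm E u \<le> 1})"
proof -
  obtain C where C: "C \<ge> 0" "\<And>u. u \<in> carr E \<Longrightarrow> vnorm F (T u) \<le> C * vnorm E u"
    using Lop_bdd[OF T] by blast
  show ?thesis
  proof (rule bdd_aboveI2)
    fix v assume "v \<in> {u \<in> carr E. vnorm E u \<le> 1}"
    then show "vnorm F (T v) \<le> C"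
      using C(2)[of v] mult_left_mono[of "vnorm E v" 1 C] C(1) by auto
  qed
qed

lemma norm_le_opnorm:
  assumes T: "T \<in> carr (Lop E F)" and u: "u \<in> carr E"
  shows "vnorm F (T u) \<le> vnorm (Lop E F) T * vnorm E u"
proof -
  note bdd = Lop_bdd_above[OF T]
  show ?thesis
  proof (cases "vnorm E u = 0")
    case True
    then have "u = vzero E" using u E.norm_eq_zeroD by blast
    then show ?thesis using T by (simp add: Lop_zero)
  next
    case False
    then have pos: "vnorm E u > 0" using u E.norm_nonneg[OF u] by linarith
    define v where "v = vscale E (complex_of_real (1 / vnorm E u)) u"
    have v: "v \<in> carr E" "vnorm E v = 1"
      using u pos by (auto simp: v_def E.norm_scale norm_divide)
    have "vnorm F (T v) \<le> vnorm (Lop E F) T"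
      unfolding Lop_simps by (rule cSUP_upper[OF _ bdd]) (use v in auto)
    moreover have "vnorm F (T v) = (1 / vnorm E u) * vnorm F (T u)"
      using T u pos by (simp add: v_def Lop_scale F.norm_scale norm_divide)
    ultimately show ?thesis using pos by (simp add: field_simps)
  qed
qed

lemma opnorm_le:
  assumes "C \<ge> 0" "\<And>u. u \<in> carr E \<Longrightarrow> vnorm F (T u) \<le> C * vnorm E u"
  shows "vnorm (Lop E F) T \<le> C"
  unfolding Lop_simps
proof (rule cSUP_least)
  show "{u \<in> carr E. vnorm E u \<le> 1} \<noteq> {}" using E.zero_closed E.norm_zero by force
  fix u assume "u \<in> {u \<in> carr E. vnorm E u \<le> 1}"
  then show "vnorm F (T u) \<le> C"
    using assms(2)[of u] mult_left_mono[of "vnorm E u" 1 C] assms(1) by auto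
qed

lemma opnorm_nonneg:
  assumes T: "T \<in> carr (Lop E F)"
  shows "0 \<le> vnorm (Lop E F) T"
proof -
  note bdd = Lop_bdd_above[OF T]
  have "vnorm F (T (vzero E)) \<le> vnorm (Lop E F) T"
    unfolding Lop_simps by (rule cSUP_upper[OF _ bdd]) auto
  then show ?thesis using T by (simp add: Lop_zero)
qed

lemma norm_le_opnorm':
  assumes "T \<in> carr (Lop E F)" "u \<in> carr E" "vnorm (Lop E F) T \<le> C"
  shows "vnorm F (T u) \<le> C * vnorm E u"
  using norm_le_opnorm[OF assms(1,2)] mult_right_mono[OF assms(3), of "vnorm E u"] assms(2) by force

lemma Lop_add_closed: 
  assumes "S \<in> carr (Lop E F)" "T \<in> carr (Lop E F)"
  shows "vadd (Lop E F) S T \<in> carr (Lop E F)"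
proof (rule Lop_memI[of _ "vnorm (Lop E F) S + vnorm (Lop E F) T"])
  fix u assume u: "u \<in> carr E"
  have "vnorm F (vadd F (S u) (T u)) \<le> vnorm F (S u) + vnorm F (T u)"
    using assms u by (intro F.norm_triangle) auto
  then show "vnorm F (vadd (Lop E F) S T u) \<le> (vnorm (Lop E F) S + vnorm (Lop E F) T) * vnorm E u"
    using norm_le_opnorm[OF assms(1) u] norm_le_opnorm[OF assms(2) u] u
    by (simp add: Lop_simps(2) algebra_simps)
qed (use assms in \<open>auto simp: Lop_simps(2) Lop_add Lop_scale F.add_ac F.scale_add_right\<close>)

lemma Lop_scale_closed: 
  assumes "T \<in> carr (Lop E F)"
  shows "vscale (Lop E F) c T \<in> carr (Lop E F)"
proof (rule Lop_memI[of _ "norm c * vnorm (Lop E F) T"])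
  fix u assume u: "u \<in> carr E"
  show "vnorm F (vscale (Lop E F) c T u) \<le> (norm c * vnorm (Lop E F) T) * vnorm E u"
    using mult_left_mono[OF norm_le_opnorm[OF assms u], of "norm c"] u assms
    by (simp add: Lop_simps(4) algebra_simps F.norm_scale)
qed (use assms in \<open>auto simp: Lop_simps(4) Lop_add Lop_scale F.scale_add_right mult.commute\<close>)

lemma Lop_zero_closed: "vzero (Lop E F) \<in> carr (Lop E F)"
  by (rule Lop_memI[of _ 0]) (auto simp: Lop_simps(3))

lemma opnorm_scale_le:
  assumes "T \<in> carr (Lop E F)"
  shows "vnorm (Lop E F) (vscale (Lop E F) c T) \<le> norm c * vnorm (Lop E F) T"
  using mult_left_mono[OF norm_le_opnorm[OF assms]] assms
  by (intro opnorm_le) (auto simp: Lop_simps(4) F.norm_scale algebra_simps opnorm_nonneg)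

lemma cnspace_Lop: "cnspace (Lop E F)"
proof
  fix S T R assume *: "S \<in> carr (Lop E F)" "T \<in> carr (Lop E F)"
  show "vadd (Lop E F) S T \<in> carr (Lop E F)" by (rule Lop_add_closed[OF *])
  show "vadd (Lop E F) S T = vadd (Lop E F) T S"
    using * by (auto simp: Lop_simps(2) intro!: restrict_ext F.add_commute)
  show "vscale (Lop E F) c (vadd (Lop E F) S T)
    = vadd (Lop E F) (vscale (Lop E F) c S) (vscale (Lop E F) c T)" for c
    using * by (auto simp: Lop_simps(2,4) intro!: restrict_ext F.scale_add_right)
  show "vnorm (Lop E F) (vadd (Lop E F) S T) \<le> vnorm (Lop E F) S + vnorm (Lop E F) T"
  proof (rule opnorm_le)
    fix u assume u: "u \<in> carr E"
    have "vnorm F (vadd F (S u) (T u)) \<le> vnorm F (S u) + vnorm F (T u)"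
      using * u by (intro F.norm_triangle) auto
    then show "vnorm F (vadd (Lop E F) S T u) \<le> (vnorm (Lop E F) S + vnorm (Lop E F) T) * vnorm E u"
      using norm_le_opnorm[OF *(1) u] norm_le_opnorm[OF *(2) u] u
      by (simp add: Lop_simps(2) algebra_simps)
  qed (use * in \<open>auto intro: add_nonneg_nonneg opnorm_nonneg\<close>)
  assume R: "R \<in> carr (Lop E F)" 
  show "vadd (Lop E F) (vadd (Lop E F) S T) R = vadd (Lop E F) S (vadd (Lop E F) T R)"
    using * R by (auto simp: Lop_simps(2) intro!: restrict_ext F.add_assoc)
next
  show "vzero (Lop E F) \<in> carr (Lop E F)" by (rule Lop_zero_closed)
next
  fix T c assume T: "T \<in> carr (Lop E F)"
  show "vscale (Lop E F) c T \<in> carr (Lop E F)" by (rule Lop_scale_closed[OF T])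
  have ext: "T \<in> extensional (carr E)" using T by (rule Lop_extensional)
  show "vadd (Lop E F) T (vzero (Lop E F)) = T"
    by (rule extensionalityI[OF _ ext]) (use T in \<open>auto simp: Lop_simps(2,3)\<close>)
  show "vscale (Lop E F) 1 T = T"
    by (rule extensionalityI[OF _ ext]) (use T in \<open>auto simp: Lop_simps(4)\<close>)
  show "vscale (Lop E F) 0 T = vzero (Lop E F)"
    using T by (auto simp: Lop_simps(3,4) intro!: restrict_ext)
  show "vscale (Lop E F) (c + d) T = vadd (Lop E F) (vscale (Lop E F) c T) (vscale (Lop E F) d T)" for d
    using T by (auto simp: Lop_simps(2,4) intro!: restrict_ext F.scale_add_left)
  show eq: "vscale (Lop E F) c (vscale (Lop E F) d T) = vscale (Lop E F) (c * d) T" for c d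
    using T by (auto simp: Lop_simps(2,4) intro!: restrict_ext)
  show "vnorm (Lop E F) (vscale (Lop E F) c T) = norm c * vnorm (Lop E F) T"
  proof (cases "c = 0")
    case True
    have "vnorm (Lop E F) (vscale (Lop E F) 0 T) = 0"
      using opnorm_scale_le[OF T, of 0] opnorm_nonneg[OF Lop_scale_closed[OF T, of 0]] by simp
    then show ?thesis using True by simp
  next
    case False
    \<comment> \<open>So far only \<open>\<le>\<close> is available; the same inequality for the
      factor \<open>1/c\<close> gives the other direction.\<close>
    have "vscale (Lop E F) (1/c) (vscale (Lop E F) c T) = T"
      unfolding eq using False
      by (intro extensionalityI[OF _ ext]) (use T in \<open>auto simp: Lop_simps(4)\<close>)
    then have "vnorm (Lop E F) T \<le> norm (1/c) * vnorm (Lop E F) (vscale (Lop E F) c T)"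
      using opnorm_scale_le[OF Lop_scale_closed[OF T], of "1/c" c] by simp
    then have "norm c * vnorm (Lop E F) T \<le> vnorm (Lop E F) (vscale (Lop E F) c T)"
      using False by (simp add: norm_divide field_simps)
    then show ?thesis using opnorm_scale_le[OF T, of c] by simp
  qed
  assume 0: "vnorm (Lop E F) T = 0"
  show "T = vzero (Lop E F)"
  proof (rule Lop_ext[OF T Lop_zero_closed])
    fix u assume u: "u \<in> carr E"
    have "vnorm F (T u) = 0"
      using norm_le_opnorm[OF T u] F.norm_nonneg[OF Lop_closed[OF T u]] 0 by simp
    then show "T u = vzero (Lop E F) u"
      using T u F.norm_eq_zeroD[of "T u"] by (simp add: Lop_simps(3))
  qed
qed

lemma Lop_diff_apply: "u \<in> carr E \<Longrightarrow> vdiff (Lop E F) S T u = vdiff F (S u) (T u)"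
  by (simp add: vdiff_def Lop_simps)

lemma vlim_Lop:
  assumes "vlim E x l G" "T \<in> carr (Lop E F)" "\<And>i. x i \<in> carr E" "l \<in> carr E"
  shows "vlim F (\<lambda>i. T (x i)) (T l) G"
proof (rule F.vlim_bound)
  show "((\<lambda>i. vnorm (Lop E F) T * vnorm E (vdiff E (x i) l)) \<longlongrightarrow> 0) G"
    using tendsto_mult[OF tendsto_const assms(1)[unfolded vlim_def]] by simp
  show "\<forall>\<^sub>F i in G. vnorm F (vdiff F (T (x i)) (T l)) \<le> vnorm (Lop E F) T * vnorm E (vdiff E (x i) l)"
    using assms by (auto simp flip: Lop_diff intro!: always_eventually norm_le_opnorm)
qed (use assms in auto)

lemma vlim_Lop_apply:
  assumes "vlim (Lop E F) T S G" "\<And>i. T i \<in> carr (Lop E F)" "S \<in> carr (Lop E F)" "u \<in> carr E"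
  shows "vlim F (\<lambda>i. T i u) (S u) G"
proof (rule F.vlim_bound)
  interpret L: cnspace "Lop E F" by (rule cnspace_Lop)
  show "((\<lambda>i. vnorm (Lop E F) (vdiff (Lop E F) (T i) S) * vnorm E u) \<longlongrightarrow> 0) G"
    using tendsto_mult[OF assms(1)[unfolded vlim_def] tendsto_const[of "vnorm E u"]] by simp
  show "\<forall>\<^sub>F i in G. vnorm F (vdiff F (T i u) (S u)) \<le> vnorm (Lop E F) (vdiff (Lop E F) (T i) S) * vnorm E u"
    using assms norm_le_opnorm[OF L.diff_closed, of "T _" S u]
    by (auto simp: Lop_diff_apply intro!: always_eventually)
qed (use assms in auto)

text \<open>Continuity of \<open>T\<close>, packaged for use with closed spans.\<close>

lemma closed_subspace_vimage:
  assumes T: "T \<in> carr (Lop E F)" and W: "closed_subspace F W"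
  shows "closed_subspace E {u \<in> carr E. T u \<in> W}"
proof (rule E.closed_subspaceI)
  show "linear_subspace E {u \<in> carr E. T u \<in> W}"
    using W T by (auto simp: closed_subspace_def linear_subspace_def Lop_add Lop_scale Lop_zero)
next
  fix u assume u: "u \<in> carr E"
    and ap: "\<And>\<epsilon>. \<epsilon> > 0 \<Longrightarrow> \<exists>w\<in>{u \<in> carr E. T u \<in> W}. vnorm E (vdiff E u w) < \<epsilon>"
  have "T u \<in> W"
  proof (rule F.closed_subspaceD[OF W])
    fix \<epsilon> :: real assume "\<epsilon> > 0"
    let ?C = "vnorm (Lop E F) T"
    have C: "?C \<ge> 0" by (rule opnorm_nonneg[OF T])
    have "\<epsilon> / (?C + 1) > 0" using C \<open>\<epsilon> > 0\<close> by simp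
    then obtain w where w: "w \<in> carr E" "T w \<in> W" "vnorm E (vdiff E u w) < \<epsilon> / (?C + 1)"
      using ap by blast
    have "vnorm F (vdiff F (T u) (T w)) \<le> ?C * vnorm E (vdiff E u w)"
      using T u w norm_le_opnorm[OF T, of "vdiff E u w"] by (simp add: Lop_diff)
    also have "\<dots> \<le> ?C * (\<epsilon> / (?C + 1))" using w C by (intro mult_left_mono) auto
    also have "\<dots> < \<epsilon>" using C \<open>\<epsilon> > 0\<close> by (simp add: field_simps)
    finally show "\<exists>w\<in>W. vnorm F (vdiff F (T u) w) < \<epsilon>" using w by blast
  qed (use T u in auto)
  then show "u \<in> {u \<in> carr E. T u \<in> W}" using u by simp
qed

text \<open>A three-term estimate: for \<open>w\<close> near \<open>u\<close>, the distances from
  \<open>T i u\<close> to \<open>T i w\<close> and from \<open>S w\<close> to \<open>S u\<close> are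
  small uniformly in \<open>i\<close>, thanks to the bound \<open>C\<close>. Strong convergence of a
  bounded net therefore needs checking on generators only. The constant \<open>?D\<close> dominates
  both operator norms and is positive whatever the sign of \<open>C\<close>.\<close>

lemma closed_subspace_vlim_Lop:
  assumes T: "\<And>i. T i \<in> carr (Lop E F)" and S: "S \<in> carr (Lop E F)"
    and C: "\<And>i. vnorm (Lop E F) (T i) \<le> C"
  shows "closed_subspace E {u \<in> carr E. vlim F (\<lambda>i. T i u) (S u) G}"
proof (rule E.closed_subspaceI)
  show "linear_subspace E {u \<in> carr E. vlim F (\<lambda>i. T i u) (S u) G}"
    using T S by (auto simp: linear_subspace_def Lop_add Lop_scale Lop_zero
        intro: F.vlim_add F.vlim_scale F.vlim_const)
next
  fix u assume u: "u \<in> carr E"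
    and ap: "\<And>\<epsilon>. \<epsilon> > 0 \<Longrightarrow>
      \<exists>w\<in>{u \<in> carr E. vlim F (\<lambda>i. T i u) (S u) G}. vnorm E (vdiff E u w) < \<epsilon>"
  let ?D = "\<bar>C\<bar> + vnorm (Lop E F) S + 1"
  have D: "?D > 0" using opnorm_nonneg[OF S] by linarith
  have "vlim F (\<lambda>i. T i u) (S u) G"
  proof (rule F.vlimI)
    fix \<epsilon> :: real assume \<epsilon>: "\<epsilon> > 0"
    then have "\<epsilon> / (2 * ?D) > 0" using D by simp
    then obtain w where w: "w \<in> carr E" "vlim F (\<lambda>i. T i w) (S w) G"
        "vnorm E (vdiff E u w) < \<epsilon> / (2 * ?D)"
      using ap by blast
    have "\<forall>\<^sub>F i in G. vnorm F (vdiff F (T i w) (S w)) < \<epsilon> / 2"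
      using F.vlimD[OF w(2), of "\<epsilon>/2"] \<epsilon> by simp
    then show "\<forall>\<^sub>F i in G. vnorm F (vdiff F (T i u) (S u)) < \<epsilon>"
    proof (rule eventually_mono)
      fix i assume i: "vnorm F (vdiff F (T i w) (S w)) < \<epsilon> / 2"
      let ?d = "vnorm E (vdiff E u w)"
      have 1: "vnorm F (vdiff F (T i u) (T i w)) \<le> \<bar>C\<bar> * ?d"
        using norm_le_opnorm'[OF T, of "vdiff E u w" i "\<bar>C\<bar>"] C[of i] u w T
        by (simp add: Lop_diff)
      have 2: "vnorm F (vdiff F (S w) (S u)) \<le> vnorm (Lop E F) S * ?d"
        using norm_le_opnorm[OF S, of "vdiff E u w"] u w S
        by (simp add: Lop_diff F.norm_diff_commute)
      have d: "?D * ?d < \<epsilon> / 2" "?d \<ge> 0"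
        using w D u by (simp_all add: field_simps)
      have "vnorm F (vdiff F (T i u) (S u)) \<le> vnorm F (vdiff F (T i u) (T i w))
          + (vnorm F (vdiff F (T i w) (S w)) + vnorm F (vdiff F (S w) (S u)))"
        using F.norm_diff_triangle[of "T i u" "T i w" "S u"]
          F.norm_diff_triangle[of "T i w" "S w" "S u"] T S u w by force
      also have "\<dots> < \<epsilon>" using 1 2 i d by (simp add: algebra_simps)
      finally show "vnorm F (vdiff F (T i u) (S u)) < \<epsilon>" .
    qed
  qed (use T S u in auto)
  then show "u \<in> {u \<in> carr E. vlim F (\<lambda>i. T i u) (S u) G}" using u by simp
qed

end

section \<open>Composition of bounded operators\<close>

locale cnspace_triple = E: cnspace E + F: cnspace F + H: cnspace H
  for E :: "('v, 'x) nspace_scheme" and F :: "('w, 'y) nspace_scheme"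
    and H :: "('z, 'k) nspace_scheme"
begin

sublocale EF: cnspace_pair E F ..
sublocale FH: cnspace_pair F H ..
sublocale EH: cnspace_pair E H ..

lemma compose_norm:
  assumes "S \<in> carr (Lop F H)" "T \<in> carr (Lop E F)" "u \<in> carr E"
  shows "vnorm H (S (T u)) \<le> vnorm (Lop F H) S * vnorm (Lop E F) T * vnorm E u"
proof -
  have "vnorm H (S (T u)) \<le> vnorm (Lop F H) S * vnorm F (T u)"
    using assms by (intro FH.norm_le_opnorm) auto
  also have "\<dots> \<le> vnorm (Lop F H) S * (vnorm (Lop E F) T * vnorm E u)"
    using assms by (intro mult_left_mono EF.norm_le_opnorm FH.opnorm_nonneg)
  finally show ?thesis by (simp add: mult.assoc)
qed

lemma compose_closed [simp]:
  assumes "S \<in> carr (Lop F H)" "T \<in> carr (Lop E F)"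
  shows "compose (carr E) S T \<in> carr (Lop E H)"
  by (rule EH.Lop_memI[of _ "vnorm (Lop F H) S * vnorm (Lop E F) T"])
    (use assms in \<open>auto simp: compose_def EF.Lop_add EF.Lop_scale FH.Lop_add FH.Lop_scale
      intro: compose_norm\<close>)

lemma compose_opnorm:
  assumes "S \<in> carr (Lop F H)" "T \<in> carr (Lop E F)"
  shows "vnorm (Lop E H) (compose (carr E) S T) \<le> vnorm (Lop F H) S * vnorm (Lop E F) T"
  by (rule EH.opnorm_le)
    (use assms in \<open>auto simp: compose_def intro: compose_norm mult_nonneg_nonneg FH.opnorm_nonneg EF.opnorm_nonneg\<close>)

text \<open>Seen as a bounded operator between operator spaces, composition inherits the general
  facts on limits (\<open>vlim_Lop\<close>) and on preimages of closed subspaces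
  (\<open>closed_subspace_vimage\<close>).\<close>

lemma compose_left_Lop:
  assumes "S \<in> carr (Lop F H)"
  shows "(\<lambda>T\<in>carr (Lop E F). compose (carr E) S T) \<in> carr (Lop (Lop E F) (Lop E H))"
proof -
  interpret L: cnspace_pair "Lop E F" "Lop E H"
    by (intro cnspace_pair.intro EF.cnspace_Lop EH.cnspace_Lop)
  show ?thesis
    by (rule L.Lop_memI[of _ "vnorm (Lop F H) S"])
      (use assms in \<open>auto simp: compose_opnorm EF.Lop_add_closed EF.Lop_scale_closed,
       auto simp: compose_def Lop_simps(2,4) FH.Lop_add FH.Lop_scale intro!: restrict_ext\<close>)
qed

lemma compose_right_Lop:
  assumes "T \<in> carr (Lop E F)"
  shows "(\<lambda>S\<in>carr (Lop F H). compose (carr E) S T) \<in> carr (Lop (Lop F H) (Lop E H))"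
proof -
  interpret L: cnspace_pair "Lop F H" "Lop E H"
    by (intro cnspace_pair.intro FH.cnspace_Lop EH.cnspace_Lop)
  show ?thesis
    by (rule L.Lop_memI[of _ "vnorm (Lop E F) T"])
      (use assms in \<open>auto simp: compose_opnorm mult.commute[of "vnorm (Lop E F) T"] FH.Lop_add_closed FH.Lop_scale_closed,
       auto simp: compose_def Lop_simps(2,4) intro!: restrict_ext\<close>)
qed

end

section \<open>Multipliers of an operator algebra with a left approximate identity\<close>

definition vcomplete :: "('v, 'x) nspace_scheme \<Rightarrow> bool" where
  "vcomplete E \<longleftrightarrow> (\<forall>x::nat \<Rightarrow> 'v. (\<forall>n. x n \<in> carr E) \<longrightarrow>
     (\<forall>\<epsilon>>0. \<exists>N. \<forall>m\<ge>N. \<forall>n\<ge>N. vnorm E (vdiff E (x m) (x n)) < \<epsilon>) \<longrightarrow>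
     (\<exists>l\<in>carr E. vlim E x l sequentially))"

text \<open>Completeness is formulated for sequences, the approximate identity is a net. Vectors
  \<open>y n\<close> within \<open>1 / Suc n\<close> of a tail of the net form a Cauchy sequence,
  whose limit is the limit of the net.\<close>

lemma (in cnspace) vcomplete_net:
  assumes "vcomplete E" "G \<noteq> bot" "\<And>i. x i \<in> carr E"
    and ap: "\<And>\<epsilon>. \<epsilon> > 0 \<Longrightarrow> \<exists>y\<in>carr E. \<forall>\<^sub>F i in G. vnorm E (vdiff E (x i) y) < \<epsilon>"
  obtains l where "l \<in> carr E" "vlim E x l G"
proof -
  have "\<exists>y\<in>carr E. \<forall>\<^sub>F i in G. vnorm E (vdiff E (x i) y) < 1 / real (Suc n)" for n
    by (rule ap) simp
  then obtain y where y: "\<And>n. y n \<in> carr E"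
      "\<And>n. \<forall>\<^sub>F i in G. vnorm E (vdiff E (x i) (y n)) < 1 / real (Suc n)"
    by metis
  have small: "\<exists>N. \<forall>n\<ge>N. 1 / real (Suc n) < \<epsilon>" if \<epsilon>: "\<epsilon> > 0" for \<epsilon> :: real
    using order_tendstoD(2)[OF lim_inverse_n' \<epsilon>] LIMSEQ_Suc[OF lim_inverse_n']
      order_tendstoD(2)[OF LIMSEQ_Suc[OF lim_inverse_n'] \<epsilon>]
    by (simp add: eventually_sequentially inverse_eq_divide)
  have yy: "vnorm E (vdiff E (y m) (y n)) < 1 / real (Suc m) + 1 / real (Suc n)" for m n
  proof -
    \<comment> \<open>Both tails share an index because the filter is nontrivial.\<close>
    obtain i where i: "vnorm E (vdiff E (x i) (y m)) < 1 / real (Suc m)"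
        "vnorm E (vdiff E (x i) (y n)) < 1 / real (Suc n)"
      using eventually_happens[OF eventually_conj[OF y(2)[of m] y(2)[of n]]] assms(2) by blast
    then show ?thesis
      using norm_diff_triangle[OF y(1)[of m] assms(3)[of i] y(1)[of n]]
        norm_diff_commute[OF assms(3)[of i] y(1)[of m]] by linarith
  qed
  have "\<exists>N. \<forall>m\<ge>N. \<forall>n\<ge>N. vnorm E (vdiff E (y m) (y n)) < \<epsilon>" if \<epsilon>: "\<epsilon> > 0" for \<epsilon>
  proof -
    obtain N where N: "\<And>n. n \<ge> N \<Longrightarrow> 1 / real (Suc n) < \<epsilon>/2"
      using small[of "\<epsilon>/2"] \<epsilon> by auto
    have "vnorm E (vdiff E (y m) (y n)) < \<epsilon>" if "m \<ge> N" "n \<ge> N" for m n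
      using yy[of m n] N[OF that(1)] N[OF that(2)] by linarith
    then show ?thesis by blast
  qed
  then obtain l where l: "l \<in> carr E" "vlim E y l sequentially"
    using assms(1) y(1) unfolding vcomplete_def by blast
  have "vlim E x l G"
  proof (rule vlimI)
    fix \<epsilon> :: real assume \<epsilon>: "\<epsilon> > 0"
    obtain N where N: "\<And>n. n \<ge> N \<Longrightarrow> 1 / real (Suc n) < \<epsilon>/2"
      using small[of "\<epsilon>/2"] \<epsilon> by auto
    obtain M where M: "\<And>n. n \<ge> M \<Longrightarrow> vnorm E (vdiff E (y n) l) < \<epsilon>/2"
      using vlimD[OF l(2), of "\<epsilon>/2"] \<epsilon> by (auto simp: eventually_sequentially)
    define n where "n = max N M"
    show "\<forall>\<^sub>F i in G. vnorm E (vdiff E (x i) l) < \<epsilon>"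
      using y(2)[of n]
    proof (rule eventually_mono)
      fix i assume "vnorm E (vdiff E (x i) (y n)) < 1 / real (Suc n)"
      then show "vnorm E (vdiff E (x i) l) < \<epsilon>"
        using norm_diff_triangle[OF assms(3)[of i] y(1)[of n] l(1)] N[of n] M[of n]
        by (simp add: n_def)
    qed
  qed (use assms l in auto)
  then show thesis using that l by blast
qed

text \<open>The multiplier theorem is isolated from the tensor structure: all that enters is a
  contractive left approximate identity which also converges strongly to the identity of a complete
  space. Index type and filter are arbitrary, since the one used later runs over pairs along a
  product filter.\<close>

locale left_unital_algebra = cnspace F for F :: "('v, 'x) nspace_scheme" +
  fixes B :: "('v \<Rightarrow> 'v) set" and u :: "'i \<Rightarrow> 'v \<Rightarrow> 'v" and G :: "'i filter"
  assumes complete: "vcomplete F"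
    and subspace: "linear_subspace (Lop F F) B"
    and mult_closed: "b \<in> B \<Longrightarrow> c \<in> B \<Longrightarrow> compose (carr F) b c \<in> B"
    and nontrivial: "G \<noteq> bot"
    and unit_mem: "u i \<in> B"
    and unit_contractive: "vnorm (Lop F F) (u i) \<le> 1"
    and unit_left: "b \<in> B \<Longrightarrow> vlim (Lop F F) (\<lambda>i. compose (carr F) (u i) b) b G"
    and unit_strong: "f \<in> carr F \<Longrightarrow> vlim F (\<lambda>i. u i f) f G"
begin

abbreviation (input) "BB \<equiv> (op_algebra F)\<lparr>carr := B\<rparr>"

sublocale FF: cnspace_triple F F F ..
sublocale L: cnspace "Lop F F" by (rule FF.EF.cnspace_Lop)

lemma B_Lop [simp]: "b \<in> B \<Longrightarrow> b \<in> carr (Lop F F)"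
  using subspace by (auto simp: linear_subspace_def)

lemma cnspace_op_algebra: "cnspace (op_algebra F)"
  by (rule cnspace_cong[OF L.cnspace_axioms]) simp_all

lemma linear_subspace_op_algebra: "linear_subspace (op_algebra F) B"
  using subspace by (simp add: linear_subspace_def)

sublocale BB: cnspace BB
  by (rule cnspace_subspace[OF cnspace_op_algebra linear_subspace_op_algebra])
sublocale BL: cnspace_pair BB BB ..

lemma vlim_BB: "vlim BB = vlim (Lop F F)"
  by (intro ext) (simp add: vlim_def vdiff_def)

lemma BL_closed: "L \<in> carr (Lop BB BB) \<Longrightarrow> b \<in> B \<Longrightarrow> L b \<in> B"
  using BL.Lop_closed[of L b] by simp

lemma centralizer_Lop:
  assumes "t \<in> spatial_multipliers F B"
  shows "(\<lambda>b\<in>B. compose (carr F) t b) \<in> carr (Lop BB BB)"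
    and "(\<lambda>b\<in>B. compose (carr F) b t) \<in> carr (Lop BB BB)"
    and "vnorm (Lop BB BB) (\<lambda>b\<in>B. compose (carr F) t b) \<le> vnorm (Lop F F) t"
    and "vnorm (Lop BB BB) (\<lambda>b\<in>B. compose (carr F) b t) \<le> vnorm (Lop F F) t"
proof -
  have t: "t \<in> carr (Lop F F)" "\<And>b. b \<in> B \<Longrightarrow> compose (carr F) t b \<in> B"
      "\<And>b. b \<in> B \<Longrightarrow> compose (carr F) b t \<in> B"
    using assms by (auto simp: spatial_multipliers_def)
  have B: "b \<in> B \<Longrightarrow> c \<in> B \<Longrightarrow> vadd (Lop F F) b c \<in> B" "b \<in> B \<Longrightarrow> vscale (Lop F F) z b \<in> B" for b c z
    using subspace by (auto simp: linear_subspace_def)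
  have n: "0 \<le> vnorm (Lop F F) t" using t by simp
  show "(\<lambda>b\<in>B. compose (carr F) t b) \<in> carr (Lop BB BB)"
    by (rule BL.Lop_memI[of _ "vnorm (Lop F F) t"])
      (use t B in \<open>auto simp: FF.compose_opnorm,
       auto simp: compose_def Lop_simps(2,4) FF.EF.Lop_add FF.EF.Lop_scale intro!: restrict_ext\<close>)
  show "(\<lambda>b\<in>B. compose (carr F) b t) \<in> carr (Lop BB BB)"
    by (rule BL.Lop_memI[of _ "vnorm (Lop F F) t"])
      (use t B in \<open>auto simp: FF.compose_opnorm mult.commute[of "vnorm (Lop F F) t"],
       auto simp: compose_def Lop_simps(2,4) intro!: restrict_ext\<close>)
  show "vnorm (Lop BB BB) (\<lambda>b\<in>B. compose (carr F) t b) \<le> vnorm (Lop F F) t"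
    by (rule BL.opnorm_le) (use t n in \<open>auto simp: FF.compose_opnorm\<close>)
  show "vnorm (Lop BB BB) (\<lambda>b\<in>B. compose (carr F) b t) \<le> vnorm (Lop F F) t"
    by (rule BL.opnorm_le)
      (use t n in \<open>auto simp: FF.compose_opnorm mult.commute[of "vnorm (Lop F F) t"]\<close>)
qed

lemma centralizer_in:
  assumes t: "t \<in> spatial_multipliers F B"
  shows "centralizer_of F B t \<in> double_centralizers BB"
proof -
  have c: "compose (carr F) t b \<in> B" "compose (carr F) b t \<in> B" if "b \<in> B" for b
    using t that by (auto simp: spatial_multipliers_def)
  have tc: "t \<in> carr (Lop F F)" using t by (auto simp: spatial_multipliers_def)
  show ?thesis
    unfolding centralizer_of_def double_centralizers_def
    using centralizer_Lop[OF t] c mult_closed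
    by (auto simp: tc) (auto simp: compose_def FF.EF.Lop_closed[OF tc] FF.EF.Lop_closed[OF B_Lop]
      intro!: restrict_ext)
qed

text \<open>\<open>t f\<close> is the limit of \<open>t (u i f)\<close>, and \<open>t\<close>
  composed with \<open>u i\<close> is left multiplication by \<open>t\<close> evaluated at an
  element of norm at most 1.\<close>

lemma centralizer_norm:
  assumes t: "t \<in> spatial_multipliers F B"
  shows "vnorm (Lop F F) t \<le> vnorm (Lop BB BB) (\<lambda>b\<in>B. compose (carr F) t b)" (is "_ \<le> ?C")
proof -
  have tc: "t \<in> carr (Lop F F)" using t by (auto simp: spatial_multipliers_def)
  have C: "?C \<ge> 0" by (rule BL.opnorm_nonneg[OF centralizer_Lop(1)[OF t]])
  show ?thesis
  proof (rule FF.EF.opnorm_le[OF C])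
    fix f assume f: "f \<in> carr F"
    have "vnorm F (t (u i f)) \<le> ?C * vnorm F f" for i
    proof -
      have "vnorm (Lop F F) (compose (carr F) t (u i)) \<le> ?C * vnorm (Lop F F) (u i)"
        using BL.norm_le_opnorm[OF centralizer_Lop(1)[OF t], of "u i"] unit_mem by simp
      also have "\<dots> \<le> ?C * 1" by (intro mult_left_mono C unit_contractive)
      finally have "vnorm F (compose (carr F) t (u i) f) \<le> ?C * vnorm F f"
        using f tc unit_mem by (intro FF.EF.norm_le_opnorm') auto
      then show ?thesis using f by (simp add: compose_def)
    qed
    moreover have "vlim F (\<lambda>i. t (u i f)) (t f) G"
      by (rule FF.EF.vlim_Lop[OF unit_strong[OF f] tc]) (use f unit_mem in auto)
    ultimately show "vnorm F (t f) \<le> ?C * vnorm F f"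
      using norm_vlim_le[of "\<lambda>i. t (u i f)" "t f" G, OF _ nontrivial] tc f B_Lop[OF unit_mem]
      by simp
  qed
qed

lemma centralizer_inj:
  assumes "s \<in> spatial_multipliers F B" "t \<in> spatial_multipliers F B"
    "\<And>b. b \<in> B \<Longrightarrow> compose (carr F) s b = compose (carr F) t b"
  shows "s = t"
proof -
  have c: "s \<in> carr (Lop F F)" "t \<in> carr (Lop F F)"
    using assms by (auto simp: spatial_multipliers_def)
  show ?thesis
  proof (rule FF.EF.Lop_ext[OF c])
    fix f assume f: "f \<in> carr F"
    have eq: "s (u i f) = t (u i f)" for i
      using fun_cong[OF assms(3)[OF unit_mem[of i]], of f] f by (simp add: compose_def)
    have "vlim F (\<lambda>i. t (u i f)) (s f) G" "vlim F (\<lambda>i. t (u i f)) (t f) G"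
      using FF.EF.vlim_Lop[OF unit_strong[OF f] c(1)] FF.EF.vlim_Lop[OF unit_strong[OF f] c(2)]
        f unit_mem by (simp_all add: eq)
    then show "s f = t f"
      by (rule vlim_unique[OF _ _ nontrivial]) (simp_all add: c f unit_mem)
  qed
qed

text \<open>On vectors \<open>u k f\<close> the limit can be named: \<open>L (u i)\<close> times
  \<open>u k\<close> equals \<open>L\<close> of the product \<open>u i\<close> times
  \<open>u k\<close>, which tends to \<open>L (u k)\<close>. As \<open>u k f\<close> is close to
  \<open>f\<close> for suitable \<open>k\<close> and the \<open>L (u i)\<close> are uniformly
  bounded, \<open>L (u k) f\<close> serves as the approximating vector in
  \<open>vcomplete_net\<close>.\<close>

lemma centralizer_limit:
  assumes L: "L \<in> carr (Lop BB BB)"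
    and mod: "\<And>a b. a \<in> B \<Longrightarrow> b \<in> B \<Longrightarrow> L (compose (carr F) a b) = compose (carr F) (L a) b"
    and f: "f \<in> carr F"
  obtains g where "g \<in> carr F" "vlim F (\<lambda>i. L (u i) f) g G"
proof -
  let ?C = "vnorm (Lop BB BB) L"
  have C: "?C \<ge> 0" by (rule BL.opnorm_nonneg[OF L])
  have Lu: "L (u i) \<in> B" "vnorm (Lop F F) (L (u i)) \<le> ?C" for i
    using BL_closed[OF L unit_mem] BL.norm_le_opnorm[OF L, of "u i"] unit_mem
      mult_left_mono[OF unit_contractive[of i] C] by auto
  show thesis
  proof (rule vcomplete_net[OF complete nontrivial])
    show "L (u i) f \<in> carr F" for i using Lu f by auto
    fix \<epsilon> :: real assume \<epsilon>: "\<epsilon> > 0"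
    have "\<epsilon> / (2 * (?C + 1)) > 0" using C \<epsilon> by simp
    then obtain k where k: "vnorm F (vdiff F (u k f) f) < \<epsilon> / (2 * (?C + 1))"
      using vlimD[OF unit_strong[OF f]] eventually_happens nontrivial by blast
    \<comment> \<open>With \<open>k\<close> fixed, boundedness of \<open>L\<close> turns the left
      unit property for \<open>u k\<close> into norm convergence of the images.\<close>
    have "vlim BB (\<lambda>i. L (compose (carr F) (u i) (u k))) (L (u k)) G"
      by (rule BL.vlim_Lop[OF _ L]) (auto simp: vlim_BB mult_closed unit_left unit_mem)
    then have "vlim F (\<lambda>i. L (compose (carr F) (u i) (u k)) f) (L (u k) f) G"
      unfolding vlim_BB by (rule FF.EF.vlim_Lop_apply) (auto simp: unit_mem mult_closed f BL_closed[OF L])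
    then have "vlim F (\<lambda>i. L (u i) (u k f)) (L (u k) f) G"
      using unit_mem f by (simp add: mod compose_eq)
    then have "\<forall>\<^sub>F i in G. vnorm F (vdiff F (L (u i) (u k f)) (L (u k) f)) < \<epsilon> / 2"
      using vlimD[of _ _ _ "\<epsilon>/2"] \<epsilon> by simp
    then have "\<forall>\<^sub>F i in G. vnorm F (vdiff F (L (u i) f) (L (u k) f)) < \<epsilon>"
    proof (rule eventually_mono)
      fix i assume i: "vnorm F (vdiff F (L (u i) (u k f)) (L (u k) f)) < \<epsilon> / 2"
      have ukf: "u k f \<in> carr F" using unit_mem f by auto
      have "vnorm F (vdiff F (L (u i) f) (L (u i) (u k f))) \<le> ?C * vnorm F (vdiff F f (u k f))"
        using FF.EF.norm_le_opnorm'[OF B_Lop[OF Lu(1)] _ Lu(2), of "vdiff F f (u k f)" i] f ukf Lu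
        by (simp add: FF.EF.Lop_diff)
      also have "\<dots> \<le> ?C * (\<epsilon> / (2 * (?C + 1)))"
        using k f ukf by (intro mult_left_mono C) (simp add: norm_diff_commute)
      also have "\<dots> < \<epsilon> / 2" using C \<epsilon> by (simp add: field_simps)
      finally show "vnorm F (vdiff F (L (u i) f) (L (u k) f)) < \<epsilon>"
        using i norm_diff_triangle[of "L (u i) f" "L (u i) (u k f)" "L (u k) f"] Lu f ukf
        by force
    qed
    then show "\<exists>y\<in>carr F. \<forall>\<^sub>F i in G. vnorm F (vdiff F (L (u i) f) y) < \<epsilon>"
      using Lu f by auto
  qed (use that in blast)
qed

text \<open>The strong limit of the \<open>L (u i)\<close> is the only candidate. It induces
  \<open>L\<close> because \<open>L (u i)\<close> times \<open>b\<close> is \<open>L\<close> of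
  \<open>u i\<close> times \<open>b\<close>, and it induces \<open>R\<close> by the identity that
  couples \<open>L\<close> with \<open>R\<close>.\<close>

lemma centralizer_surj:
  assumes "(L, R) \<in> double_centralizers BB"
  obtains t where "t \<in> spatial_multipliers F B" "centralizer_of F B t = (L, R)"
proof -
  have L: "L \<in> carr (Lop BB BB)" and R: "R \<in> carr (Lop BB BB)"
    and mod: "\<And>a b. a \<in> B \<Longrightarrow> b \<in> B \<Longrightarrow> L (compose (carr F) a b) = compose (carr F) (L a) b"
    and dc: "\<And>a b. a \<in> B \<Longrightarrow> b \<in> B \<Longrightarrow> compose (carr F) a (L b) = compose (carr F) (R a) b"
    using assms by (auto simp: double_centralizers_def)
  let ?C = "vnorm (Lop BB BB) L"
  have C: "?C \<ge> 0" by (rule BL.opnorm_nonneg[OF L])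
  have Lu: "L (u i) \<in> B" "vnorm (Lop F F) (L (u i)) \<le> ?C" for i
    using BL_closed[OF L unit_mem] BL.norm_le_opnorm[OF L, of "u i"] unit_mem
      mult_left_mono[OF unit_contractive[of i] C] by auto
  have ex: "\<exists>g. g \<in> carr F \<and> vlim F (\<lambda>i. L (u i) f) g G" if "f \<in> carr F" for f
    using centralizer_limit[OF L mod that] by blast
  define t where "t = (\<lambda>f\<in>carr F. SOME g. g \<in> carr F \<and> vlim F (\<lambda>i. L (u i) f) g G)"
  have t: "t f \<in> carr F" "vlim F (\<lambda>i. L (u i) f) (t f) G" if "f \<in> carr F" for f
    using someI_ex[OF ex[OF that]] that by (simp_all add: t_def)
  have t_eq: "t f = g" if "f \<in> carr F" "g \<in> carr F" "vlim F (\<lambda>i. L (u i) f) g G" for f g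
    using that t Lu nontrivial by (intro vlim_unique[of "\<lambda>i. L (u i) f"]) auto
  have tL: "t \<in> carr (Lop F F)"
  proof (rule FF.EF.Lop_memI[of _ ?C])
    show "t \<in> extensional (carr F)" by (simp add: t_def)
    show "t f \<in> carr F" if "f \<in> carr F" for f using t that by simp
    show "t (vadd F f g) = vadd F (t f) (t g)" if fg: "f \<in> carr F" "g \<in> carr F" for f g
    proof (rule t_eq)
      have "vlim F (\<lambda>i. vadd F (L (u i) f) (L (u i) g)) (vadd F (t f) (t g)) G"
        using t fg Lu by (intro vlim_add) auto
      then show "vlim F (\<lambda>i. L (u i) (vadd F f g)) (vadd F (t f) (t g)) G"
        using fg Lu by (simp add: FF.EF.Lop_add)
    qed (use fg t in auto)
    show "t (vscale F c f) = vscale F c (t f)" if f: "f \<in> carr F" for c f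
    proof (rule t_eq)
      have "vlim F (\<lambda>i. vscale F c (L (u i) f)) (vscale F c (t f)) G"
        using t f Lu by (intro vlim_scale) auto
      then show "vlim F (\<lambda>i. L (u i) (vscale F c f)) (vscale F c (t f)) G"
        using f Lu by (simp add: FF.EF.Lop_scale)
    qed (use f t in auto)
    show "vnorm F (t f) \<le> ?C * vnorm F f" if f: "f \<in> carr F" for f
      using t f Lu by (intro norm_vlim_le[OF t(2)[OF f] nontrivial] FF.EF.norm_le_opnorm') auto
  qed
  have tb: "compose (carr F) t b = L b" if b: "b \<in> B" for b
  proof (rule FF.EF.Lop_ext)
    fix f assume f: "f \<in> carr F"
    have "vlim BB (\<lambda>i. L (compose (carr F) (u i) b)) (L b) G"
      by (rule BL.vlim_Lop[OF _ L]) (auto simp: vlim_BB mult_closed unit_left unit_mem b)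
    then have "vlim F (\<lambda>i. L (compose (carr F) (u i) b) f) (L b f) G"
      unfolding vlim_BB
      by (rule FF.EF.vlim_Lop_apply) (auto simp: unit_mem mult_closed f b BL_closed[OF L])
    then have "vlim F (\<lambda>i. L (u i) (b f)) (L b f) G"
      using unit_mem b f by (simp add: mod compose_eq)
    then have "t (b f) = L b f" using b f BL_closed[OF L b] by (intro t_eq) auto
    then show "compose (carr F) t b f = L b f" using f by (simp add: compose_def)
  qed (use tL b BL_closed[OF L b] in auto)
  \<comment> \<open>\<open>b\<close> times \<open>L (u i)\<close> equals \<open>R b\<close> times
    \<open>u i\<close>. Evaluated at \<open>f\<close>, the left side tends to
    \<open>b (t f)\<close>, and the right side to \<open>R b f\<close> because \<open>u i f\<close>
    tends to \<open>f\<close>; so only strong convergence of the units is involved.\<close>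
  have bt: "compose (carr F) b t = R b" if b: "b \<in> B" for b
  proof (rule FF.EF.Lop_ext)
    fix f assume f: "f \<in> carr F"
    have Rb: "R b \<in> B" by (rule BL_closed[OF R b])
    have eq: "b (L (u i) f) = R b (u i f)" for i
      using fun_cong[OF dc[OF b unit_mem[of i]], of f] f by (simp add: compose_def)
    have "vlim F (\<lambda>i. b (L (u i) f)) (b (t f)) G"
      by (rule FF.EF.vlim_Lop[OF t(2)[OF f] B_Lop[OF b]]) (use t f Lu in auto)
    moreover have "vlim F (\<lambda>i. R b (u i f)) (R b f) G"
      by (rule FF.EF.vlim_Lop[OF unit_strong[OF f] B_Lop[OF Rb]]) (use f unit_mem in auto)
    ultimately have "b (t f) = R b f"
      unfolding eq by (rule vlim_unique[OF _ _ nontrivial]) (use f Rb unit_mem b t in auto)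
    then show "compose (carr F) b t f = R b f" using f by (simp add: compose_def)
  qed (use tL b BL_closed[OF R b] in auto)
  have ext: "L \<in> extensional B" "R \<in> extensional B"
    using BL.Lop_extensional[OF L] BL.Lop_extensional[OF R] by simp_all
  have "centralizer_of F B t = (L, R)"
    using ext tb bt by (auto simp: centralizer_of_def intro!: extensionalityI[of _ B])
  moreover have "t \<in> spatial_multipliers F B"
    using tL tb bt BL_closed[OF L] BL_closed[OF R] by (auto simp: spatial_multipliers_def)
  ultimately show thesis using that by blast
qed

theorem centralizer_iso:
  "isometric_algebra_iso (centralizer_of F B)
     ((op_algebra F)\<lparr>carr := spatial_multipliers F B\<rparr>) (multiplier_algebra BB)"
  unfolding isometric_algebra_iso_def
proof (intro conjI ballI allI)
  let ?S = "spatial_multipliers F B"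
  have S: "t \<in> carr (Lop F F)" "b \<in> B \<Longrightarrow> compose (carr F) t b \<in> B"
      "b \<in> B \<Longrightarrow> compose (carr F) b t \<in> B" if "t \<in> ?S" for t b
    using that by (auto simp: spatial_multipliers_def)
  have "inj_on (centralizer_of F B) ?S"
  proof (rule inj_onI)
    fix s t assume st: "s \<in> ?S" "t \<in> ?S" and eq: "centralizer_of F B s = centralizer_of F B t"
    have "compose (carr F) s b = compose (carr F) t b" if "b \<in> B" for b
      using fun_cong[OF arg_cong[OF eq, of fst], of b] that by (simp add: centralizer_of_def)
    then show "s = t" using centralizer_inj st by blast
  qed
  moreover have "centralizer_of F B ` ?S = double_centralizers BB"
  proof
    show "centralizer_of F B ` ?S \<subseteq> double_centralizers BB" using centralizer_in by blast
    show "double_centralizers BB \<subseteq> centralizer_of F B ` ?S"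
    proof
      fix LR assume "LR \<in> double_centralizers BB"
      moreover obtain L R where "LR = (L, R)" by (cases LR)
      ultimately show "LR \<in> centralizer_of F B ` ?S"
        using centralizer_surj[of L R] by (metis image_eqI)
    qed
  qed
  ultimately show "bij_betw (centralizer_of F B) (carr ((op_algebra F)\<lparr>carr := ?S\<rparr>))
      (carr (multiplier_algebra BB))"
    by (simp add: bij_betw_def multiplier_algebra_def)
  {
    fix s t
    assume "s \<in> carr ((op_algebra F)\<lparr>carr := ?S\<rparr>)" "t \<in> carr ((op_algebra F)\<lparr>carr := ?S\<rparr>)"
    then have st: "s \<in> ?S" "t \<in> ?S" by simp_all
    have c: "s \<in> carr (Lop F F)" "t \<in> carr (Lop F F)" using S st by auto
    show "centralizer_of F B (vadd ((op_algebra F)\<lparr>carr := ?S\<rparr>) s t)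
        = vadd (multiplier_algebra BB) (centralizer_of F B s) (centralizer_of F B t)"
      using c by (auto simp: centralizer_of_def multiplier_algebra_def compose_def Lop_simps(2)
          FF.EF.Lop_add intro!: restrict_ext)
    show "centralizer_of F B (amult ((op_algebra F)\<lparr>carr := ?S\<rparr>) s t)
        = amult (multiplier_algebra BB) (centralizer_of F B s) (centralizer_of F B t)"
      using c S(2)[OF st(2)] S(3)[OF st(1)]
      by (auto simp: centralizer_of_def multiplier_algebra_def compose_def[of B] intro!: restrict_ext)
         (auto simp: compose_def intro!: restrict_ext)
  }
  {
    fix c t assume "t \<in> carr ((op_algebra F)\<lparr>carr := ?S\<rparr>)"
    then have t: "t \<in> ?S" by simp
    show "centralizer_of F B (vscale ((op_algebra F)\<lparr>carr := ?S\<rparr>) c t)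
        = vscale (multiplier_algebra BB) c (centralizer_of F B t)"
      using S(1)[OF t] by (auto simp: centralizer_of_def multiplier_algebra_def compose_def Lop_simps(4)
          FF.EF.Lop_scale intro!: restrict_ext)
  }
  fix t assume "t \<in> carr ((op_algebra F)\<lparr>carr := ?S\<rparr>)"
  then have t: "t \<in> ?S" by simp
  \<comment> \<open>Both multiplications have norm at most that of \<open>t\<close>, and the left
    one attains it, so the maximum is exact.\<close>
  show "vnorm (multiplier_algebra BB) (centralizer_of F B t) = vnorm ((op_algebra F)\<lparr>carr := ?S\<rparr>) t"
    using centralizer_Lop(3,4)[OF t] centralizer_norm[OF t]
    by (simp add: centralizer_of_def multiplier_algebra_def)
qed

end

section \<open>The Banach space \<open>L\<^sup>p\<close>\<close>

text \<open>For positive arguments this is convexity of \<open>x powr p\<close>; if one argument is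
  0, what remains is \<open>r powr p \<le> r\<close> for \<open>0 < r \<le> 1\<close>.\<close>

lemma powr_convex_combination:
  fixes a b s t p :: real
  assumes "1 \<le> p" "0 \<le> a" "0 \<le> b" "0 < s" "0 < t" "s + t = 1"
  shows "(s * a + t * b) powr p \<le> s * a powr p + t * b powr p"
proof -
  have shrink: "(r * c) powr p \<le> r * c powr p" if "0 \<le> c" "0 < r" "r \<le> 1" for r c :: real
  proof -
    have "r powr p \<le> r powr 1" using that assms by (intro powr_mono') auto
    then show ?thesis using that by (simp add: powr_mult mult_right_mono)
  qed
  consider "a = 0" | "b = 0" | "0 < a" "0 < b" using assms by linarith
  then show ?thesis
  proof cases
    case 3
    have "convex_on {0<..} (\<lambda>x. x powr p)" using assms by (rule_tac powr_convex)
    from convex_onD[OF this, of t a b] show ?thesis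
      using 3 assms by (simp add: eq_diff_eq[symmetric])
  qed (use shrink[of b t] shrink[of a s] assms in auto)
qed

locale Lp_exponent =
  fixes p :: real
  assumes p_ge_1: "1 \<le> p"
begin

lemma p_pos: "0 < p" using p_ge_1 by simp

text \<open>The \<open>p\<close>-th power of the norm as a nonnegative integral, meaningful before
  integrability is known. The Bochner integral in \<open>Nm\<close> is 0 for a nonintegrable
  function, so estimates are made with \<open>Lpn\<close> and transferred by
  \<open>Nm_leI\<close>.\<close>

definition Lpn :: "'a measure \<Rightarrow> ('a \<Rightarrow> complex) \<Rightarrow> ennreal" where
  "Lpn M f = (\<integral>\<^sup>+x. ennreal (norm (f x) powr p) \<partial>M)"

definition Nm :: "'a measure \<Rightarrow> ('a \<Rightarrow> complex) \<Rightarrow> real" where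
  "Nm M f = (LINT x|M. norm (f x) powr p) powr (1 / p)"

lemma Lp_fun_iff: "f \<in> Lp_fun p M \<longleftrightarrow> f \<in> borel_measurable M \<and> Lpn M f < \<infinity>"
  by (auto simp: Lp_fun_def integrable_iff_bounded Lpn_def)

lemma Lp_fun_measurable [measurable_dest]: "f \<in> Lp_fun p M \<Longrightarrow> f \<in> borel_measurable M"
  by (simp add: Lp_fun_def)

lemma Lp_fun_integrable: "f \<in> Lp_fun p M \<Longrightarrow> integrable M (\<lambda>x. norm (f x) powr p)"
  by (simp add: Lp_fun_def)

lemma Nm_nonneg: "0 \<le> Nm M f"
  by (simp add: Nm_def)

lemma Nm_powr: "Nm M f powr p = (LINT x|M. norm (f x) powr p)"
  using p_pos by (simp add: Nm_def powr_powr integral_nonneg_AE)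

lemma Lpn_eq_Nm: "f \<in> Lp_fun p M \<Longrightarrow> Lpn M f = ennreal (Nm M f powr p)"
  unfolding Nm_powr Lpn_def by (intro nn_integral_eq_integral Lp_fun_integrable) auto

lemma Lp_funI:
  assumes "f \<in> borel_measurable M" "Lpn M f \<le> ennreal c"
  shows "f \<in> Lp_fun p M"
  using assms by (auto simp: Lp_fun_iff intro: le_less_trans)

lemma Nm_leI:
  assumes "f \<in> borel_measurable M" "Lpn M f \<le> ennreal (c powr p)" "0 \<le> c"
  shows "Nm M f \<le> c"
proof -
  have f: "f \<in> Lp_fun p M" using assms by (intro Lp_funI)
  have "Nm M f powr p \<le> c powr p"
    using assms(2) Lpn_eq_Nm[OF f] by simp
  then have "(Nm M f powr p) powr (1/p) \<le> (c powr p) powr (1/p)"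
    using p_pos by (rule_tac powr_mono2) auto
  then show ?thesis using p_pos assms(3) Nm_nonneg[of M f] by (simp add: powr_powr)
qed

lemma Lpn_le:
  assumes "f \<in> Lp_fun p M" "Nm M f \<le> c"
  shows "Lpn M f \<le> ennreal (c powr p)"
  unfolding Lpn_eq_Nm[OF assms(1)] using assms(2) Nm_nonneg p_pos
  by (intro ennreal_leI powr_mono2) auto

lemma Lpn_cong_AE: "AE x in M. f x = g x \<Longrightarrow> Lpn M f = Lpn M g"
  unfolding Lpn_def by (intro nn_integral_cong_AE) auto

lemma Nm_cong_AE:
  assumes "AE x in M. f x = g x" "f \<in> borel_measurable M" "g \<in> borel_measurable M"
  shows "Nm M f = Nm M g"
  unfolding Nm_def using assms by (intro arg_cong2[where f = "(powr)"] integral_cong_AE) auto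

text \<open>Minkowski's inequality by convexity: \<open>norm (f x) + norm (g x)\<close> is
  \<open>\<alpha> + \<beta>\<close> times a convex combination, with weights \<open>s\<close> and
  \<open>t\<close>, of the quotients \<open>norm (f x) / \<alpha>\<close> and
  \<open>norm (g x) / \<beta>\<close>. Strict bounds in place of the norms themselves keep the
  denominators positive when \<open>f\<close> or \<open>g\<close> vanishes almost
  everywhere.\<close>

lemma Lpn_add_le:
  assumes f: "f \<in> Lp_fun p M" and g: "g \<in> Lp_fun p M" and "Nm M f < \<alpha>" "Nm M g < \<beta>"
  shows "Lpn M (\<lambda>x. f x + g x) \<le> ennreal ((\<alpha> + \<beta>) powr p)"
proof -
  note [measurable] = Lp_fun_measurable[OF f] Lp_fun_measurable[OF g]
  have pos: "0 < \<alpha>" "0 < \<beta>" using assms(3,4) Nm_nonneg[of M f] Nm_nonneg[of M g] by linarith+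
  define s where "s = \<alpha> / (\<alpha> + \<beta>)"
  define t where "t = \<beta> / (\<alpha> + \<beta>)"
  define C where "C = (\<alpha> + \<beta>) powr p"
  have st: "0 < s" "0 < t" "s + t = 1"
    using pos by (auto simp: s_def t_def simp flip: add_divide_distrib)
  have sc: "(\<alpha> + \<beta>) * (s * (c / \<alpha>)) = c" "(\<alpha> + \<beta>) * (t * (c / \<beta>)) = c" for c
    using pos by (simp_all add: s_def t_def)
  have pt: "norm (f x + g x) powr p
      \<le> C * (s / \<alpha> powr p) * norm (f x) powr p + C * (t / \<beta> powr p) * norm (g x) powr p" for x
  proof -
    have "norm (f x + g x) powr p \<le> (norm (f x) + norm (g x)) powr p"
      using p_pos by (intro powr_mono2 norm_triangle_ineq) auto
    also have "norm (f x) + norm (g x)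
        = (\<alpha> + \<beta>) * (s * (norm (f x) / \<alpha>) + t * (norm (g x) / \<beta>))"
      by (simp only: distrib_left[of "\<alpha> + \<beta>"] sc)
    also have "\<dots> powr p = C * (s * (norm (f x) / \<alpha>) + t * (norm (g x) / \<beta>)) powr p"
      unfolding C_def by (rule powr_mult)
    also have "\<dots> \<le> C * (s * (norm (f x) / \<alpha>) powr p + t * (norm (g x) / \<beta>) powr p)"
      using pos st p_ge_1 unfolding C_def by (intro mult_left_mono powr_convex_combination) auto
    finally show ?thesis using pos by (simp add: powr_divide algebra_simps)
  qed
  have "Lpn M (\<lambda>x. f x + g x) \<le> (\<integral>\<^sup>+x. ennreal (C * (s / \<alpha> powr p)) * ennreal (norm (f x) powr p)
      + ennreal (C * (t / \<beta> powr p)) * ennreal (norm (g x) powr p) \<partial>M)"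
    unfolding Lpn_def using pt st pos
    by (intro nn_integral_mono) (simp add: ennreal_mult'[symmetric] C_def flip: ennreal_plus)
  also have "\<dots> = ennreal (C * (s / \<alpha> powr p)) * Lpn M f + ennreal (C * (t / \<beta> powr p)) * Lpn M g"
    unfolding Lpn_def by (simp add: nn_integral_add nn_integral_cmult)
  also have "\<dots> \<le> ennreal (C * (s / \<alpha> powr p)) * ennreal (\<alpha> powr p)
      + ennreal (C * (t / \<beta> powr p)) * ennreal (\<beta> powr p)"
    using Lpn_le[OF f, of \<alpha>] Lpn_le[OF g, of \<beta>] assms(3,4) by (intro add_mono mult_left_mono) auto
  also have "\<dots> = ennreal (C * s + C * t)"
    using pos st by (simp add: ennreal_mult'[symmetric] C_def flip: ennreal_plus)
  also have "C * s + C * t = C" using st(3) by (simp flip: distrib_left)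
  finally show ?thesis by (simp add: C_def)
qed

lemma Lp_fun_add:
  assumes "f \<in> Lp_fun p M" "g \<in> Lp_fun p M"
  shows "(\<lambda>x. f x + g x) \<in> Lp_fun p M"
  by (rule Lp_funI[OF _ Lpn_add_le[OF assms less_add_one less_add_one]])
    (use assms in \<open>auto intro!: borel_measurable_add Lp_fun_measurable\<close>)

lemma Nm_triangle:
  assumes "f \<in> Lp_fun p M" "g \<in> Lp_fun p M"
  shows "Nm M (\<lambda>x. f x + g x) \<le> Nm M f + Nm M g"
proof (rule field_le_epsilon)
  fix e :: real assume e: "e > 0"
  \<comment> \<open>The strict bounds of \<open>Lpn_add_le\<close> are met with half of the slack
    each.\<close>
  have "Nm M (\<lambda>x. f x + g x) \<le> (Nm M f + e/2) + (Nm M g + e/2)"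
    by (rule Nm_leI[OF _ Lpn_add_le[OF assms]])
      (use e assms Nm_nonneg[of M f] Nm_nonneg[of M g] in \<open>auto intro: Lp_fun_measurable Lp_fun_add\<close>)
  then show "Nm M (\<lambda>x. f x + g x) \<le> Nm M f + Nm M g + e" by simp
qed

lemma Lp_fun_cmult:
  assumes "f \<in> Lp_fun p M"
  shows "(\<lambda>x. c * f x) \<in> Lp_fun p M" "Nm M (\<lambda>x. c * f x) = norm c * Nm M f"
proof -
  have eq: "norm (c * f x) powr p = norm c powr p * norm (f x) powr p" for x
    by (simp add: norm_mult powr_mult)
  show "(\<lambda>x. c * f x) \<in> Lp_fun p M"
    using assms unfolding Lp_fun_def by (auto simp: norm_mult powr_mult intro!: integrable_mult_right borel_measurable_times)
  show "Nm M (\<lambda>x. c * f x) = norm c * Nm M f"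
    unfolding Nm_def eq using p_pos by (simp add: powr_mult powr_powr integral_nonneg_AE)
qed

lemma Lp_fun_zero: "(\<lambda>x. 0) \<in> Lp_fun p M" "Nm M (\<lambda>x. 0) = 0"
  using p_pos by (auto simp: Lp_fun_def Nm_def)

lemma Lp_fun_diff:
  assumes "f \<in> Lp_fun p M" "g \<in> Lp_fun p M"
  shows "(\<lambda>x. f x - g x) \<in> Lp_fun p M"
  using Lp_fun_add[OF assms(1) Lp_fun_cmult(1)[OF assms(2), of "-1"]] by simp

lemma Nm_zero_AE:
  assumes "f \<in> Lp_fun p M" "Nm M f = 0"
  shows "AE x in M. f x = 0"
proof -
  have "(LINT x|M. norm (f x) powr p) = 0"
    using Nm_powr[of M f] assms p_pos by simp
  then have "AE x in M. norm (f x) powr p = 0"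
    using integral_nonneg_eq_0_iff_AE[OF Lp_fun_integrable[OF assms(1)]] by simp
  then show ?thesis by simp
qed

section \<open>Classes modulo null sets as a normed space\<close>

lemma equiv_ae_eq: "equiv (Lp_fun p M) (ae_eq p M)"
  by (rule equivI) (auto simp: ae_eq_def refl_on_def sym_def trans_def intro: AE_mp)

lemma Lp_class_eq_iff:
  "f \<in> Lp_fun p M \<Longrightarrow> g \<in> Lp_fun p M \<Longrightarrow>
    Lp_class p M f = Lp_class p M g \<longleftrightarrow> (AE x in M. f x = g x)"
  unfolding Lp_class_def by (simp add: eq_equiv_class_iff[OF equiv_ae_eq]) (simp add: ae_eq_def)

lemma carr_Lp: "carr (Lp p M) = Lp_class p M ` Lp_fun p M"
  by (auto simp: Lp_def Lp_class_def quotient_def)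

lemma Lp_class_carr [simp]: "f \<in> Lp_fun p M \<Longrightarrow> Lp_class p M f \<in> carr (Lp p M)"
  by (simp add: carr_Lp)

lemma rep_Lp_class:
  assumes "f \<in> Lp_fun p M"
  shows "rep (Lp_class p M f) \<in> Lp_fun p M" "AE x in M. rep (Lp_class p M f) x = f x"
proof -
  have "f \<in> Lp_class p M f" using assms by (simp add: Lp_class_def ae_eq_def)
  then have "rep (Lp_class p M f) \<in> Lp_class p M f"
    unfolding rep_def by (rule someI[of "\<lambda>g. g \<in> Lp_class p M f"])
  then show "rep (Lp_class p M f) \<in> Lp_fun p M" "AE x in M. rep (Lp_class p M f) x = f x"
    by (auto simp: Lp_class_def ae_eq_def)
qed

lemma rep_Lp_fun [simp]: "u \<in> carr (Lp p M) \<Longrightarrow> rep u \<in> Lp_fun p M"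
  using rep_Lp_class by (auto simp: carr_Lp)

lemma Lp_class_rep [simp]:
  assumes "u \<in> carr (Lp p M)"
  shows "Lp_class p M (rep u) = u"
proof -
  obtain f where f: "f \<in> Lp_fun p M" and u: "u = Lp_class p M f"
    using assms by (auto simp: carr_Lp)
  show ?thesis unfolding u using rep_Lp_class[OF f] f by (simp add: Lp_class_eq_iff)
qed

lemma vadd_Lp: "vadd (Lp p M) u v = Lp_class p M (\<lambda>x. rep u x + rep v x)"
  and vzero_Lp: "vzero (Lp p M) = Lp_class p M (\<lambda>x. 0)"
  and vscale_Lp: "vscale (Lp p M) c u = Lp_class p M (\<lambda>x. c * rep u x)"
  and vnorm_Lp: "vnorm (Lp p M) u = Nm M (rep u)"
  by (simp_all add: Lp_def Nm_def)

lemma vadd_Lp_class: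
  assumes "f \<in> Lp_fun p M" "g \<in> Lp_fun p M"
  shows "vadd (Lp p M) (Lp_class p M f) (Lp_class p M g) = Lp_class p M (\<lambda>x. f x + g x)"
  unfolding vadd_Lp using rep_Lp_class(2)[OF assms(1)] rep_Lp_class(2)[OF assms(2)] assms
  by (subst Lp_class_eq_iff) (auto intro!: Lp_fun_add rep_Lp_class(1))

lemma vscale_Lp_class:
  assumes "f \<in> Lp_fun p M"
  shows "vscale (Lp p M) c (Lp_class p M f) = Lp_class p M (\<lambda>x. c * f x)"
  unfolding vscale_Lp using rep_Lp_class(2)[OF assms(1)] assms
  by (subst Lp_class_eq_iff) (auto intro!: Lp_fun_cmult rep_Lp_class(1))

lemma vnorm_Lp_class:
  assumes "f \<in> Lp_fun p M"
  shows "vnorm (Lp p M) (Lp_class p M f) = Nm M f"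
  unfolding vnorm_Lp using rep_Lp_class[OF assms] assms
  by (intro Nm_cong_AE) (auto intro: Lp_fun_measurable)

lemma vdiff_Lp_class:
  assumes "f \<in> Lp_fun p M" "g \<in> Lp_fun p M"
  shows "vdiff (Lp p M) (Lp_class p M f) (Lp_class p M g) = Lp_class p M (\<lambda>x. f x - g x)"
  using vadd_Lp_class[OF assms(1) Lp_fun_cmult(1)[OF assms(2), of "-1"]] assms
  by (simp add: vdiff_def vscale_Lp_class)

lemma cnspace_Lp: "cnspace (Lp p M)"
proof
  fix u v w assume "u \<in> carr (Lp p M)" "v \<in> carr (Lp p M)"
  then obtain f g where fg: "f \<in> Lp_fun p M" "g \<in> Lp_fun p M"
      and uv: "u = Lp_class p M f" "v = Lp_class p M g"
    by (auto simp: carr_Lp)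
  note s = vadd_Lp_class vscale_Lp_class vnorm_Lp_class Lp_fun_add Lp_fun_cmult
  show "vadd (Lp p M) u v \<in> carr (Lp p M)" using fg by (simp add: uv s)
  show "vadd (Lp p M) u v = vadd (Lp p M) v u" using fg by (simp add: uv s add.commute)
  show "vscale (Lp p M) c (vadd (Lp p M) u v)
      = vadd (Lp p M) (vscale (Lp p M) c u) (vscale (Lp p M) c v)" for c
    using fg by (simp add: uv s distrib_left)
  show "vnorm (Lp p M) (vadd (Lp p M) u v) \<le> vnorm (Lp p M) u + vnorm (Lp p M) v"
    using fg by (simp add: uv s Nm_triangle)
  assume "w \<in> carr (Lp p M)"
  then obtain h where "h \<in> Lp_fun p M" "w = Lp_class p M h"
    by (auto simp: carr_Lp)
  then show "vadd (Lp p M) (vadd (Lp p M) u v) w = vadd (Lp p M) u (vadd (Lp p M) v w)"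
    using fg by (simp add: uv s add.assoc)
next
  show "vzero (Lp p M) \<in> carr (Lp p M)" by (simp add: vzero_Lp Lp_fun_zero)
  fix u c d assume "u \<in> carr (Lp p M)"
  then obtain f where f: "f \<in> Lp_fun p M" and u: "u = Lp_class p M f"
    by (auto simp: carr_Lp)
  note s = vadd_Lp_class vscale_Lp_class vnorm_Lp_class Lp_fun_add Lp_fun_cmult vzero_Lp Lp_fun_zero
  show "vscale (Lp p M) c u \<in> carr (Lp p M)" using f by (simp add: u s)
  show "vadd (Lp p M) u (vzero (Lp p M)) = u" using f by (simp add: u s)
  show "vscale (Lp p M) (c + d) u = vadd (Lp p M) (vscale (Lp p M) c u) (vscale (Lp p M) d u)"
    using f by (simp add: u s distrib_right)
  show "vscale (Lp p M) c (vscale (Lp p M) d u) = vscale (Lp p M) (c * d) u"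
    using f by (simp add: u s mult.assoc)
  show "vscale (Lp p M) 1 u = u" using f by (simp add: u s)
  show "vscale (Lp p M) 0 u = vzero (Lp p M)" using f by (simp add: u s)
  show "vnorm (Lp p M) (vscale (Lp p M) c u) = norm c * vnorm (Lp p M) u" using f by (simp add: u s)
  assume "vnorm (Lp p M) u = 0"
  then show "u = vzero (Lp p M)"
    using f Nm_zero_AE[OF f] by (simp add: u s Lp_class_eq_iff)
qed

text \<open>The weights \<open>2 ^ k\<close> make the increments of the subsequence summable almost everywhere
  without a second use of Minkowski's inequality.\<close>

lemma AE_convergent_subsequence:
  assumes f: "\<And>k. f k \<in> Lp_fun p M"
    and d: "\<And>k. Nm M (\<lambda>x. f (Suc k) x - f k x) \<le> (1/4) ^ k"
  shows "AE x in M. convergent (\<lambda>k. f k x)"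
proof -
  note [measurable] = Lp_fun_measurable[OF f]
  define h where "h k x = f (Suc k) x - f k x" for k x
  have hL: "h k \<in> Lp_fun p M" for k unfolding h_def by (intro Lp_fun_diff f)
  note [measurable] = Lp_fun_measurable[OF hL]
  have le: "ennreal ((2 ^ k) powr p) * Lpn M (h k) \<le> ennreal ((1/2) ^ k)" for k
  proof -
    have "ennreal ((2 ^ k) powr p) * Lpn M (h k) \<le> ennreal ((2 ^ k) powr p) * ennreal (((1/4) ^ k) powr p)"
      using d[of k] by (intro mult_left_mono Lpn_le hL) (simp_all add: h_def[abs_def])
    also have "\<dots> = ennreal ((2 ^ k * (1/4) ^ k) powr p)"
      by (simp add: powr_mult ennreal_mult')
    also have "2 ^ k * (1/4) ^ k = ((1/2::real) ^ k)" by (simp flip: power_mult_distrib)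
    also have "((1/2::real) ^ k) powr p \<le> ((1/2) ^ k) powr 1"
      using p_ge_1 by (intro powr_mono') (auto simp: power_le_one)
    finally show ?thesis by (simp add: ennreal_leI)
  qed
  have "(\<integral>\<^sup>+x. (\<Sum>k. ennreal ((2 ^ k) powr p) * ennreal (norm (h k x) powr p)) \<partial>M)
      = (\<Sum>k. ennreal ((2 ^ k) powr p) * Lpn M (h k))"
    by (subst nn_integral_suminf) (simp_all add: nn_integral_cmult Lpn_def)
  also have "\<dots> \<le> (\<Sum>k. ennreal ((1/2) ^ k))"
    by (intro suminf_le le) auto
  also have "\<dots> = ennreal (\<Sum>k. (1/2) ^ k)"
    by (intro suminf_ennreal_eq) (auto intro: summable_sums)
  finally have "(\<integral>\<^sup>+x. (\<Sum>k. ennreal ((2 ^ k) powr p) * ennreal (norm (h k x) powr p)) \<partial>M) \<noteq> \<infinity>"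
    by (auto simp: top_unique)
  then have "AE x in M. (\<Sum>k. ennreal ((2 ^ k) powr p) * ennreal (norm (h k x) powr p)) \<noteq> \<infinity>"
    by (intro nn_integral_PInf_AE) auto
  then show ?thesis
  proof (rule AE_mp, intro AE_I2 impI)
    fix x assume fin: "(\<Sum>k. ennreal ((2 ^ k) powr p) * ennreal (norm (h k x) powr p)) \<noteq> \<infinity>"
    define c where "c = enn2real (\<Sum>k. ennreal ((2 ^ k) powr p) * ennreal (norm (h k x) powr p))"
    have c: "c \<ge> 0" "(\<Sum>k. ennreal ((2 ^ k) powr p) * ennreal (norm (h k x) powr p)) = ennreal c"
      using fin by (simp_all add: c_def ennreal_enn2real_if)
    have "norm (h k x) \<le> c powr (1/p) * (1/2) ^ k" for k
    proof -
      have "ennreal ((2 ^ k) powr p) * ennreal (norm (h k x) powr p) \<le> ennreal c"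
        using sum_le_suminf[of "\<lambda>k. ennreal ((2 ^ k) powr p) * ennreal (norm (h k x) powr p)" "{k}"] c(2)
        by simp
      then have "(2 ^ k * norm (h k x)) powr p \<le> c"
        using c(1) by (simp add: powr_mult flip: ennreal_mult')
      then have "((2 ^ k * norm (h k x)) powr p) powr (1/p) \<le> c powr (1/p)"
        using p_pos by (intro powr_mono2) auto
      then have le: "2 ^ k * norm (h k x) \<le> c powr (1/p)" using p_pos by (simp add: powr_powr)
      have "norm (h k x) = (2 ^ k * norm (h k x)) * (1/2) ^ k" by (simp add: power_one_over)
      also have "\<dots> \<le> c powr (1/p) * (1/2) ^ k" using le by (rule mult_right_mono) simp
      finally show ?thesis .
    qed
    moreover have "summable (\<lambda>k. c powr (1/p) * (1/2) ^ k)"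
      by (intro summable_mult summable_geometric) simp
    ultimately have "summable (\<lambda>k. h k x)"
      using summable_comparison_test'[of "\<lambda>k. c powr (1/p) * (1/2) ^ k" 0 "\<lambda>k. h k x"] by blast
    then have "convergent (\<lambda>n. \<Sum>k<n. h k x)"
      by (simp add: summable_iff_convergent)
    moreover have "(\<Sum>k<n. h k x) = f n x - f 0 x" for n
      unfolding h_def by (rule sum_lessThan_telescope)
    ultimately show "convergent (\<lambda>n. f n x)"
      using convergent_diff_const_right_iff[of "\<lambda>n. f n x" "f 0 x"] by simp
  qed
qed

text \<open>Fatou's lemma, applied to the \<open>p\<close>-th powers of the absolute values.\<close>

lemma Lpn_limit_le:
  assumes f: "\<And>k. f k \<in> Lp_fun p M" and g: "g \<in> borel_measurable M"
    and lim: "AE x in M. (\<lambda>k. f k x) \<longlonglongrightarrow> g x"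
    and le: "\<forall>\<^sub>F k in sequentially. Lpn M (f k) \<le> C"
  shows "Lpn M g \<le> C"
proof -
  note [measurable] = Lp_fun_measurable[OF f] g
  have "Lpn M g = (\<integral>\<^sup>+x. liminf (\<lambda>k. ennreal (norm (f k x) powr p)) \<partial>M)"
    unfolding Lpn_def
  proof (rule nn_integral_cong_AE, rule AE_mp[OF lim], intro AE_I2 impI)
    fix x assume "(\<lambda>k. f k x) \<longlonglongrightarrow> g x"
    then have "(\<lambda>k. ennreal (norm (f k x) powr p)) \<longlonglongrightarrow> ennreal (norm (g x) powr p)"
      using p_pos by (intro tendsto_ennrealI tendsto_powr' tendsto_norm tendsto_const) auto
    from lim_imp_Liminf[OF trivial_limit_sequentially this]
    show "ennreal (norm (g x) powr p) = liminf (\<lambda>k. ennreal (norm (f k x) powr p))" ..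
  qed
  also have "\<dots> \<le> liminf (\<lambda>k. Lpn M (f k))"
    unfolding Lpn_def by (rule nn_integral_liminf) measurable
  also have "\<dots> \<le> C" using le by (intro Liminf_le) (auto elim: eventually_mono)
  finally show ?thesis .
qed

lemma vcomplete_Lp: "vcomplete (Lp p M)"
  unfolding vcomplete_def
proof (intro allI impI)
  interpret cnspace "Lp p M" by (rule cnspace_Lp)
  fix x :: "nat \<Rightarrow> ('a \<Rightarrow> complex) set"
  assume x: "\<forall>n. x n \<in> carr (Lp p M)"
    and cauchy: "\<forall>\<epsilon>>0. \<exists>N. \<forall>m\<ge>N. \<forall>n\<ge>N. vnorm (Lp p M) (vdiff (Lp p M) (x m) (x n)) < \<epsilon>"
  define f where "f n = rep (x n)" for n
  have f: "f n \<in> Lp_fun p M" "x n = Lp_class p M (f n)" for n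
    using x by (simp_all add: f_def)
  have dist: "vnorm (Lp p M) (vdiff (Lp p M) (x m) (x n)) = Nm M (\<lambda>t. f m t - f n t)" for m n
    using f by (simp add: vdiff_Lp_class vnorm_Lp_class Lp_fun_diff)
  have "\<exists>N. \<forall>m\<ge>N. \<forall>n\<ge>N. Nm M (\<lambda>t. f m t - f n t) < (1/4) ^ k" for k
    using cauchy unfolding dist by simp
  then obtain N where N: "\<And>k m n. m \<ge> N k \<Longrightarrow> n \<ge> N k \<Longrightarrow> Nm M (\<lambda>t. f m t - f n t) < (1/4) ^ k"
    by metis
  \<comment> \<open>The sum makes \<open>r\<close> monotone with \<open>r k \<ge> N k\<close>; the
    summand \<open>k\<close> gives \<open>r j \<ge> j\<close>, so that \<open>r j\<close> passes any
    threshold \<open>N k\<close> as soon as \<open>j\<close> does.\<close>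
  define r where "r k = (\<Sum>i\<le>k. N i) + k" for k
  have rN: "r k \<ge> N k" "r k \<ge> k" "r (Suc k) \<ge> r k" for k
  proof -
    have "N k \<le> (\<Sum>i\<le>k. N i)" by (rule member_le_sum) auto
    then show "r k \<ge> N k" by (simp add: r_def)
  qed (simp_all add: r_def)
  have "AE t in M. convergent (\<lambda>k. f (r k) t)"
  proof (rule AE_convergent_subsequence)
    show "Nm M (\<lambda>t. f (r (Suc k)) t - f (r k) t) \<le> (1/4) ^ k" for k
      using N[of k "r (Suc k)" "r k"] rN(1)[of k] rN(3)[of k] by simp
  qed (rule f)
  then have lim: "AE t in M. (\<lambda>k. f (r k) t) \<longlonglongrightarrow> lim (\<lambda>k. f (r k) t)"
    by (simp add: convergent_LIMSEQ_iff)
  \<comment> \<open>\<open>lim\<close> is a total function: where the subsequence diverges its value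
    is arbitrary, but this happens on a null set only, and measurability holds everywhere.\<close>
  define g where "g t = lim (\<lambda>k. f (r k) t)" for t
  note [measurable] = Lp_fun_measurable[OF f(1)]
  have gm [measurable]: "g \<in> borel_measurable M" unfolding g_def[abs_def] by measurable
  \<comment> \<open>Fatou along the subsequence, with \<open>n\<close> fixed, upgrades the Cauchy
    estimate for \<open>f n\<close> to the distance from \<open>g\<close>, so the whole sequence
    converges and not just the subsequence.\<close>
  have bound: "Lpn M (\<lambda>t. f n t - g t) \<le> ennreal (((1/4) ^ k) powr p)" if "n \<ge> N k" for n k
  proof (rule Lpn_limit_le)
    show "(\<lambda>t. f n t - f (r j) t) \<in> Lp_fun p M" for j by (intro Lp_fun_diff f)
    show "AE t in M. (\<lambda>j. f n t - f (r j) t) \<longlonglongrightarrow> f n t - g t"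
      by (rule AE_mp[OF lim]) (auto intro!: tendsto_diff simp: g_def)
    show "\<forall>\<^sub>F j in sequentially. Lpn M (\<lambda>t. f n t - f (r j) t) \<le> ennreal (((1/4) ^ k) powr p)"
      unfolding eventually_sequentially
    proof (intro exI allI impI)
      fix j assume "j \<ge> N k"
      then have "r j \<ge> N k" using rN(2)[of j] by linarith
      then show "Lpn M (\<lambda>t. f n t - f (r j) t) \<le> ennreal (((1/4) ^ k) powr p)"
        using N[OF that, of "r j"] by (intro Lpn_le Lp_fun_diff f) simp
    qed
  qed measurable
  have "(\<lambda>t. f (N 0) t - g t) \<in> Lp_fun p M"
    using bound[of 0 "N 0"] by (intro Lp_funI[where c = 1]) auto
  \<comment> \<open>\<open>g\<close> is \<open>f (N 0)\<close> minus the difference just seen to lie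
    in \<open>L^p\<close>.\<close>
  then have gL: "g \<in> Lp_fun p M"
    using Lp_fun_diff[OF f(1)[of "N 0"], of "\<lambda>t. f (N 0) t - g t"] by simp
  have "vlim (Lp p M) x (Lp_class p M g) sequentially"
  proof (rule vlimI)
    fix \<epsilon> :: real assume "\<epsilon> > 0"
    then obtain k where k: "(1/4) ^ k < \<epsilon>" using real_arch_pow_inv[of \<epsilon> "1/4"] by auto
    have "vnorm (Lp p M) (vdiff (Lp p M) (x n) (Lp_class p M g)) \<le> (1/4) ^ k" if "n \<ge> N k" for n
      using Nm_leI[OF _ bound[OF that]] f gL
      by (simp add: f(2) vdiff_Lp_class vnorm_Lp_class Lp_fun_diff)
    then show "\<forall>\<^sub>F n in sequentially. vnorm (Lp p M) (vdiff (Lp p M) (x n) (Lp_class p M g)) < \<epsilon>"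
      using k unfolding eventually_sequentially by (blast intro: le_less_trans)
  qed (use x gL in auto)
  then show "\<exists>l\<in>carr (Lp p M). vlim (Lp p M) x l sequentially" using gL by auto
qed

section \<open>Operators induced by maps on functions\<close>

definition Lp_lift :: "'a measure \<Rightarrow> 'b measure \<Rightarrow>
    (('a \<Rightarrow> complex) \<Rightarrow> 'b \<Rightarrow> complex) \<Rightarrow> ('a, 'b) Lp_op" where
  "Lp_lift M N \<Phi> = (\<lambda>u\<in>carr (Lp p M). Lp_class p N (\<Phi> (rep u)))"

text \<open>Linearity is asked for almost everywhere only, which admits maps given by a series that
  converges off a null set depending on the argument. The norm estimate is put in terms of
  \<open>Lpn\<close> so that it can be proved by integrating a pointwise one.\<close>

definition Lp_liftable :: "'a measure \<Rightarrow> 'b measure \<Rightarrow>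
    (('a \<Rightarrow> complex) \<Rightarrow> 'b \<Rightarrow> complex) \<Rightarrow> real \<Rightarrow> bool" where
  "Lp_liftable M N \<Phi> C \<longleftrightarrow> 0 \<le> C \<and>
     (\<forall>f\<in>Lp_fun p M. \<Phi> f \<in> borel_measurable N \<and> Lpn N (\<Phi> f) \<le> ennreal (C powr p) * Lpn M f) \<and>
     (\<forall>f\<in>Lp_fun p M. \<forall>g\<in>Lp_fun p M. (AE x in M. f x = g x) \<longrightarrow> (AE y in N. \<Phi> f y = \<Phi> g y)) \<and>
     (\<forall>f\<in>Lp_fun p M. \<forall>g\<in>Lp_fun p M. AE y in N. \<Phi> (\<lambda>x. f x + g x) y = \<Phi> f y + \<Phi> g y) \<and>
     (\<forall>c. \<forall>f\<in>Lp_fun p M. AE y in N. \<Phi> (\<lambda>x. c * f x) y = c * \<Phi> f y)"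

lemma Lp_liftable_bound:
  assumes "Lp_liftable M N \<Phi> C" and f: "f \<in> Lp_fun p M"
  shows "\<Phi> f \<in> Lp_fun p N" "Nm N (\<Phi> f) \<le> C * Nm M f"
proof -
  have C: "0 \<le> C" and m: "\<Phi> f \<in> borel_measurable N"
    and le: "Lpn N (\<Phi> f) \<le> ennreal (C powr p) * Lpn M f"
    using assms by (auto simp: Lp_liftable_def)
  have le': "Lpn N (\<Phi> f) \<le> ennreal ((C * Nm M f) powr p)"
    using le C by (simp add: Lpn_eq_Nm[OF f] powr_mult ennreal_mult')
  then show "\<Phi> f \<in> Lp_fun p N" by (rule Lp_funI[OF m])
  show "Nm N (\<Phi> f) \<le> C * Nm M f"
    by (rule Nm_leI[OF m le']) (simp add: C Nm_nonneg)
qed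

lemma Lp_lift:
  assumes \<Phi>: "Lp_liftable M N \<Phi> C"
  shows Lp_lift_class: "f \<in> Lp_fun p M \<Longrightarrow> Lp_lift M N \<Phi> (Lp_class p M f) = Lp_class p N (\<Phi> f)"
    and Lp_lift_Lop: "Lp_lift M N \<Phi> \<in> carr (Lop (Lp p M) (Lp p N))"
    and Lp_lift_norm: "vnorm (Lop (Lp p M) (Lp p N)) (Lp_lift M N \<Phi>) \<le> C"
proof -
  interpret cnspace_pair "Lp p M" "Lp p N" by (intro cnspace_pair.intro cnspace_Lp)
  define T where "T = Lp_lift M N \<Phi>"
  note mem = Lp_liftable_bound(1)[OF \<Phi>] and bound = Lp_liftable_bound(2)[OF \<Phi>]
  have C: "0 \<le> C"
    and cong: "\<And>f g. f \<in> Lp_fun p M \<Longrightarrow> g \<in> Lp_fun p M \<Longrightarrow> AE x in M. f x = g x \<Longrightarrow>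
      AE y in N. \<Phi> f y = \<Phi> g y"
    and add: "\<And>f g. f \<in> Lp_fun p M \<Longrightarrow> g \<in> Lp_fun p M \<Longrightarrow>
      AE y in N. \<Phi> (\<lambda>x. f x + g x) y = \<Phi> f y + \<Phi> g y"
    and scale: "\<And>f c. f \<in> Lp_fun p M \<Longrightarrow> AE y in N. \<Phi> (\<lambda>x. c * f x) y = c * \<Phi> f y"
    using \<Phi> by (auto simp: Lp_liftable_def)
  have T: "T (Lp_class p M f) = Lp_class p N (\<Phi> f)" if "f \<in> Lp_fun p M" for f
    using that rep_Lp_class[OF that] by (simp add: T_def Lp_lift_def Lp_class_eq_iff mem cong)
  then show "f \<in> Lp_fun p M \<Longrightarrow> Lp_lift M N \<Phi> (Lp_class p M f) = Lp_class p N (\<Phi> f)" for f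
    by (simp add: T_def)
  have b: "vnorm (Lp p N) (T u) \<le> C * vnorm (Lp p M) u" if "u \<in> carr (Lp p M)" for u
    using that by (auto simp: carr_Lp T vnorm_Lp_class mem bound)
  have TL: "T \<in> carr (Lop (Lp p M) (Lp p N))"
  proof (rule Lop_memI[OF _ _ _ _ b])
    show "T \<in> extensional (carr (Lp p M))" by (simp add: T_def Lp_lift_def)
    show "T u \<in> carr (Lp p N)" if "u \<in> carr (Lp p M)" for u
      using that by (auto simp: carr_Lp T mem)
    show "T (vadd (Lp p M) u v) = vadd (Lp p N) (T u) (T v)"
      if uv: "u \<in> carr (Lp p M)" "v \<in> carr (Lp p M)" for u v
    proof -
      obtain f g where fg: "f \<in> Lp_fun p M" "g \<in> Lp_fun p M"
          and "u = Lp_class p M f" "v = Lp_class p M g"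
        using uv by (auto simp: carr_Lp)
      then show ?thesis
        using add[OF fg] by (simp add: T vadd_Lp_class mem Lp_fun_add Lp_class_eq_iff)
    qed
    show "T (vscale (Lp p M) c u) = vscale (Lp p N) c (T u)" if u: "u \<in> carr (Lp p M)" for u c
    proof -
      obtain f where f: "f \<in> Lp_fun p M" and "u = Lp_class p M f"
        using u by (auto simp: carr_Lp)
      then show ?thesis
        using scale[OF f] by (simp add: T vscale_Lp_class mem Lp_fun_cmult Lp_class_eq_iff)
    qed
  qed
  then show "Lp_lift M N \<Phi> \<in> carr (Lop (Lp p M) (Lp p N))" by (simp add: T_def)
  show "vnorm (Lop (Lp p M) (Lp p N)) (Lp_lift M N \<Phi>) \<le> C"
    using opnorm_le[OF C b] by (simp add: T_def)
qed

end

section \<open>Products with counting measure, and compact operators\<close>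

text \<open>Every function on a counting space is measurable, so the iterated integral that defines
  the product measure is countably additive by exchanging sum and integral, for any measure
  \<open>N\<close>.\<close>

lemma emeasure_count_space_pair:
  assumes "X \<in> sets (count_space I \<Otimes>\<^sub>M N)"
  shows "emeasure (count_space I \<Otimes>\<^sub>M N) X = (\<integral>\<^sup>+i. emeasure N (Pair i -` X) \<partial>count_space I)"
    (is "_ = ?\<mu> X")
proof -
  let ?\<nu> = "\<lambda>X. \<integral>\<^sup>+i. \<integral>\<^sup>+t. indicator X (i, t) \<partial>N \<partial>count_space I"
  have eq: "?\<nu> A = ?\<mu> A" if "A \<in> sets (count_space I \<Otimes>\<^sub>M N)" for A
  proof (rule nn_integral_cong)
    fix i
    have "(\<lambda>t. indicator A (i, t)) = (indicator (Pair i -` A) :: _ \<Rightarrow> ennreal)"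
      by (auto simp: indicator_def)
    then show "(\<integral>\<^sup>+t. indicator A (i, t) \<partial>N) = emeasure N (Pair i -` A)"
      using that by (simp add: sets_Pair1)
  qed
  have "emeasure (count_space I \<Otimes>\<^sub>M N) X = ?\<nu> X"
  proof (rule emeasure_measure_of[OF pair_measure_def _ _ _ assms])
    show "positive (sets (count_space I \<Otimes>\<^sub>M N)) ?\<nu>"
      by (auto simp: positive_def)
    show "countably_additive (sets (count_space I \<Otimes>\<^sub>M N)) ?\<nu>"
    proof (rule countably_additiveI)
      fix A :: "nat \<Rightarrow> ('a \<times> 'b) set"
      assume A: "range A \<subseteq> sets (count_space I \<Otimes>\<^sub>M N)" "disjoint_family A"
        and U: "(\<Union>i. A i) \<in> sets (count_space I \<Otimes>\<^sub>M N)"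
      have mem: "A n \<in> sets (count_space I \<Otimes>\<^sub>M N)" for n using A by auto
      have "disjoint_family (\<lambda>n. Pair i -` A n)" for i
        by (intro disjoint_family_on_bisimulation[OF A(2)]) auto
      moreover have "range (\<lambda>n. Pair i -` A n) \<subseteq> sets N" for i
        using A by (auto simp: sets_Pair1)
      ultimately show "(\<Sum>n. ?\<nu> (A n)) = ?\<nu> (\<Union>n. A n)"
        unfolding eq[OF mem] eq[OF U]
        by (simp add: nn_integral_suminf[symmetric] vimage_UN suminf_emeasure)
    qed
    show "{a \<times> b |a b. a \<in> sets (count_space I) \<and> b \<in> sets N} \<subseteq> Pow (space (count_space I) \<times> space N)"
      by (rule pair_measure_closed)
  qed
  then show ?thesis using eq[OF assms] by simp
qed

text \<open>Tonelli's theorem by induction on measurable functions: indicators are the preceding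
  lemma, and the outer integral raises no question of measurability.\<close>

lemma nn_integral_count_space_pair:
  assumes "g \<in> borel_measurable (count_space I \<Otimes>\<^sub>M N)"
  shows "integral\<^sup>N (count_space I \<Otimes>\<^sub>M N) g = (\<integral>\<^sup>+i. \<integral>\<^sup>+t. g (i, t) \<partial>N \<partial>count_space I)"
  using assms
proof induct
  case (cong u v)
  then have "(\<integral>\<^sup>+i. \<integral>\<^sup>+t. u (i, t) \<partial>N \<partial>count_space I) = (\<integral>\<^sup>+i. \<integral>\<^sup>+t. v (i, t) \<partial>N \<partial>count_space I)"
    by (intro nn_integral_cong) (auto simp: space_pair_measure)
  with cong show ?case by (simp cong: nn_integral_cong)
next
  case (set A)
  have "(\<lambda>t. indicator A (i, t)) = (indicator (Pair i -` A) :: _ \<Rightarrow> ennreal)" for i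
    by (auto simp: indicator_def)
  then show ?case using set by (simp add: emeasure_count_space_pair sets_Pair1)
next
  case (mult u c)
  then show ?case by (simp add: nn_integral_cmult measurable_compose_Pair1 cong: nn_integral_cong)
next
  case (add u v)
  then show ?case by (simp add: nn_integral_add measurable_compose_Pair1 cong: nn_integral_cong)
next
  case (seq U)
  have "(\<integral>\<^sup>+i. \<integral>\<^sup>+t. (SUP n. U n) (i, t) \<partial>N \<partial>count_space I)
      = (\<integral>\<^sup>+i. (SUP n. \<integral>\<^sup>+t. U n (i, t) \<partial>N) \<partial>count_space I)"
    using seq by (intro nn_integral_cong)
      (simp add: image_comp nn_integral_monotone_convergence_SUP measurable_compose_Pair1 incseq_def le_fun_def)
  also have "\<dots> = (SUP n. \<integral>\<^sup>+i. \<integral>\<^sup>+t. U n (i, t) \<partial>N \<partial>count_space I)"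
    using seq by (intro nn_integral_monotone_convergence_SUP)
      (auto simp: incseq_def le_fun_def intro!: nn_integral_mono)
  also have "\<dots> = (SUP n. integral\<^sup>N (count_space I \<Otimes>\<^sub>M N) (U n))"
    using seq by simp
  also have "\<dots> = integral\<^sup>N (count_space I \<Otimes>\<^sub>M N) (SUP n. U n)"
  proof -
    have "(SUP n. U n) = (\<lambda>x. SUP n. U n x)" by (auto simp: fun_eq_iff image_comp)
    then show ?thesis using seq by (simp add: nn_integral_monotone_convergence_SUP)
  qed
  finally show ?case ..
qed

text \<open>A sum of slice measures vanishes only if every term does. Conversely, null sets in the
  slices assemble to a measurable null set of the product, which is where countability of
  \<open>I\<close> enters.\<close>

lemma AE_count_space_pair:
  assumes "countable I"
  shows "(AE x in count_space I \<Otimes>\<^sub>M N. P x) \<longleftrightarrow> (\<forall>i\<in>I. AE t in N. P (i, t))"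
proof
  assume "AE x in count_space I \<Otimes>\<^sub>M N. P x"
  then obtain Z where Z: "{x \<in> space (count_space I \<Otimes>\<^sub>M N). \<not> P x} \<subseteq> Z"
      "emeasure (count_space I \<Otimes>\<^sub>M N) Z = 0" "Z \<in> sets (count_space I \<Otimes>\<^sub>M N)"
    by (rule AE_E)
  have "(\<integral>\<^sup>+i. emeasure N (Pair i -` Z) \<partial>count_space I) = 0"
    using Z by (simp add: emeasure_count_space_pair)
  then have null: "\<And>i. i \<in> I \<Longrightarrow> emeasure N (Pair i -` Z) = 0"
    by (simp add: nn_integral_0_iff_AE AE_count_space)
  show "\<forall>i\<in>I. AE t in N. P (i, t)"
  proof
    fix i assume i: "i \<in> I"
    show "AE t in N. P (i, t)"
    proof (rule AE_I)
      show "{t \<in> space N. \<not> P (i, t)} \<subseteq> Pair i -` Z"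
        using Z(1) i by (auto simp: space_pair_measure)
    qed (use null[OF i] Z(3) in \<open>auto intro: sets_Pair1\<close>)
  qed
next
  assume ae: "\<forall>i\<in>I. AE t in N. P (i, t)"
  have "\<forall>i\<in>I. \<exists>Z. {t \<in> space N. \<not> P (i, t)} \<subseteq> Z \<and> emeasure N Z = 0 \<and> Z \<in> sets N"
  proof
    fix i assume "i \<in> I"
    with ae have "AE t in N. P (i, t)" by blast
    then obtain Z where "{t \<in> space N. \<not> P (i, t)} \<subseteq> Z" "emeasure N Z = 0" "Z \<in> sets N"
      by (rule AE_E)
    then show "\<exists>Z. {t \<in> space N. \<not> P (i, t)} \<subseteq> Z \<and> emeasure N Z = 0 \<and> Z \<in> sets N" by blast
  qed
  then obtain Z where Z: "\<And>i. i \<in> I \<Longrightarrow> {t \<in> space N. \<not> P (i, t)} \<subseteq> Z i"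
      "\<And>i. i \<in> I \<Longrightarrow> emeasure N (Z i) = 0" "\<And>i. i \<in> I \<Longrightarrow> Z i \<in> sets N"
    by metis
  let ?Z = "\<Union>i\<in>I. {i} \<times> Z i"
  show "AE x in count_space I \<Otimes>\<^sub>M N. P x"
  proof (rule AE_I)
    show "{x \<in> space (count_space I \<Otimes>\<^sub>M N). \<not> P x} \<subseteq> ?Z"
      using Z(1) by (auto simp: space_pair_measure)
    show m: "?Z \<in> sets (count_space I \<Otimes>\<^sub>M N)"
      using Z(3) by (intro sets.countable_UN'[OF assms]) auto
    have "Pair i -` ?Z = Z i" if "i \<in> I" for i using that by auto
    then show "emeasure (count_space I \<Otimes>\<^sub>M N) ?Z = 0"
      unfolding emeasure_count_space_pair[OF m]
      by (subst nn_integral_0_iff_AE) (auto simp: AE_count_space Z(2))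
  qed
qed

lemma space_counting [simp]: "space counting = {1..}"
  by (simp add: counting_def)

lemma measurable_counting [simp]: "f \<in> borel_measurable counting"
  by (simp add: counting_def)

lemma AE_counting: "(AE i in counting. P i) \<longleftrightarrow> (\<forall>i\<ge>1. P i)"
  unfolding counting_def AE_count_space by auto

text \<open>Coordinates start at 1, while series run from 0: here and below coordinate
  \<open>Suc j\<close> belongs to the term with index \<open>j\<close>.\<close>

lemma nn_integral_counting: "integral\<^sup>N counting g = (\<Sum>j. g (Suc j))"
proof -
  have b: "bij_betw Suc UNIV {1..}"
    by (rule bij_betwI[of _ _ _ "\<lambda>n. n - 1"]) auto
  show ?thesis
    unfolding counting_def nn_integral_bij_count_space[OF b, symmetric] nn_integral_count_space_nat ..
qed

lemma cnspace_complex_vlim: "vlim complex_space x l G \<longleftrightarrow> (x \<longlongrightarrow> l) G"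
  by (simp add: vlim_def vdiff_def complex_space_def tendsto_norm_zero_iff LIM_zero_iff)

lemma complex_space_simps [simp]:
  "carr complex_space = UNIV" "vadd complex_space = (+)" "vzero complex_space = 0"
  "vscale complex_space = (*)" "vnorm complex_space = norm"
  by (simp_all add: complex_space_def)

section \<open>Compact operators on a normed space\<close>

context cnspace
begin

text \<open>The image of the unit ball under \<open>T\<close> is totally bounded, so a finite
  \<open>\<epsilon>/4\<close>-net \<open>K\<close> decides: the \<open>P i\<close> converge
  uniformly on \<open>K\<close>, and contractivity spreads this to the whole image.\<close>

lemma vlim_compose_compact:
  assumes T: "T \<in> compact_operators E"
    and P: "\<And>i. P i \<in> carr (Lop E E)" "\<And>i. vnorm (Lop E E) (P i) \<le> 1"
    and lim: "\<And>u. u \<in> carr E \<Longrightarrow> vlim E (\<lambda>i. P i u) u G"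
  shows "vlim (Lop E E) (\<lambda>i. compose (carr E) (P i) T) T G"
proof -
  interpret EE: cnspace_triple E E E ..
  interpret L: cnspace "Lop E E" by (rule EE.EF.cnspace_Lop)
  let ?U = "{u \<in> carr E. vnorm E u \<le> 1}"
  have TL: "T \<in> carr (Lop E E)" and comp: "compactin (norm_topology E) (norm_topology E closure_of (T ` ?U))"
    using T by (auto simp: compact_operators_def)
  interpret M: Metric_space "carr E" "vdist E" by (rule metric)
  have TU: "T ` ?U \<subseteq> norm_topology E closure_of (T ` ?U)"
    by (rule closure_of_subset) (use TL in auto)
  have tb: "M.mtotally_bounded (norm_topology E closure_of (T ` ?U))"
    using comp unfolding norm_topology_def by (rule M.compactin_imp_mtotally_bounded)
  show ?thesis
  proof (rule L.vlimI)
    fix \<epsilon> :: real assume \<epsilon>: "\<epsilon> > 0"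
    then have e4: "\<epsilon> / 4 > 0" by simp
    obtain K where K: "finite K" "K \<subseteq> norm_topology E closure_of (T ` ?U)"
        "norm_topology E closure_of (T ` ?U) \<subseteq> (\<Union>x\<in>K. M.mball x (\<epsilon>/4))"
      using tb e4 unfolding M.mtotally_bounded_def by meson
    have KE: "K \<subseteq> carr E" using K(2) closure_of_subset_topspace[of "norm_topology E"] by auto
    have "\<forall>\<^sub>F i in G. \<forall>w\<in>K. vnorm E (vdiff E (P i w) w) < \<epsilon> / 4"
      using K(1) KE vlimD[OF lim e4] by (simp add: eventually_ball_finite_distrib subset_iff)
    then show "\<forall>\<^sub>F i in G. vnorm (Lop E E) (vdiff (Lop E E) (compose (carr E) (P i) T) T) < \<epsilon>"
    proof (rule eventually_mono)
      fix i assume i: "\<forall>w\<in>K. vnorm E (vdiff E (P i w) w) < \<epsilon> / 4"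
      \<comment> \<open>One quarter each for \<open>P i (T u)\<close> against \<open>P i w\<close>,
        \<open>P i w\<close> against \<open>w\<close>, and \<open>w\<close> against
        \<open>T u\<close>; the fourth quarter keeps the inequality strict after taking the
        supremum.\<close>
      have "vnorm (Lop E E) (vdiff (Lop E E) (compose (carr E) (P i) T) T) \<le> 3 * (\<epsilon> / 4)"
        unfolding Lop_simps(5)
      proof (rule cSUP_least)
        show "?U \<noteq> {}" using zero_closed norm_zero by force
        fix u assume u: "u \<in> ?U"
        then have uE: "u \<in> carr E" by simp
        have Tu: "T u \<in> carr E" using u TL by auto
        obtain w where w: "w \<in> K" "T u \<in> M.mball w (\<epsilon>/4)"
          using u TU K(3) by blast
        have wE: "w \<in> carr E" using w KE by auto
        have d: "vnorm E (vdiff E w (T u)) < \<epsilon> / 4"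
          using w(2) wE Tu by (simp add: vdist_def)
        have Pc: "P i (T u) \<in> carr E" "P i w \<in> carr E" using P Tu wE by auto
        have "vnorm E (vdiff E (P i (T u)) (P i w)) \<le> 1 * vnorm E (vdiff E (T u) w)"
          using EE.EF.norm_le_opnorm'[OF P(1) _ P(2), of "vdiff E (T u) w" i] P Tu wE
          by (simp add: EE.EF.Lop_diff)
        then have "vnorm E (vdiff E (P i (T u)) (T u)) \<le> 3 * (\<epsilon> / 4)"
          using norm_diff_triangle[OF Pc(1) Pc(2) Tu] norm_diff_triangle[OF Pc(2) wE Tu]
            i[rule_format, OF w(1)] d norm_diff_commute[OF Tu wE] by linarith
        then show "vnorm E (vdiff (Lop E E) (compose (carr E) (P i) T) T u) \<le> 3 * (\<epsilon> / 4)"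
          using uE by (simp add: EE.EF.Lop_diff_apply compose_eq)
      qed
      then show "vnorm (Lop E E) (vdiff (Lop E E) (compose (carr E) (P i) T) T) < \<epsilon>"
        using \<epsilon> by linarith
    qed
  qed (use TL P in auto)
qed

lemma continuous_map_scale:
  assumes z: "z \<in> carr E"
  shows "continuous_map euclidean (norm_topology E) (\<lambda>c. vscale E c z)"
proof -
  interpret M: Metric_space "carr E" "vdist E" by (rule metric)
  have "continuous_map (Met_TC.mtopology) M.mtopology (\<lambda>c. vscale E c z)"
    unfolding Metric_space.metric_continuous_map[OF Met_TC.Metric_space_axioms M.Metric_space_axioms]
  proof (intro conjI ballI allI impI)
    fix a :: complex and \<epsilon> :: real assume \<epsilon>: "0 < \<epsilon>"
    have n: "0 \<le> vnorm E z" using z by simp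
    show "\<exists>\<delta>>0. \<forall>x. x \<in> UNIV \<and> dist a x < \<delta> \<longrightarrow> vdist E (vscale E a z) (vscale E x z) < \<epsilon>"
    proof (intro exI conjI allI impI)
      show "\<epsilon> / (vnorm E z + 1) > 0" using n \<epsilon> by simp
      fix x assume "x \<in> UNIV \<and> dist a x < \<epsilon> / (vnorm E z + 1)"
      then have "dist a x * (vnorm E z + 1) < \<epsilon>" using n by (simp add: field_simps)
      moreover have "vdist E (vscale E a z) (vscale E x z) = dist a x * vnorm E z"
        using z scale_add_left[OF z, of a "- x"]
        by (simp add: vdist_def vdiff_def dist_norm flip: norm_scale)
      ultimately show "vdist E (vscale E a z) (vscale E x z) < \<epsilon>"
        using mult_left_mono[of "vnorm E z" "vnorm E z + 1" "dist a x"] by simp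
    qed
  qed (use z in auto)
  then show ?thesis by (simp add: norm_topology_def)
qed

text \<open>The image of the unit ball lies on a compact disc in the line through \<open>z\<close>,
  with radius the norm of \<open>\<phi>\<close>.\<close>

lemma rank_one_compact:
  assumes \<phi>: "\<phi> \<in> carr (Lop E complex_space)" and z: "z \<in> carr E"
  shows "(\<lambda>u\<in>carr E. vscale E (\<phi> u) z) \<in> compact_operators E"
proof -
  interpret C: cnspace complex_space by (rule cnspace_complex)
  interpret EC: cnspace_pair E complex_space ..
  interpret EE: cnspace_pair E E ..
  interpret M: Metric_space "carr E" "vdist E" by (rule metric)
  let ?T = "\<lambda>u\<in>carr E. vscale E (\<phi> u) z"
  let ?c = "vnorm (Lop E complex_space) \<phi>"
  have T: "?T \<in> carr (Lop E E)"
  proof (rule EE.Lop_memI[of _ "?c * vnorm E z"])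
    fix u assume u: "u \<in> carr E"
    show "vnorm E (?T u) \<le> ?c * vnorm E z * vnorm E u"
      using mult_right_mono[OF EC.norm_le_opnorm[OF \<phi> u], of "vnorm E z"] u z
      by (simp add: norm_scale algebra_simps)
  qed (use \<phi> z in \<open>auto simp: EC.Lop_add EC.Lop_scale scale_add_left\<close>)
  let ?K = "(\<lambda>c. vscale E c z) ` cball 0 ?c"
  have K: "compactin (norm_topology E) ?K"
    by (rule image_compactin[OF _ continuous_map_scale[OF z]]) simp
  have sub: "?T ` {u \<in> carr E. vnorm E u \<le> 1} \<subseteq> ?K"
  proof (clarsimp, rule imageI)
    fix u assume u: "u \<in> carr E" "vnorm E u \<le> 1"
    have "norm (\<phi> u) \<le> ?c * vnorm E u" using EC.norm_le_opnorm[OF \<phi> u(1)] by simp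
    also have "\<dots> \<le> ?c * 1" using u EC.opnorm_nonneg[OF \<phi>] by (intro mult_left_mono) auto
    finally show "\<phi> u \<in> cball 0 ?c" by simp
  qed
  \<comment> \<open>Compactness is required of the closure of the image; it stays inside
    \<open>?K\<close> because compact sets are closed in a metric space.\<close>
  have "closedin (norm_topology E) ?K"
    using K M.Hausdorff_space_mtopology unfolding norm_topology_def
    by (intro compactin_imp_closedin)
  then have "norm_topology E closure_of (?T ` {u \<in> carr E. vnorm E u \<le> 1}) \<subseteq> ?K"
    by (intro closure_of_minimal sub)
  then have "compactin (norm_topology E) (norm_topology E closure_of (?T ` {u \<in> carr E. vnorm E u \<le> 1}))"
    by (rule closed_compactin[OF K _ closedin_closure_of])
  then show ?thesis using T by (simp add: compact_operators_def)
qed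

end

context Lp_exponent
begin

text \<open>Dominated convergence. It serves twice: for tails of sequences in
  \<open>proj_strong\<close> and for tails of slices in \<open>closed_span_tens\<close>.\<close>

lemma Nm_truncate_tendsto:
  assumes f: "f \<in> Lp_fun p M" and A: "\<And>n. A n \<in> sets M"
    and ev: "\<And>x. x \<in> space M \<Longrightarrow> \<forall>\<^sub>F n in sequentially. x \<notin> A n"
  shows "(\<lambda>n. Nm M (\<lambda>x. if x \<in> A n then f x else 0)) \<longlonglongrightarrow> 0"
proof -
  note [measurable] = Lp_fun_measurable[OF f] A
  have "(\<lambda>n. LINT x|M. norm (if x \<in> A n then f x else 0) powr p) \<longlonglongrightarrow> (LINT x|M. (0::real))"
  proof (rule integral_dominated_convergence[where w = "\<lambda>x. norm (f x) powr p"])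
    show "AE x in M. (\<lambda>n. norm (if x \<in> A n then f x else 0) powr p) \<longlonglongrightarrow> 0"
    proof (rule AE_I2)
      fix x assume "x \<in> space M"
      then have "\<forall>\<^sub>F n in sequentially. norm (if x \<in> A n then f x else 0) powr p = 0"
        using p_pos by (intro eventually_mono[OF ev]) auto
      then show "(\<lambda>n. norm (if x \<in> A n then f x else 0) powr p) \<longlonglongrightarrow> 0"
        by (rule tendsto_eventually)
    qed
  qed (auto intro: Lp_fun_integrable[OF f])
  then have "(\<lambda>n. (LINT x|M. norm (if x \<in> A n then f x else 0) powr p) powr (1/p)) \<longlonglongrightarrow> 0 powr (1/p)"
    using p_pos by (intro tendsto_powr' tendsto_const) (auto intro: always_eventually integral_nonneg_AE)
  then show ?thesis by (simp add: Nm_def)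
qed

section \<open>Coordinates in \<open>l^p\<close>\<close>

abbreviation "ell \<equiv> ellp p"
abbreviation "ell_ops \<equiv> carr (Lop ell ell)"
abbreviation "ell_dual \<equiv> carr (Lop ell complex_space)"

text \<open>Counting measure has no nonempty null sets, so on indices from 1 the arbitrary choice in
  \<open>rep\<close> is harmless and \<open>rep u j\<close> is the coordinate.\<close>

lemma rep_Lp_class_counting [simp]:
  "f \<in> Lp_fun p counting \<Longrightarrow> 1 \<le> j \<Longrightarrow> rep (Lp_class p counting f) j = f j"
  using rep_Lp_class(2)[of f counting] by (simp add: AE_counting)

lemma ellp_eqI:
  assumes "u \<in> carr ell" "v \<in> carr ell" "\<And>j. 1 \<le> j \<Longrightarrow> rep u j = rep v j"
  shows "u = v"
proof -
  have "Lp_class p counting (rep u) = Lp_class p counting (rep v)"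
    using assms by (subst Lp_class_eq_iff) (auto simp: AE_counting)
  then show ?thesis using assms by simp
qed

lemma ellp_add: "u \<in> carr ell \<Longrightarrow> v \<in> carr ell \<Longrightarrow> 1 \<le> j \<Longrightarrow>
    rep (vadd ell u v) j = rep u j + rep v j"
  by (simp add: vadd_Lp Lp_fun_add)

lemma ellp_scale: "u \<in> carr ell \<Longrightarrow> 1 \<le> j \<Longrightarrow> rep (vscale ell c u) j = c * rep u j"
  by (simp add: vscale_Lp Lp_fun_cmult)

lemma ellp_zero: "1 \<le> j \<Longrightarrow> rep (vzero ell) j = 0"
  by (simp add: vzero_Lp Lp_fun_zero)

lemma Lpn_finite_support:
  assumes "finite F" "F \<subseteq> {1..}" "\<And>j. 1 \<le> j \<Longrightarrow> j \<notin> F \<Longrightarrow> f j = 0"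
  shows "Lpn counting f = ennreal (\<Sum>j\<in>F. norm (f j) powr p)"
proof -
  have "Lpn counting f = (\<Sum>j\<in>F. ennreal (norm (f j) powr p))"
    unfolding Lpn_def counting_def using assms p_pos
    by (intro nn_integral_count_space') auto
  then show ?thesis by (simp add: sum_ennreal)
qed

lemma ellp_sum_le:
  assumes u: "u \<in> carr ell" and F: "finite F" "F \<subseteq> {1..}"
  shows "(\<Sum>j\<in>F. norm (rep u j) powr p) \<le> vnorm ell u powr p"
proof -
  let ?f = "\<lambda>j. if j \<in> F then rep u j else 0"
  have "ennreal (\<Sum>j\<in>F. norm (rep u j) powr p) = Lpn counting ?f"
    using F by (subst Lpn_finite_support[of F]) auto
  also have "\<dots> \<le> Lpn counting (rep u)"
    unfolding Lpn_def using p_pos by (intro nn_integral_mono) auto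
  also have "\<dots> = ennreal (vnorm ell u powr p)"
    using u by (simp add: Lpn_eq_Nm vnorm_Lp)
  finally show ?thesis by simp
qed

lemma ellp_coord_le:
  assumes u: "u \<in> carr ell" and j: "1 \<le> j"
  shows "norm (rep u j) \<le> vnorm ell u"
proof -
  interpret cnspace ell by (rule cnspace_Lp)
  have "norm (rep u j) powr p \<le> vnorm ell u powr p"
    using ellp_sum_le[OF u, of "{j}"] j by simp
  then have "(norm (rep u j) powr p) powr (1/p) \<le> (vnorm ell u powr p) powr (1/p)"
    using p_pos by (rule_tac powr_mono2) auto
  then show ?thesis using p_pos u by (simp add: powr_powr)
qed

definition unit_vec :: "nat \<Rightarrow> (nat \<Rightarrow> complex) set" where
  "unit_vec j = Lp_class p counting (\<lambda>i. if i = j then 1 else 0)"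

lemma unit_vec_fun: "(\<lambda>i. if i = j then 1 else 0) \<in> Lp_fun p counting"
  \<comment> \<open>The intersection admits \<open>j = 0\<close>, a point outside the space, for
    which the class is zero.\<close>
  using Lpn_finite_support[of "{j} \<inter> {1..}" "\<lambda>i. if i = j then 1 else 0"]
  by (intro Lp_funI) auto

end

section \<open>The sequence space \<open>\<ell>\<^sup>p\<close> and its dual\<close>

context Lp_exponent
begin

sublocale ell: cnspace ell by (rule cnspace_Lp)
sublocale C: cnspace complex_space by (rule cnspace_complex)
sublocale ellC: cnspace_pair ell complex_space ..
sublocale ellell: cnspace_pair ell ell ..
sublocale ellellC: cnspace_triple ell ell complex_space ..
sublocale ell3: cnspace_triple ell ell ell ..

lemma unit_vec_closed [simp]: "unit_vec j \<in> carr ell"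
  using unit_vec_fun by (simp add: unit_vec_def)

lemma rep_unit_vec [simp]: "1 \<le> i \<Longrightarrow> rep (unit_vec j) i = (if i = j then 1 else 0)"
  by (simp add: unit_vec_def unit_vec_fun)

lemma norm_unit_vec: "1 \<le> j \<Longrightarrow> vnorm ell (unit_vec j) \<le> 1"
  unfolding unit_vec_def vnorm_Lp_class[OF unit_vec_fun]
  by (rule Nm_leI, simp, subst Lpn_finite_support[of "{j}"]) auto

definition coord :: "nat \<Rightarrow> (nat \<Rightarrow> complex) set \<Rightarrow> complex" where
  "coord i = (\<lambda>u\<in>carr ell. rep u i)"

lemma coord_Lop: "1 \<le> i \<Longrightarrow> coord i \<in> ell_dual"
  by (rule ellC.Lop_memI[of _ 1]) (auto simp: coord_def ellp_add ellp_scale ellp_coord_le)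

definition proj :: "nat \<Rightarrow> (nat \<Rightarrow> complex) set \<Rightarrow> (nat \<Rightarrow> complex) set" where
  "proj n = Lp_lift counting counting (\<lambda>f i. if i \<le> n then f i else 0)"

lemma proj_liftable: "Lp_liftable counting counting (\<lambda>f i. if i \<le> n then f i else 0) 1"
  unfolding Lp_liftable_def AE_counting
  by (auto simp: Lpn_def intro!: nn_integral_mono)

lemma proj_Lop [simp]: "proj n \<in> ell_ops"
  unfolding proj_def by (rule Lp_lift_Lop[OF proj_liftable])

lemma norm_proj: "vnorm (Lop ell ell) (proj n) \<le> 1"
  unfolding proj_def by (rule Lp_lift_norm[OF proj_liftable])

lemma rep_proj [simp]:
  assumes "u \<in> carr ell" "1 \<le> i"
  shows "rep (proj n u) i = (if i \<le> n then rep u i else 0)"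
proof -
  have "proj n u = Lp_class p counting (\<lambda>i. if i \<le> n then rep u i else 0)"
    using Lp_lift_class[OF proj_liftable, of "rep u"] assms by (simp add: proj_def)
  then show ?thesis
    using Lp_liftable_bound(1)[OF proj_liftable, of "rep u"] assms by simp
qed

lemma proj_0: "u \<in> carr ell \<Longrightarrow> proj 0 u = vzero ell"
  by (rule ellp_eqI) (auto simp: ellp_zero)

lemma proj_Suc: "u \<in> carr ell \<Longrightarrow>
    proj (Suc n) u = vadd ell (proj n u) (vscale ell (rep u (Suc n)) (unit_vec (Suc n)))"
  by (rule ellp_eqI) (auto simp: ellp_add ellp_scale le_Suc_eq)

lemma proj_strong:
  assumes u: "u \<in> carr ell"
  shows "vlim ell (\<lambda>n. proj n u) u sequentially"
proof -
  let ?g = "\<lambda>n x. if x \<in> {n<..} then rep u x else 0"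
  have gm: "?g n \<in> Lp_fun p counting" for n
  proof (rule Lp_funI)
    show "Lpn counting (?g n) \<le> ennreal (Nm counting (rep u) powr p)"
      using u by (simp add: Lpn_eq_Nm[symmetric]) (auto simp: Lpn_def intro!: nn_integral_mono)
  qed simp
  have "vdiff ell u (proj n u) = Lp_class p counting (?g n)" for n
    by (rule ellp_eqI) (use u gm in \<open>auto simp: vdiff_def ellp_add ellp_scale\<close>)
  then have "vnorm ell (vdiff ell (proj n u) u) = Nm counting (?g n)" for n
    using u gm by (simp add: ell.norm_diff_commute[of "proj n u"] vnorm_Lp_class)
  moreover have "(\<lambda>n. Nm counting (?g n)) \<longlonglongrightarrow> 0"
  proof (rule Nm_truncate_tendsto)
    show "\<forall>\<^sub>F n in sequentially. x \<notin> {n<..}" for x :: nat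
      by (rule eventually_sequentiallyI[of x]) simp
  qed (use u in \<open>auto simp: counting_def\<close>)
  ultimately show ?thesis by (simp add: vlim_def)
qed

lemma functional_proj:
  assumes \<phi>: "\<phi> \<in> ell_dual" and u: "u \<in> carr ell"
  shows "\<phi> (proj n u) = (\<Sum>j<n. rep u (Suc j) * \<phi> (unit_vec (Suc j)))"
  using u by (induction n)
    (simp_all add: proj_0 proj_Suc ellC.Lop_zero[OF \<phi>] ellC.Lop_add[OF \<phi>] ellC.Lop_scale[OF \<phi>])

lemma functional_sums:
  assumes \<phi>: "\<phi> \<in> ell_dual" and u: "u \<in> carr ell"
  shows "(\<lambda>j. rep u (Suc j) * \<phi> (unit_vec (Suc j))) sums \<phi> u"
  using ellC.vlim_Lop[OF proj_strong[OF u] \<phi>] u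
  by (simp add: functional_proj[OF \<phi>] cnspace_complex_vlim sums_def)

text \<open>Row \<open>i\<close> of \<open>k\<close> is the functional \<open>coord i\<close> after
  \<open>k\<close>, so this is the expansion of a functional along the truncations of
  \<open>u\<close>. It justifies the matrix formula in \<open>kron_fun\<close>.\<close>

lemma matrix_sums:
  assumes k: "k \<in> ell_ops" and u: "u \<in> carr ell" and i: "1 \<le> i"
  shows "(\<lambda>j. rep u (Suc j) * rep (k (unit_vec (Suc j))) i) sums rep (k u) i"
  using functional_sums[OF ellellC.compose_closed[OF coord_Lop[OF i] k] u] k u
  by (simp add: compose_eq coord_def)

definition rank_one :: "(nat \<Rightarrow> complex) set \<Rightarrow> ((nat \<Rightarrow> complex) set \<Rightarrow> complex) \<Rightarrow>
    (nat \<Rightarrow> complex) set \<Rightarrow> (nat \<Rightarrow> complex) set" where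
  "rank_one z \<phi> = (\<lambda>u\<in>carr ell. vscale ell (\<phi> u) z)"

lemma rank_one_compact_operators:
  assumes "z \<in> carr ell" "\<phi> \<in> ell_dual"
  shows "rank_one z \<phi> \<in> compact_operators ell"
  unfolding rank_one_def using assms by (intro ell.rank_one_compact)

lemma compact_operators_Lop: "k \<in> compact_operators ell \<Longrightarrow> k \<in> ell_ops"
  by (simp add: compact_operators_def)

lemma rank_one_Lop [simp]: "z \<in> carr ell \<Longrightarrow> \<phi> \<in> ell_dual \<Longrightarrow>
    rank_one z \<phi> \<in> ell_ops"
  by (intro compact_operators_Lop rank_one_compact_operators)

lemma proj_vlim_compact:
  "k \<in> compact_operators ell \<Longrightarrow>
    vlim (Lop ell ell) (\<lambda>n. compose (carr ell) (proj n) k) k sequentially"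
  by (intro ell.vlim_compose_compact norm_proj proj_strong) auto

lemma compose_proj_0:
  assumes k: "k \<in> ell_ops"
  shows "compose (carr ell) (proj 0) k = vzero (Lop ell ell)"
  by (rule ellell.Lop_ext)
    (use k in \<open>auto simp: compose_eq proj_0 ellell.Lop_zero_closed, auto simp: Lop_simps(3)\<close>)

text \<open>Admitting one more coordinate adds one row of the matrix of \<open>k\<close>, which is a
  rank one operator. By induction a truncated operator is a finite sum of such.\<close>

lemma compose_proj_Suc:
  assumes k: "k \<in> ell_ops"
  shows "compose (carr ell) (proj (Suc n)) k = vadd (Lop ell ell)
    (compose (carr ell) (proj n) k)
    (rank_one (unit_vec (Suc n)) (compose (carr ell) (coord (Suc n)) k))"
proof (rule ellell.Lop_ext)
  have c: "compose (carr ell) (coord (Suc n)) k \<in> ell_dual"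
    by (intro ellellC.compose_closed coord_Lop k) simp
  then show "vadd (Lop ell ell) (compose (carr ell) (proj n) k)
    (rank_one (unit_vec (Suc n)) (compose (carr ell) (coord (Suc n)) k))
      \<in> ell_ops"
    using k by (intro ellell.Lop_add_closed) auto
qed (use k in \<open>auto simp: compose_eq proj_Suc Lop_simps(2) rank_one_def coord_def\<close>)

end

text \<open>The larger of the two powers alone dominates the product: if
  \<open>b powr r \<le> a powr p\<close>, then \<open>b \<le> a powr (p/r)\<close>, and
  \<open>1 + p/r = p\<close>. This crude form of Young's inequality suffices, since only finiteness
  of sums is at stake.\<close>

lemma simple_Young:
  fixes a b p r :: real
  assumes "0 < p" "0 < r" "1 / p + 1 / r = 1" "0 \<le> a" "0 \<le> b"
  shows "a * b \<le> a powr p + b powr r"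
proof -
  have main: "a * b \<le> a powr p" if le: "b powr r \<le> a powr p" and "0 < p" "0 < r"
      and eq: "1 / p + 1 / r = 1" and a: "0 \<le> a" "0 \<le> b" for a b p r :: real
  proof (cases "a = 0")
    case False
    have "(b powr r) powr (1/r) \<le> (a powr p) powr (1/r)"
      using le that by (rule_tac powr_mono2) auto
    then have b: "b \<le> a powr (p/r)" using that by (simp add: powr_powr)
    have "p * (1 / p + 1 / r) = 1 + p / r" using that(2) by (simp add: distrib_left)
    then have e: "1 + p / r = p" unfolding eq by simp
    have "a * b \<le> a powr 1 * a powr (p/r)"
      using b a by (simp add: mult_left_mono)
    also have "\<dots> = a powr p" unfolding powr_add[symmetric] e ..
    finally show ?thesis .
  qed simp
  show ?thesis
  proof (cases "b powr r \<le> a powr p")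
    case True
    then show ?thesis using main[OF True] assms by (simp add: add_increasing2)
  next
    case False
    then have "b * a \<le> b powr r" using assms by (intro main[of a p b r]) auto
    then show ?thesis by (simp add: mult.commute add_increasing)
  qed
qed

locale Lp_conjugate = Lp_exponent +
  fixes q :: ennreal
  assumes conj: "1 / ennreal p + 1 / q = 1"
begin

lemma conjugate_cases:
  obtains (inf) "q = top" "p = 1"
  | (fin) r where "q = ennreal r" "0 < r" "1 / p + 1 / r = 1" "q \<noteq> top" "enn2real q = r"
proof -
  have p: "1 / ennreal p = ennreal (1 / p)"
    using p_pos by (simp add: divide_ennreal[symmetric] flip: ennreal_1)
  show thesis
  proof (cases q rule: ennreal_cases)
    case top
    then have "ennreal (1 / p) = ennreal 1" using conj p by simp
    then have "p = 1" using p_pos by (subst (asm) ennreal_inj) auto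
    then show thesis using inf top by simp
  next
    case (real r)
    \<comment> \<open>In \<open>ennreal\<close>, \<open>1 / 0\<close> is \<open>top\<close>, which
      would exceed the sum 1.\<close>
    have "r \<noteq> 0" using conj real by (auto simp: divide_ennreal_def)
    then have r: "0 < r" using real by simp
    have "1 / q = ennreal (1 / r)"
      using r real by (simp add: divide_ennreal[symmetric] flip: ennreal_1)
    then have "ennreal (1 / p + 1 / r) = ennreal 1" using conj p r p_pos by simp
    then have "1 / p + 1 / r = 1" using p_pos r by (subst (asm) ennreal_inj) auto
    then show thesis using fin r real by simp
  qed
qed

text \<open>The constant need not be the \<open>q\<close>-norm of \<open>\<upsilon>\<close>. On the
  unit ball a sup bound (\<open>p = 1\<close>) or Young's inequality bounds all finite sums at once;
  homogeneity then gives the factor \<open>vnorm ell u\<close>.\<close>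

lemma Hoelder_finite:
  assumes \<upsilon>: "\<upsilon> \<in> ellq q"
  obtains C where "0 \<le> C" "\<And>u F. u \<in> carr ell \<Longrightarrow> finite F \<Longrightarrow> F \<subseteq> {1..} \<Longrightarrow>
    (\<Sum>j\<in>F. norm (\<upsilon> j * rep u j)) \<le> C * vnorm ell u"
proof -
  obtain C where C: "0 \<le> C" and unit: "\<And>u F. u \<in> carr ell \<Longrightarrow> vnorm ell u \<le> 1 \<Longrightarrow>
    finite F \<Longrightarrow> F \<subseteq> {1..} \<Longrightarrow> (\<Sum>j\<in>F. norm (\<upsilon> j * rep u j)) \<le> C"
  proof (cases rule: conjugate_cases)
    case inf
    then have "bounded (\<upsilon> ` {1..})" using \<upsilon> by (simp add: ellq_def)
    then obtain K where K: "0 < K" "\<And>j. 1 \<le> j \<Longrightarrow> norm (\<upsilon> j) \<le> K"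
      by (auto simp: bounded_pos)
    show thesis
    proof (rule that)
      show "0 \<le> K" using K by simp
      fix u and F :: "nat set" assume u: "u \<in> carr ell" "vnorm ell u \<le> 1" and F: "finite F" "F \<subseteq> {1..}"
      have "(\<Sum>j\<in>F. norm (\<upsilon> j * rep u j)) \<le> (\<Sum>j\<in>F. K * norm (rep u j))"
        using F K by (intro sum_mono) (auto simp: norm_mult intro!: mult_right_mono)
      also have "\<dots> = K * (\<Sum>j\<in>F. norm (rep u j) powr p)"
        using inf by (simp add: sum_distrib_left)
      also have "\<dots> \<le> K * 1"
        using ellp_sum_le[OF u(1) F] u inf K ell.norm_nonneg[OF u(1)] by (intro mult_left_mono) auto
      finally show "(\<Sum>j\<in>F. norm (\<upsilon> j * rep u j)) \<le> K" by simp
    qed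
  next
    case (fin r)
    then have summ: "(\<lambda>j. norm (\<upsilon> j) powr r) summable_on {1..}" using \<upsilon> by (simp add: ellq_def)
    show thesis
    proof (rule that)
      show "0 \<le> 1 + (\<Sum>\<^sub>\<infinity>j\<in>{1..}. norm (\<upsilon> j) powr r)" by (simp add: infsum_nonneg)
      fix u and F :: "nat set" assume u: "u \<in> carr ell" "vnorm ell u \<le> 1" and F: "finite F" "F \<subseteq> {1..}"
      have "(\<Sum>j\<in>F. norm (\<upsilon> j * rep u j)) \<le> (\<Sum>j\<in>F. norm (rep u j) powr p + norm (\<upsilon> j) powr r)"
        using simple_Young[OF p_pos fin(2,3) norm_ge_zero norm_ge_zero]
        by (intro sum_mono) (simp add: norm_mult mult.commute[of "norm (\<upsilon> _)"])
      also have "\<dots> = (\<Sum>j\<in>F. norm (rep u j) powr p) + (\<Sum>j\<in>F. norm (\<upsilon> j) powr r)"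
        by (simp add: sum.distrib)
      also have "\<dots> \<le> vnorm ell u powr p + (\<Sum>\<^sub>\<infinity>j\<in>{1..}. norm (\<upsilon> j) powr r)"
        using F u by (intro add_mono ellp_sum_le finite_sum_le_infsum summ) auto
      also have "vnorm ell u powr p \<le> 1 powr p"
        using u p_pos by (intro powr_mono2) auto
      finally show "(\<Sum>j\<in>F. norm (\<upsilon> j * rep u j)) \<le> 1 + (\<Sum>\<^sub>\<infinity>j\<in>{1..}. norm (\<upsilon> j) powr r)" by simp
    qed
  qed
  show thesis
  proof (rule that[OF C])
    fix u and F :: "nat set" assume u: "u \<in> carr ell" and F: "finite F" "F \<subseteq> {1..}"
    show "(\<Sum>j\<in>F. norm (\<upsilon> j * rep u j)) \<le> C * vnorm ell u"
    proof (cases "vnorm ell u = 0")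
      case True
      have "norm (\<upsilon> j * rep u j) = 0" if "j \<in> F" for j
        using ellp_coord_le[OF u, of j] that F True by auto
      then have "(\<Sum>j\<in>F. norm (\<upsilon> j * rep u j)) = 0" by (intro sum.neutral ballI)
      then show ?thesis using True by simp
    next
      case False
      then have pos: "0 < vnorm ell u" using ell.norm_nonneg[OF u] by linarith
      let ?c = "complex_of_real (1 / vnorm ell u)"
      let ?v = "vscale ell ?c u"
      have "(\<Sum>j\<in>F. norm (\<upsilon> j * rep ?v j)) \<le> C"
        using pos u F by (intro unit) (auto simp: ell.norm_scale norm_divide)
      moreover have "(\<Sum>j\<in>F. norm (\<upsilon> j * rep ?v j)) = (\<Sum>j\<in>F. (1 / vnorm ell u) * norm (\<upsilon> j * rep u j))"
        using u F pos by (intro sum.cong) (auto simp: ellp_scale norm_mult norm_divide subset_iff)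
      ultimately have "(1 / vnorm ell u) * (\<Sum>j\<in>F. norm (\<upsilon> j * rep u j)) \<le> C"
        by (simp only: sum_distrib_left)
      then show ?thesis using pos by (simp add: field_simps)
    qed
  qed
qed

lemma Hoelder_summable:
  assumes "\<upsilon> \<in> ellq q" and u: "u \<in> carr ell"
  shows "(\<lambda>j. norm (\<upsilon> j * rep u j)) summable_on {1..}"
proof -
  obtain C where "\<And>F. finite F \<Longrightarrow> F \<subseteq> {1..} \<Longrightarrow>
      (\<Sum>j\<in>F. norm (\<upsilon> j * rep u j)) \<le> C * vnorm ell u"
    using Hoelder_finite[OF assms(1)] u by metis
  then show ?thesis unfolding abs_summable_iff_bdd_above[of "\<lambda>j. \<upsilon> j * rep u j"]
    by (intro bdd_aboveI2[where M = "C * vnorm ell u"]) auto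
qed

lemma row_op_Lop:
  assumes \<upsilon>: "\<upsilon> \<in> ellq q"
  shows "row_op p \<upsilon> \<in> ell_dual"
proof -
  obtain C where C: "0 \<le> C" "\<And>u F. u \<in> carr ell \<Longrightarrow> finite F \<Longrightarrow> F \<subseteq> {1..} \<Longrightarrow>
      (\<Sum>j\<in>F. norm (\<upsilon> j * rep u j)) \<le> C * vnorm ell u"
    using Hoelder_finite[OF \<upsilon>] by metis
  note s = Hoelder_summable[OF \<upsilon>] abs_summable_summable[OF Hoelder_summable[OF \<upsilon>]]
  show ?thesis
  proof (rule ellC.Lop_memI[of _ C])
    fix u v c assume u: "u \<in> carr ell"
    have "norm (\<Sum>\<^sub>\<infinity>j\<in>{1..}. \<upsilon> j * rep u j) \<le> (\<Sum>\<^sub>\<infinity>j\<in>{1..}. norm (\<upsilon> j * rep u j))"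
      by (rule norm_infsum_bound[OF s(1)[OF u]])
    also have "\<dots> \<le> C * vnorm ell u"
      using C(2)[OF u] by (intro infsum_le_finite_sums s(1)[OF u]) auto
    finally show "vnorm complex_space (row_op p \<upsilon> u) \<le> C * vnorm ell u"
      using u by (simp add: row_op_def)
    have "(\<Sum>\<^sub>\<infinity>j\<in>{1..}. \<upsilon> j * rep (vscale ell c u) j) = (\<Sum>\<^sub>\<infinity>j\<in>{1..}. c * (\<upsilon> j * rep u j))"
      using u by (intro infsum_cong) (simp add: ellp_scale)
    then show "row_op p \<upsilon> (vscale ell c u) = vscale complex_space c (row_op p \<upsilon> u)"
      using u by (simp add: row_op_def infsum_cmult_right')
    assume v: "v \<in> carr ell"
    have "(\<Sum>\<^sub>\<infinity>j\<in>{1..}. \<upsilon> j * rep (vadd ell u v) j)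
        = (\<Sum>\<^sub>\<infinity>j\<in>{1..}. \<upsilon> j * rep u j + \<upsilon> j * rep v j)"
      using u v by (intro infsum_cong) (simp add: ellp_add distrib_left)
    also have "\<dots> = (\<Sum>\<^sub>\<infinity>j\<in>{1..}. \<upsilon> j * rep u j) + (\<Sum>\<^sub>\<infinity>j\<in>{1..}. \<upsilon> j * rep v j)"
      by (intro infsum_add s(2) u v)
    finally show "row_op p \<upsilon> (vadd ell u v) = vadd complex_space (row_op p \<upsilon> u) (row_op p \<upsilon> v)"
      using u v by (simp add: row_op_def)
  qed (auto simp: row_op_def)
qed

text \<open>The converse of Hoelder: \<open>\<phi>\<close> is tested on finitely supported vectors
  for which Hoelder's inequality is an equality. Writing \<open>S\<close> for the sum of the first
  \<open>n\<close> powers, this gives \<open>S \<le> ?c * S powr (1/p)\<close>, hence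
  \<open>S \<le> ?c powr r\<close> independently of \<open>n\<close>. For \<open>q = top\<close> the
  unit vectors are test enough.\<close>

lemma functional_ellq:
  assumes \<phi>: "\<phi> \<in> ell_dual"
  shows "(\<lambda>j. \<phi> (unit_vec j)) \<in> ellq q"
proof (cases rule: conjugate_cases)
  case inf
  have "norm (\<phi> (unit_vec j)) \<le> vnorm (Lop ell complex_space) \<phi>" if "1 \<le> j" for j
    using ellC.norm_le_opnorm[OF \<phi> unit_vec_closed, of j] norm_unit_vec[OF that]
      mult_left_mono[OF norm_unit_vec[OF that] ellC.opnorm_nonneg[OF \<phi>]] by simp
  then show ?thesis using inf by (auto simp: ellq_def bounded_iff)
next
  case (fin r)
  let ?c = "vnorm (Lop ell complex_space) \<phi>"
  let ?w = "\<lambda>j. \<phi> (unit_vec j)"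
  have c: "0 \<le> ?c" by (rule ellC.opnorm_nonneg[OF \<phi>])
  have bound: "(\<Sum>j\<in>F. norm (?w j) powr r) \<le> ?c powr r" if F: "finite F" "F \<subseteq> {1..}" for F
  proof -
    \<comment> \<open>An initial segment in place of \<open>F\<close> lets
      \<open>functional_proj\<close> evaluate \<open>\<phi>\<close> on the test vector.\<close>
    obtain n where n: "F \<subseteq> {1..n}"
      using F finite_nat_set_iff_bounded_le by fastforce
    define S where "S = (\<Sum>j\<in>{1..n}. norm (?w j) powr r)"
    \<comment> \<open>The phase makes \<open>f j * ?w j\<close> equal to
      \<open>norm (?w j) powr r\<close>, and the exponent \<open>r - 1\<close> makes
      \<open>norm (f j) powr p\<close> the same number, because
      \<open>(r - 1) * p = r\<close>.\<close>
    define f where "f j = (if j \<in> {1..n} then cnj (sgn (?w j)) * complex_of_real (norm (?w j) powr (r - 1)) else 0)" for j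
    have r: "(r - 1) * p = r" "1 < r"
    proof -
      have "p + r = p * r" using fin p_pos by (simp add: field_simps)
      then show "(r - 1) * p = r" by (simp add: algebra_simps)
      then show "1 < r" using fin p_pos by (metis diff_gt_0_iff_gt zero_less_mult_pos2)
    qed
    have nf: "norm (f j) powr p = (if j \<in> {1..n} then norm (?w j) powr r else 0)" for j
      using r by (cases "?w j = 0") (auto simp: f_def norm_mult norm_sgn powr_powr)
    have wf: "f j * ?w j = (if j \<in> {1..n} then complex_of_real (norm (?w j) powr r) else 0)" for j
    proof (cases "?w j = 0")
      case False
      have "cnj (sgn (?w j)) * ?w j = complex_of_real (norm (?w j))"
        using False by (simp add: sgn_div_norm scaleR_conv_of_real complex_norm_square[symmetric]
            mult.commute[of "cnj _"] power2_eq_square divide_simps)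
      then have "f j * ?w j = (if j \<in> {1..n} then complex_of_real (norm (?w j) * norm (?w j) powr (r - 1)) else 0)"
        by (simp add: f_def mult.assoc mult.left_commute)
      also have "norm (?w j) * norm (?w j) powr (r - 1) = norm (?w j) powr r"
        using powr_add[of "norm (?w j)" 1 "r - 1"] False by simp
      finally show ?thesis .
    qed (simp add: f_def)
    have L: "Lpn counting f = ennreal S"
    proof -
      have "Lpn counting f = ennreal (\<Sum>j\<in>{1..n}. norm (f j) powr p)"
        by (rule Lpn_finite_support) (auto simp: f_def)
      also have "(\<Sum>j\<in>{1..n}. norm (f j) powr p) = S"
        unfolding S_def by (intro sum.cong) (simp_all add: nf)
      finally show ?thesis .
    qed
    have S: "0 \<le> S" by (simp add: S_def sum_nonneg)
    have fL: "f \<in> Lp_fun p counting" by (rule Lp_funI[of _ _ S]) (simp_all add: L)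
    have Nf: "Nm counting f \<le> S powr (1/p)"
      using S p_pos by (intro Nm_leI) (simp_all add: L powr_powr)
    let ?z = "Lp_class p counting f"
    have zc: "?z \<in> carr ell" using fL by simp
    have "proj n ?z = ?z"
      by (rule ellp_eqI) (use fL in \<open>auto simp: f_def\<close>)
    then have "\<phi> ?z = (\<Sum>j<n. f (Suc j) * ?w (Suc j))"
      using functional_proj[OF \<phi> zc, of n] fL by simp
    also have "\<dots> = complex_of_real S"
      unfolding S_def wf using sum.atLeast1_atMost_eq[of "\<lambda>j. complex_of_real (norm (?w j) powr r)" n]
      by (simp add: less_Suc_eq_le Suc_le_eq)
    finally have "S = norm (\<phi> ?z)" using S by simp
    also have "\<dots> \<le> ?c * S powr (1/p)"
      using ellC.norm_le_opnorm[OF \<phi> zc] mult_left_mono[OF Nf c] fL by (simp add: vnorm_Lp_class)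
    finally have le: "S \<le> ?c * S powr (1/p)" .
    have "S \<le> ?c powr r"
    proof (cases "S = 0")
      case False
      then have pos: "0 < S" using S by simp
      \<comment> \<open>The factor \<open>S powr (1/p)\<close> is cancelled against the right-hand
        side of \<open>le\<close>.\<close>
      have "S = S powr (1/p) * S powr (1/r)" using pos fin by (simp flip: powr_add)
      then have "S powr (1/r) \<le> ?c" using le pos
        by (smt (verit, best) mult.commute mult_right_le_imp_le mult_le_cancel_right powr_gt_zero)
      then have "(S powr (1/r)) powr r \<le> ?c powr r" using fin by (rule_tac powr_mono2) auto
      then show ?thesis using fin pos by (simp add: powr_powr)
    qed simp
    moreover have "(\<Sum>j\<in>F. norm (?w j) powr r) \<le> S"
      unfolding S_def using n by (intro sum_mono2) auto
    ultimately show ?thesis by linarith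
  qed
  have "(\<lambda>j. norm (?w j) powr r) summable_on {1..}"
    using bound by (intro nonneg_bdd_above_summable_on bdd_aboveI2[where M = "?c powr r"]) auto
  then show ?thesis using fin by (simp add: ellq_def)
qed

text \<open>The ordered series of \<open>functional_sums\<close> and the unordered sum in
  \<open>row_op\<close> agree because Hoelder makes the terms absolutely summable;
  \<open>Suc\<close> matches the two index sets.\<close>

lemma functional_eq_row_op:
  assumes \<phi>: "\<phi> \<in> ell_dual"
  shows "\<phi> = row_op p (\<lambda>j. \<phi> (unit_vec j))"
proof (rule ellC.Lop_ext[OF \<phi> row_op_Lop[OF functional_ellq[OF \<phi>]]])
  fix u assume u: "u \<in> carr ell"
  let ?h = "\<lambda>j. \<phi> (unit_vec j) * rep u j"
  have "(?h has_sum infsum ?h {1..}) {1..}"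
    using abs_summable_summable[OF Hoelder_summable[OF functional_ellq[OF \<phi>] u]] by simp
  moreover have "bij_betw Suc UNIV {1..}"
    by (rule bij_betwI[of _ _ _ "\<lambda>n. n - 1"]) auto
  ultimately have "((\<lambda>j. ?h (Suc j)) has_sum infsum ?h {1..}) UNIV"
    using has_sum_reindex_bij_betw[of Suc UNIV "{1..}" ?h "infsum ?h {1..}"] by simp
  then have "(\<lambda>j. ?h (Suc j)) sums infsum ?h {1..}" by (rule has_sum_imp_sums)
  moreover have "(\<lambda>j. ?h (Suc j)) sums \<phi> u"
    using functional_sums[OF \<phi> u] by (simp add: mult.commute)
  ultimately show "\<phi> u = row_op p (\<lambda>j. \<phi> (unit_vec j)) u"
    using u by (simp add: row_op_def sums_unique2)
qed

text \<open>Sequences in \<open>l^q\<close> can now be replaced by bounded functionals, which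
  compose with operators on \<open>l^p\<close> without any computation.\<close>

lemma row_op_image: "row_op p ` ellq q = ell_dual"
  using row_op_Lop functional_ellq functional_eq_row_op by blast

end

section \<open>Tensor products with \<open>\<ell>\<^sup>p\<close>\<close>

context cnspace_pair
begin

text \<open>It is the kernel of a bounded operator, the preimage of the closed subspace zero under
  the difference.\<close>

lemma closed_subspace_equalizer:
  assumes S: "S \<in> carr (Lop E F)" and T: "T \<in> carr (Lop E F)"
  shows "closed_subspace E {u \<in> carr E. S u = T u}"
proof -
  interpret L: cnspace "Lop E F" by (rule cnspace_Lop)
  have z: "closed_subspace F {vzero F}"
  proof (rule F.closed_subspaceI)
    fix u assume "u \<in> carr F" "\<And>\<epsilon>. \<epsilon> > 0 \<Longrightarrow> \<exists>w\<in>{vzero F}. vnorm F (vdiff F u w) < \<epsilon>"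
    then have "u = vzero F" by (intro F.eq_if_norm_diff_le) (auto intro: less_imp_le)
    then show "u \<in> {vzero F}" by simp
  qed (auto simp: linear_subspace_def)
  have "S u = T u \<longleftrightarrow> vdiff (Lop E F) S T u \<in> {vzero F}" if "u \<in> carr E" for u
    using that S T F.eq_if_norm_diff[of "S u" "T u"] by (auto simp: Lop_diff_apply)
  then have "{u \<in> carr E. S u = T u} = {u \<in> carr E. vdiff (Lop E F) S T u \<in> {vzero F}}" by auto
  then show ?thesis using closed_subspace_vimage[OF L.diff_closed[OF S T] z] by simp
qed

end

locale Lp_tensor = Lp_exponent +
  fixes \<mu> :: "'a measure"
begin

abbreviation "P \<equiv> counting \<Otimes>\<^sub>M \<mu>"
abbreviation "E \<equiv> Lp p \<mu>"
abbreviation "F \<equiv> Lp p P"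

sublocale E: cnspace E by (rule cnspace_Lp)
sublocale F: cnspace F by (rule cnspace_Lp)
sublocale pEE: cnspace_pair E E ..
sublocale pEF: cnspace_pair E F ..
sublocale pFE: cnspace_pair F E ..
sublocale pFF: cnspace_pair F F ..
sublocale EE: cnspace_triple E E E ..
sublocale EEF: cnspace_triple E E F ..
sublocale EFE: cnspace_triple E F E ..
sublocale FEE: cnspace_triple F E E ..
sublocale FEF: cnspace_triple F E F ..
sublocale EFF: cnspace_triple E F F ..
sublocale FFE: cnspace_triple F F E ..
sublocale FFF: cnspace_triple F F F ..

section \<open>Slices and columns of functions on the product\<close>

lemma pair_measurableI:
  "(\<And>i. 1 \<le> i \<Longrightarrow> (\<lambda>t. f (i, t)) \<in> borel_measurable \<mu>) \<Longrightarrow> f \<in> borel_measurable P"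
  unfolding counting_def by (rule measurable_pair_measure_countable1) auto

lemma slice_measurable: "f \<in> borel_measurable P \<Longrightarrow> 1 \<le> i \<Longrightarrow> (\<lambda>t. f (i, t)) \<in> borel_measurable \<mu>"
  by (rule measurable_compose_Pair1) (auto simp: counting_def)

lemma AE_P: "(AE x in P. Q x) \<longleftrightarrow> (\<forall>i\<ge>1. AE t in \<mu>. Q (i, t))"
  unfolding counting_def by (subst AE_count_space_pair) auto

text \<open>A countable union of null sets is null, so one exceptional set in \<open>\<mu>\<close>
  serves all slices. In this form a property can be proved column by column.\<close>

lemma AE_P': "(AE x in P. Q x) \<longleftrightarrow> (AE t in \<mu>. \<forall>i\<ge>1. Q (i, t))"
  unfolding AE_P by (simp add: AE_all_countable)

lemma Lpn_P:
  assumes "f \<in> borel_measurable P"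
  shows "Lpn P f = (\<Sum>j. Lpn \<mu> (\<lambda>t. f (Suc j, t)))"
proof -
  note [measurable] = assms
  have "(\<lambda>x. ennreal (norm (f x) powr p)) \<in> borel_measurable P" by measurable
  then have "Lpn P f = (\<integral>\<^sup>+i. Lpn \<mu> (\<lambda>t. f (i, t)) \<partial>counting)"
    unfolding Lpn_def by (simp add: counting_def nn_integral_count_space_pair)
  then show ?thesis by (simp add: nn_integral_counting)
qed

lemma Lpn_counting: "Lpn counting f = (\<Sum>j. ennreal (norm (f (Suc j)) powr p))"
  by (simp add: Lpn_def nn_integral_counting)

text \<open>The opposite order of integration, by exchanging the sum over slices with the integral
  over \<open>\<mu>\<close>.\<close>

lemma Lpn_P':
  assumes f: "f \<in> borel_measurable P"
  shows "Lpn P f = (\<integral>\<^sup>+t. Lpn counting (\<lambda>i. f (i, t)) \<partial>\<mu>)"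
    and "(\<lambda>t. Lpn counting (\<lambda>i. f (i, t))) \<in> borel_measurable \<mu>"
proof -
  have [measurable]: "(\<lambda>t. f (Suc j, t)) \<in> borel_measurable \<mu>" for j
    by (rule slice_measurable[OF f]) simp
  show "Lpn P f = (\<integral>\<^sup>+t. Lpn counting (\<lambda>i. f (i, t)) \<partial>\<mu>)"
    unfolding Lpn_P[OF f] Lpn_counting by (subst nn_integral_suminf) (simp_all add: Lpn_def)
  show "(\<lambda>t. Lpn counting (\<lambda>i. f (i, t))) \<in> borel_measurable \<mu>"
    unfolding Lpn_counting by measurable
qed

lemma slice_Lpn_le:
  assumes f: "f \<in> borel_measurable P" and i: "1 \<le> i"
  shows "Lpn \<mu> (\<lambda>t. f (i, t)) \<le> Lpn P f"
  unfolding Lpn_P[OF f]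
  using sum_le_suminf[of "\<lambda>j. Lpn \<mu> (\<lambda>t. f (Suc j, t))" "{i - 1}"] i by simp

lemma slice_Lp_fun:
  assumes f: "f \<in> Lp_fun p P" and i: "1 \<le> i"
  shows "(\<lambda>t. f (i, t)) \<in> Lp_fun p \<mu>"
  using slice_Lpn_le[OF Lp_fun_measurable[OF f] i] slice_measurable[OF Lp_fun_measurable[OF f] i] f
  by (auto simp: Lp_fun_iff intro: le_less_trans)

lemma AE_column_Lp_fun:
  assumes f: "f \<in> Lp_fun p P"
  shows "AE t in \<mu>. (\<lambda>i. f (i, t)) \<in> Lp_fun p counting"
proof -
  note fm = Lp_fun_measurable[OF f]
  have "(\<integral>\<^sup>+t. Lpn counting (\<lambda>i. f (i, t)) \<partial>\<mu>) \<noteq> \<infinity>"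
    using f Lpn_P'(1)[OF fm] by (simp add: Lp_fun_iff less_top)
  then have "AE t in \<mu>. Lpn counting (\<lambda>i. f (i, t)) \<noteq> \<infinity>"
    by (rule nn_integral_PInf_AE[OF Lpn_P'(2)[OF fm]])
  then show ?thesis by (simp add: Lp_fun_iff less_top)
qed

abbreviation tens :: "(nat \<Rightarrow> complex) set \<Rightarrow> ('a \<Rightarrow> complex) set \<Rightarrow> (nat \<times> 'a \<Rightarrow> complex) set" where
  "tens \<equiv> tensor (Lp_tdecomp p counting \<mu>)"

lemma tens_def: "tens u v = Lp_class p P (\<lambda>(s, t). rep u s * rep v t)"
  by (simp add: Lp_tdecomp_def)

lemma Lpn_product:
  assumes g [measurable]: "g \<in> borel_measurable \<mu>"
  shows "(\<lambda>(s, t). f s * g t) \<in> borel_measurable P"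
    and "Lpn P (\<lambda>(s, t). f s * g t) = Lpn counting f * Lpn \<mu> g"
proof -
  show m: "(\<lambda>(s, t). f s * g t) \<in> borel_measurable P"
    by (rule pair_measurableI) simp
  show "Lpn P (\<lambda>(s, t). f s * g t) = Lpn counting f * Lpn \<mu> g"
    unfolding Lpn_P[OF m] Lpn_counting
    by (simp add: Lpn_def norm_mult powr_mult ennreal_mult' nn_integral_cmult)
qed

lemma product_Lp_fun:
  assumes "f \<in> Lp_fun p counting" "g \<in> Lp_fun p \<mu>"
  shows "(\<lambda>(s, t). f s * g t) \<in> Lp_fun p P"
  using assms Lpn_product[of g f] by (auto simp: Lp_fun_iff ennreal_mult_less_top)

lemma tens_class:
  assumes f: "f \<in> Lp_fun p counting" and g: "g \<in> Lp_fun p \<mu>"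
  shows "tens (Lp_class p counting f) (Lp_class p \<mu> g) = Lp_class p P (\<lambda>(s, t). f s * g t)"
  unfolding tens_def
proof (subst Lp_class_eq_iff)
  show "AE x in P. (case x of (s, t) \<Rightarrow> rep (Lp_class p counting f) s * rep (Lp_class p \<mu> g) t)
      = (case x of (s, t) \<Rightarrow> f s * g t)"
    unfolding AE_P using f rep_Lp_class(2)[OF g] by (auto elim: eventually_mono)
qed (use f g in \<open>auto intro!: product_Lp_fun rep_Lp_class(1)\<close>)

text \<open>The operator \<open>u\<close> tensor the identity of \<open>E\<close>; the general
  column operator is obtained from it by composition.\<close>

definition col :: "(nat \<Rightarrow> complex) set \<Rightarrow> ('a, nat \<times> 'a) Lp_op" where
  "col u = Lp_lift \<mu> P (\<lambda>g (s, t). rep u s * g t)"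

lemma col_liftable:
  assumes u: "u \<in> carr ell"
  shows "Lp_liftable \<mu> P (\<lambda>g (s, t). rep u s * g t) (vnorm ell u)"
  unfolding Lp_liftable_def AE_P using u
  by (auto simp: Lpn_product Lp_fun_measurable Lpn_eq_Nm[of "rep u"] vnorm_Lp Nm_nonneg distrib_left
      mult.left_commute elim: eventually_mono)

lemma col_Lop [simp]: "u \<in> carr ell \<Longrightarrow> col u \<in> carr (Lop E F)"
  unfolding col_def by (rule Lp_lift_Lop[OF col_liftable])

lemma norm_col: "u \<in> carr ell \<Longrightarrow> vnorm (Lop E F) (col u) \<le> vnorm ell u"
  unfolding col_def by (rule Lp_lift_norm[OF col_liftable])

lemma col_apply: "u \<in> carr ell \<Longrightarrow> v \<in> carr E \<Longrightarrow> col u v = tens u v"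
  using Lp_lift_class[OF col_liftable, of u "rep v"] by (simp add: col_def tens_def)

lemma tens_closed [simp]: "u \<in> carr ell \<Longrightarrow> v \<in> carr E \<Longrightarrow> tens u v \<in> carr F"
  using pEF.Lop_closed[OF col_Lop] by (simp flip: col_apply)

lemma tens_add_left:
  assumes "u \<in> carr ell" "u' \<in> carr ell" "v \<in> carr E"
  shows "tens (vadd ell u u') v = vadd F (tens u v) (tens u' v)"
  unfolding tens_def using assms
  by (subst vadd_Lp_class, simp_all add: product_Lp_fun, subst Lp_class_eq_iff)
    (auto simp: product_Lp_fun AE_P ellp_add distrib_right
      intro!: Lp_fun_add product_Lp_fun)

lemma tens_scale_left:
  assumes "u \<in> carr ell" "v \<in> carr E"
  shows "tens (vscale ell c u) v = vscale F c (tens u v)"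
  unfolding tens_def using assms
  by (subst vscale_Lp_class, simp_all add: product_Lp_fun, subst Lp_class_eq_iff)
    (auto simp: product_Lp_fun AE_P ellp_scale mult.assoc intro!: Lp_fun_cmult product_Lp_fun)

lemma tens_add_right: "u \<in> carr ell \<Longrightarrow> v \<in> carr E \<Longrightarrow> v' \<in> carr E \<Longrightarrow>
    tens u (vadd E v v') = vadd F (tens u v) (tens u v')"
  using pEF.Lop_add[OF col_Lop, of u v v'] by (simp add: col_apply)

lemma tens_scale_right: "u \<in> carr ell \<Longrightarrow> v \<in> carr E \<Longrightarrow>
    tens u (vscale E c v) = vscale F c (tens u v)"
  using pEF.Lop_scale[OF col_Lop, of u v c] by (simp add: col_apply)

lemma tens_norm: "u \<in> carr ell \<Longrightarrow> v \<in> carr E \<Longrightarrow>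
    vnorm F (tens u v) \<le> vnorm ell u * vnorm E v"
  using pEF.norm_le_opnorm'[OF col_Lop _ norm_col, of u v] by (simp add: col_apply)

section \<open>Operators acting on a single tensor factor\<close>

lemma column_sums:
  assumes k: "k \<in> ell_ops" and g: "g \<in> Lp_fun p counting" and i: "1 \<le> i"
  shows "(\<lambda>j. g (Suc j) * rep (k (unit_vec (Suc j))) i) sums rep (k (Lp_class p counting g)) i"
  using matrix_sums[OF k Lp_class_carr[OF g] i] g by simp

text \<open>This is \<open>k\<close> applied to each column, written as the matrix series because
  measurability in \<open>t\<close> is then evident. Off the null set of columns outside
  \<open>l^p\<close> it agrees with \<open>k\<close> on the class of the column
  (\<open>kron_fun_column\<close>).\<close>

definition kron_fun :: "((nat \<Rightarrow> complex) set \<Rightarrow> (nat \<Rightarrow> complex) set) \<Rightarrow>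
    (nat \<times> 'a \<Rightarrow> complex) \<Rightarrow> nat \<times> 'a \<Rightarrow> complex" where
  "kron_fun k f = (\<lambda>(i, t). \<Sum>j. f (Suc j, t) * rep (k (unit_vec (Suc j))) i)"

definition kron :: "((nat \<Rightarrow> complex) set \<Rightarrow> (nat \<Rightarrow> complex) set) \<Rightarrow> (nat \<times> 'a, nat \<times> 'a) Lp_op" where
  "kron k = Lp_lift P P (kron_fun k)"

lemma kron_fun_column:
  assumes "k \<in> ell_ops" "(\<lambda>i. f (i, t)) \<in> Lp_fun p counting" "1 \<le> i"
  shows "kron_fun k f (i, t) = rep (k (Lp_class p counting (\<lambda>i. f (i, t)))) i"
  using column_sums[OF assms] by (simp add: kron_fun_def sums_iff)

text \<open>For almost every \<open>t\<close> the column lies in \<open>l^p\<close> and its image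
  has norm at most \<open>?c\<close> times its own; integrating the \<open>p\<close>-th powers over
  \<open>t\<close> gives the bound on the product.\<close>

lemma kron_liftable:
  assumes k: "k \<in> ell_ops"
  shows "Lp_liftable P P (kron_fun k) (vnorm (Lop ell ell) k)"
proof -
  let ?c = "vnorm (Lop ell ell) k"
  have c: "0 \<le> ?c" by (rule ellell.opnorm_nonneg[OF k])
  show ?thesis
    unfolding Lp_liftable_def
  proof (intro conjI ballI allI impI)
    fix f assume f: "f \<in> Lp_fun p P"
    note ae = AE_column_Lp_fun[OF f]
    have [measurable]: "(\<lambda>t. f (Suc j, t)) \<in> borel_measurable \<mu>" for j
      by (rule slice_measurable[OF Lp_fun_measurable[OF f]]) simp
    show m: "kron_fun k f \<in> borel_measurable P"
      unfolding kron_fun_def by (rule pair_measurableI) simp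
    have le: "Lpn counting (\<lambda>i. kron_fun k f (i, t))
        \<le> ennreal (?c powr p) * Lpn counting (\<lambda>i. f (i, t))"
      if t: "(\<lambda>i. f (i, t)) \<in> Lp_fun p counting" for t
    proof -
      let ?z = "Lp_class p counting (\<lambda>i. f (i, t))"
      have z: "?z \<in> carr ell" using t by simp
      have kz: "k ?z \<in> carr ell" by (rule ellell.Lop_closed[OF k z])
      have "Lpn counting (\<lambda>i. kron_fun k f (i, t)) = Lpn counting (rep (k ?z))"
        by (rule Lpn_cong_AE) (simp add: AE_counting kron_fun_column[OF k t])
      also have "\<dots> = ennreal (vnorm ell (k ?z) powr p)"
        using kz by (simp add: Lpn_eq_Nm vnorm_Lp)
      also have "\<dots> \<le> ennreal ((?c * vnorm ell ?z) powr p)"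
        using ellell.norm_le_opnorm[OF k z] kz p_pos by (intro ennreal_leI powr_mono2) auto
      also have "\<dots> = ennreal (?c powr p) * Lpn counting (\<lambda>i. f (i, t))"
        using c z t by (simp add: powr_mult ennreal_mult' Lpn_eq_Nm[OF t] vnorm_Lp_class)
      finally show ?thesis .
    qed
    have "Lpn P (kron_fun k f) \<le> (\<integral>\<^sup>+t. ennreal (?c powr p) * Lpn counting (\<lambda>i. f (i, t)) \<partial>\<mu>)"
      unfolding Lpn_P'(1)[OF m] by (rule nn_integral_mono_AE) (rule eventually_mono[OF ae le])
    also have "\<dots> = ennreal (?c powr p) * Lpn P f"
      unfolding Lpn_P'(1)[OF Lp_fun_measurable[OF f]]
      by (rule nn_integral_cmult[OF Lpn_P'(2)[OF Lp_fun_measurable[OF f]]])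
    finally show "Lpn P (kron_fun k f) \<le> ennreal (?c powr p) * Lpn P f" .
    {
      fix a
      show "AE y in P. kron_fun k (\<lambda>x. a * f x) y = a * kron_fun k f y"
        unfolding AE_P'
      proof (rule eventually_mono[OF ae], intro allI impI)
        fix t and i :: nat assume "(\<lambda>i. f (i, t)) \<in> Lp_fun p counting" "1 \<le> i"
        from suminf_mult[OF sums_summable[OF column_sums[OF k this]], of a]
        show "kron_fun k (\<lambda>x. a * f x) (i, t) = a * kron_fun k f (i, t)"
          by (simp add: kron_fun_def mult.assoc)
      qed
    next
      fix g assume g: "g \<in> Lp_fun p P"
      {
        assume "AE x in P. f x = g x"
        then show "AE y in P. kron_fun k f y = kron_fun k g y"
          unfolding AE_P' by (rule eventually_mono) (simp add: kron_fun_def)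
      }
      show "AE y in P. kron_fun k (\<lambda>x. f x + g x) y = kron_fun k f y + kron_fun k g y"
        unfolding AE_P'
      proof (rule eventually_mono[OF eventually_conj[OF ae AE_column_Lp_fun[OF g]]], intro allI impI)
        fix t and i :: nat
        assume t: "(\<lambda>i. f (i, t)) \<in> Lp_fun p counting \<and> (\<lambda>i. g (i, t)) \<in> Lp_fun p counting" and i: "1 \<le> i"
        from suminf_add[OF sums_summable[OF column_sums[OF k conjunct1[OF t] i]]
            sums_summable[OF column_sums[OF k conjunct2[OF t] i]]]
        show "kron_fun k (\<lambda>x. f x + g x) (i, t) = kron_fun k f (i, t) + kron_fun k g (i, t)"
          by (simp add: kron_fun_def distrib_right)
      qed
    }
  qed (rule c)
qed

lemma kron_Lop [simp]: "k \<in> ell_ops \<Longrightarrow> kron k \<in> carr (Lop F F)"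
  unfolding kron_def by (rule Lp_lift_Lop[OF kron_liftable])

lemma norm_kron: "k \<in> ell_ops \<Longrightarrow>
    vnorm (Lop F F) (kron k) \<le> vnorm (Lop ell ell) k"
  unfolding kron_def by (rule Lp_lift_norm[OF kron_liftable])

lemma kron_tens:
  assumes k: "k \<in> ell_ops" and u: "u \<in> carr ell" and v: "v \<in> carr E"
  shows "kron k (tens u v) = tens (k u) v"
proof -
  have ku: "k u \<in> carr ell" by (rule ellell.Lop_closed[OF k u])
  have f: "(\<lambda>(s, t). rep u s * rep v t) \<in> Lp_fun p P" using u v by (intro product_Lp_fun) auto
  have "kron k (tens u v) = Lp_class p P (kron_fun k (\<lambda>(s, t). rep u s * rep v t))"
    unfolding tens_def kron_def by (rule Lp_lift_class[OF kron_liftable[OF k] f])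
  also have "\<dots> = tens (k u) v"
    unfolding tens_def
  proof (subst Lp_class_eq_iff)
    show "kron_fun k (\<lambda>(s, t). rep u s * rep v t) \<in> Lp_fun p P"
      by (rule Lp_liftable_bound(1)[OF kron_liftable[OF k] f])
    show "(\<lambda>(s, t). rep (k u) s * rep v t) \<in> Lp_fun p P"
      using ku v by (intro product_Lp_fun) auto
    have "kron_fun k (\<lambda>(s, t). rep u s * rep v t) (i, t) = rep (k u) i * rep v t" if "1 \<le> i" for i t
      using sums_mult2[OF matrix_sums[OF k u that], of "rep v t"]
      by (simp add: kron_fun_def sums_iff mult_ac)
    then show "AE x in P. kron_fun k (\<lambda>(s, t). rep u s * rep v t) x = (case x of (s, t) \<Rightarrow> rep (k u) s * rep v t)"
      unfolding AE_P by simp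
  qed
  finally show ?thesis .
qed

text \<open>Representatives are chosen separately in each slice. With countably many slices this
  harms neither measurability nor identities almost everywhere.\<close>

definition amp_fun :: "('a, 'a) Lp_op \<Rightarrow> (nat \<times> 'a \<Rightarrow> complex) \<Rightarrow> nat \<times> 'a \<Rightarrow> complex" where
  "amp_fun a f = (\<lambda>(j, t). rep (a (Lp_class p \<mu> (\<lambda>t. f (j, t)))) t)"

definition amp :: "('a, 'a) Lp_op \<Rightarrow> (nat \<times> 'a, nat \<times> 'a) Lp_op" where
  "amp a = Lp_lift P P (amp_fun a)"

lemma amp_liftable:
  assumes a: "a \<in> carr (Lop E E)"
  shows "Lp_liftable P P (amp_fun a) (vnorm (Lop E E) a)"
proof -
  let ?c = "vnorm (Lop E E) a"
  have c: "0 \<le> ?c" by (rule pEE.opnorm_nonneg[OF a])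
  have ac: "a (Lp_class p \<mu> f) \<in> carr E" if "f \<in> Lp_fun p \<mu>" for f
    using pEE.Lop_closed[OF a] that by simp
  show ?thesis
    unfolding Lp_liftable_def
  proof (intro conjI ballI allI impI)
    fix f assume f: "f \<in> Lp_fun p P"
    have sl: "(\<lambda>t. f (j, t)) \<in> Lp_fun p \<mu>" if "1 \<le> j" for j by (rule slice_Lp_fun[OF f that])
    show m: "amp_fun a f \<in> borel_measurable P"
      unfolding amp_fun_def
      by (rule pair_measurableI) (use ac[OF sl] in \<open>auto intro: Lp_fun_measurable\<close>)
    have "Lpn \<mu> (\<lambda>t. amp_fun a f (Suc j, t)) \<le> ennreal (?c powr p) * Lpn \<mu> (\<lambda>t. f (Suc j, t))" for j
    proof -
      have s: "(\<lambda>t. f (Suc j, t)) \<in> Lp_fun p \<mu>" by (rule sl) simp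
      let ?z = "Lp_class p \<mu> (\<lambda>t. f (Suc j, t))"
      have z: "?z \<in> carr E" using s by simp
      have "Lpn \<mu> (\<lambda>t. amp_fun a f (Suc j, t)) = ennreal (vnorm E (a ?z) powr p)"
        using ac[OF s] by (simp add: amp_fun_def Lpn_eq_Nm vnorm_Lp)
      also have "\<dots> \<le> ennreal ((?c * vnorm E ?z) powr p)"
        using pEE.norm_le_opnorm[OF a z] ac[OF s] p_pos by (intro ennreal_leI powr_mono2) auto
      also have "\<dots> = ennreal (?c powr p) * Lpn \<mu> (\<lambda>t. f (Suc j, t))"
        using c z s by (simp add: powr_mult ennreal_mult' Lpn_eq_Nm[OF s] vnorm_Lp_class)
      finally show ?thesis .
    qed
    then have "Lpn P (amp_fun a f) \<le> (\<Sum>j. ennreal (?c powr p) * Lpn \<mu> (\<lambda>t. f (Suc j, t)))"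
      unfolding Lpn_P[OF m] by (intro suminf_le) auto
    then show "Lpn P (amp_fun a f) \<le> ennreal (?c powr p) * Lpn P f"
      by (simp add: Lpn_P[OF Lp_fun_measurable[OF f]])
    {
      fix b
      show "AE y in P. amp_fun a (\<lambda>x. b * f x) y = b * amp_fun a f y"
        unfolding AE_P
      proof (intro allI impI)
        fix j :: nat assume j: "1 \<le> j"
        \<comment> \<open>Linearity of \<open>a\<close> is an identity between classes; once the
          right-hand side is written as the class of a function, it can be read off pointwise almost
          everywhere.\<close>
        have "a (Lp_class p \<mu> (\<lambda>t. b * f (j, t))) = Lp_class p \<mu> (\<lambda>t. b * rep (a (Lp_class p \<mu> (\<lambda>t. f (j, t)))) t)"
          using pEE.Lop_scale[OF a Lp_class_carr[OF sl[OF j]], of b] sl[OF j]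
          by (simp add: vscale_Lp_class) (simp add: vscale_Lp)
        then show "AE t in \<mu>. amp_fun a (\<lambda>x. b * f x) (j, t) = b * amp_fun a f (j, t)"
          using rep_Lp_class(2)[OF Lp_fun_cmult(1)[OF rep_Lp_fun[OF ac[OF sl[OF j]]], of b]]
          by (simp add: amp_fun_def)
      qed
    next
      fix g assume g: "g \<in> Lp_fun p P"
      have sg: "(\<lambda>t. g (j, t)) \<in> Lp_fun p \<mu>" if "1 \<le> j" for j by (rule slice_Lp_fun[OF g that])
      {
        assume "AE x in P. f x = g x"
        then show "AE y in P. amp_fun a f y = amp_fun a g y"
          unfolding AE_P
        proof (intro allI impI)
          fix j :: nat assume j: "1 \<le> j" and "\<forall>i\<ge>1. AE t in \<mu>. f (i, t) = g (i, t)"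
          then have "Lp_class p \<mu> (\<lambda>t. f (j, t)) = Lp_class p \<mu> (\<lambda>t. g (j, t))"
            by (simp add: Lp_class_eq_iff sl[OF j] sg[OF j])
          then show "AE t in \<mu>. amp_fun a f (j, t) = amp_fun a g (j, t)"
            by (simp add: amp_fun_def)
        qed
      }
      show "AE y in P. amp_fun a (\<lambda>x. f x + g x) y = amp_fun a f y + amp_fun a g y"
        unfolding AE_P
      proof (intro allI impI)
        fix j :: nat assume j: "1 \<le> j"
        have "a (Lp_class p \<mu> (\<lambda>t. f (j, t) + g (j, t)))
            = Lp_class p \<mu> (\<lambda>t. rep (a (Lp_class p \<mu> (\<lambda>t. f (j, t)))) t + rep (a (Lp_class p \<mu> (\<lambda>t. g (j, t)))) t)"
          using pEE.Lop_add[OF a Lp_class_carr[OF sl[OF j]] Lp_class_carr[OF sg[OF j]]] sl[OF j] sg[OF j]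
          by (simp add: vadd_Lp_class) (simp add: vadd_Lp)
        then show "AE t in \<mu>. amp_fun a (\<lambda>x. f x + g x) (j, t) = amp_fun a f (j, t) + amp_fun a g (j, t)"
          using rep_Lp_class(2)[OF Lp_fun_add[OF rep_Lp_fun[OF ac[OF sl[OF j]]] rep_Lp_fun[OF ac[OF sg[OF j]]]]]
          by (simp add: amp_fun_def)
      qed
    }
  qed (rule c)
qed

lemma amp_Lop [simp]: "a \<in> carr (Lop E E) \<Longrightarrow> amp a \<in> carr (Lop F F)"
  unfolding amp_def by (rule Lp_lift_Lop[OF amp_liftable])

lemma norm_amp: "a \<in> carr (Lop E E) \<Longrightarrow> vnorm (Lop F F) (amp a) \<le> vnorm (Lop E E) a"
  unfolding amp_def by (rule Lp_lift_norm[OF amp_liftable])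

lemma amp_tens:
  assumes a: "a \<in> carr (Lop E E)" and u: "u \<in> carr ell" and v: "v \<in> carr E"
  shows "amp a (tens u v) = tens u (a v)"
proof -
  have av: "a v \<in> carr E" by (rule pEE.Lop_closed[OF a v])
  have f: "(\<lambda>(s, t). rep u s * rep v t) \<in> Lp_fun p P" using u v by (intro product_Lp_fun) auto
  have "amp a (tens u v) = Lp_class p P (amp_fun a (\<lambda>(s, t). rep u s * rep v t))"
    unfolding tens_def amp_def by (rule Lp_lift_class[OF amp_liftable[OF a] f])
  also have "\<dots> = tens u (a v)"
    unfolding tens_def
  proof (subst Lp_class_eq_iff)
    show "amp_fun a (\<lambda>(s, t). rep u s * rep v t) \<in> Lp_fun p P"
      by (rule Lp_liftable_bound(1)[OF amp_liftable[OF a] f])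
    show "(\<lambda>(s, t). rep u s * rep (a v) t) \<in> Lp_fun p P"
      using u av by (intro product_Lp_fun) auto
    have "AE t in \<mu>. amp_fun a (\<lambda>(s, t). rep u s * rep v t) (i, t) = rep u i * rep (a v) t" for i
    proof -
      have "Lp_class p \<mu> (\<lambda>t. rep u i * rep v t) = vscale E (rep u i) v"
        by (simp add: vscale_Lp)
      then have "a (Lp_class p \<mu> (\<lambda>t. rep u i * rep v t)) = Lp_class p \<mu> (\<lambda>t. rep u i * rep (a v) t)"
        using pEE.Lop_scale[OF a v] by (simp add: vscale_Lp)
      then show ?thesis
        using rep_Lp_class(2)[OF Lp_fun_cmult(1)[OF rep_Lp_fun[OF av], of "rep u i"]]
        by (simp add: amp_fun_def)
    qed
    then show "AE x in P. amp_fun a (\<lambda>(s, t). rep u s * rep v t) x = (case x of (s, t) \<Rightarrow> rep u s * rep (a v) t)"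
      unfolding AE_P by simp
  qed
  finally show ?thesis .
qed

definition slice :: "(nat \<times> 'a, 'a) Lp_op" where
  "slice = Lp_lift P \<mu> (\<lambda>f t. f (1, t))"

lemma slice_liftable: "Lp_liftable P \<mu> (\<lambda>f t. f (1, t)) 1"
  unfolding Lp_liftable_def AE_P
  by (auto intro!: slice_measurable[OF Lp_fun_measurable, unfolded One_nat_def]
      slice_Lpn_le[OF Lp_fun_measurable, unfolded One_nat_def])

lemma slice_Lop [simp]: "slice \<in> carr (Lop F E)"
  unfolding slice_def by (rule Lp_lift_Lop[OF slice_liftable])

lemma slice_tens:
  assumes u: "u \<in> carr ell" and v: "v \<in> carr E"
  shows "slice (tens u v) = vscale E (rep u 1) v"
  using Lp_lift_class[OF slice_liftable product_Lp_fun, of "rep u" "rep v"] u v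
  by (simp add: slice_def tens_def vscale_Lp)

text \<open>The restriction of \<open>w\<close> to its first \<open>n\<close> slices is a finite sum
  of tensors of a unit vector with a slice, and the rest tends to 0 in norm.\<close>

lemma closed_span_tens: "closed_span F {tens u v | u v. u \<in> carr ell \<and> v \<in> carr E} = carr F"
  (is "closed_span F ?S = _")
proof
  have S: "?S \<subseteq> carr F" by auto
  have cs: "closed_subspace F (closed_span F ?S)" and sup: "?S \<subseteq> closed_span F ?S"
    by (rule F.closed_subspace_closed_span[OF S], rule F.closed_span_superset[OF S])
  have lin: "linear_subspace F (closed_span F ?S)" using cs by (simp add: closed_subspace_def)
  then show "closed_span F ?S \<subseteq> carr F" by (rule F.subset_carr)
  show "carr F \<subseteq> closed_span F ?S"
  proof
    fix w assume w: "w \<in> carr F"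
    let ?g = "\<lambda>n x. if fst x \<le> n then rep w x else 0"
    have wm: "rep w \<in> Lp_fun p P" using w by simp
    have gm: "?g n \<in> Lp_fun p P" for n
    proof (rule Lp_funI)
      show "?g n \<in> borel_measurable P"
      proof (rule pair_measurableI)
        fix i :: nat assume "1 \<le> i"
        then show "(\<lambda>t. ?g n (i, t)) \<in> borel_measurable \<mu>"
          using slice_measurable[OF Lp_fun_measurable[OF wm]] by (cases "i \<le> n") simp_all
      qed
      show "Lpn P (?g n) \<le> ennreal (Nm P (rep w) powr p)"
        unfolding Lpn_eq_Nm[OF wm, symmetric] Lpn_def by (auto intro!: nn_integral_mono)
    qed
    have sl: "(\<lambda>t. rep w (Suc n, t)) \<in> Lp_fun p \<mu>" for n by (rule slice_Lp_fun[OF wm]) simp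
    have mem: "Lp_class p P (?g n) \<in> closed_span F ?S" for n
    proof (induction n)
      case 0
      have "Lp_class p P (?g 0) = vzero F"
        unfolding vzero_Lp by (subst Lp_class_eq_iff) (use gm[of 0] in \<open>auto simp: Lp_fun_zero AE_P\<close>)
      then show ?case using lin by (simp add: linear_subspace_def)
    next
      case (Suc n)
      let ?v = "Lp_class p \<mu> (\<lambda>t. rep w (Suc n, t))"
      have t: "tens (unit_vec (Suc n)) ?v
          = Lp_class p P (\<lambda>(s, t). (if s = Suc n then 1 else 0) * rep w (Suc n, t))"
        unfolding unit_vec_def by (rule tens_class[OF unit_vec_fun sl])
      have h: "(\<lambda>(s, t). (if s = Suc n then 1 else 0) * rep w (Suc n, t)) \<in> Lp_fun p P"
        by (rule product_Lp_fun[OF unit_vec_fun sl])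
      have "Lp_class p P (?g (Suc n)) = vadd F (Lp_class p P (?g n)) (tens (unit_vec (Suc n)) ?v)"
        unfolding t vadd_Lp_class[OF gm h]
        by (subst Lp_class_eq_iff[OF gm Lp_fun_add[OF gm h]]) (auto simp: AE_P le_Suc_eq)
      moreover have "tens (unit_vec (Suc n)) ?v \<in> closed_span F ?S"
        using sup sl by fastforce
      ultimately show ?case using Suc lin by (simp add: linear_subspace_def)
    qed
    \<comment> \<open>The complementary part of \<open>w\<close>, up to sign; the factor
      \<open>space \<mu>\<close> makes the index set measurable and changes nothing on the space of
      the product.\<close>
    let ?h = "\<lambda>n x. if x \<in> {n<..} \<times> space \<mu> then rep w x else 0"
    have "vdiff F (Lp_class p P (?g n)) w = Lp_class p P (\<lambda>x. ?g n x - rep w x)" for n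
      using vdiff_Lp_class[OF gm wm] w by simp
    moreover have "Nm P (\<lambda>x. ?g n x - rep w x) = Nm P (?h n)" for n
      unfolding Nm_def by (intro arg_cong2[where f = "(powr)"] Bochner_Integration.integral_cong)
        (auto simp: space_pair_measure)
    ultimately have "vnorm F (vdiff F (Lp_class p P (?g n)) w) = Nm P (?h n)" for n
      using gm wm by (simp add: vnorm_Lp_class Lp_fun_diff)
    moreover have "(\<lambda>n. Nm P (?h n)) \<longlonglongrightarrow> 0"
    proof (rule Nm_truncate_tendsto[OF wm])
      show "{n<..} \<times> space \<mu> \<in> sets P" for n by (intro pair_measureI) (auto simp: counting_def)
      show "\<forall>\<^sub>F n in sequentially. x \<notin> {n<..} \<times> space \<mu>" for x :: "nat \<times> 'a"
        by (rule eventually_sequentiallyI[of "fst x"]) auto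
    qed
    ultimately have "vlim F (\<lambda>n. Lp_class p P (?g n)) w sequentially" by (simp add: vlim_def)
    then show "w \<in> closed_span F ?S"
      by (rule F.closed_subspace_vlim[OF cs _ _ mem w]) simp
  qed
qed

text \<open>This supplies the uniqueness hidden in \<open>op_tensor\<close> when the source is the
  product, and it reduces operator identities there to elementary tensors.\<close>

lemma Lop_eq_on_tens:
  assumes "cnspace H" and S: "S \<in> carr (Lop F H)" and T: "T \<in> carr (Lop F H)"
    and eq: "\<And>u v. u \<in> carr ell \<Longrightarrow> v \<in> carr E \<Longrightarrow> S (tens u v) = T (tens u v)"
  shows "S = T"
proof -
  interpret H: cnspace H by fact
  interpret FH: cnspace_pair F H ..
  show ?thesis
  proof (rule FH.Lop_ext[OF S T])
    fix w assume "w \<in> carr F"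
    then have "w \<in> closed_span F {tens u v | u v. u \<in> carr ell \<and> v \<in> carr E}"
      by (simp add: closed_span_tens)
    then show "S w = T w"
      by (rule F.closed_span_induct[OF _ _ FH.closed_subspace_equalizer[OF S T]]) (use eq in auto)
  qed
qed

end

section \<open>The standard module\<close>

text \<open>The difference splits into \<open>\<beta> (x i) (y i - m)\<close> and
  \<open>\<beta> (x i - l) m\<close>; the bound \<open>c\<close> on the \<open>x i\<close> controls
  the first part.\<close>

lemma vlim_bilinear:
  assumes "cnspace U" "cnspace V" "cnspace W"
    and closed: "\<And>u v. u \<in> carr U \<Longrightarrow> v \<in> carr V \<Longrightarrow> \<beta> u v \<in> carr W"
    and diff_left: "\<And>u u' v. u \<in> carr U \<Longrightarrow> u' \<in> carr U \<Longrightarrow> v \<in> carr V \<Longrightarrow>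
      \<beta> (vdiff U u u') v = vdiff W (\<beta> u v) (\<beta> u' v)"
    and diff_right: "\<And>u v v'. u \<in> carr U \<Longrightarrow> v \<in> carr V \<Longrightarrow> v' \<in> carr V \<Longrightarrow>
      \<beta> u (vdiff V v v') = vdiff W (\<beta> u v) (\<beta> u v')"
    and bound: "\<And>u v. u \<in> carr U \<Longrightarrow> v \<in> carr V \<Longrightarrow> vnorm W (\<beta> u v) \<le> vnorm U u * vnorm V v"
    and x: "vlim U x l G" "\<And>i. x i \<in> carr U" "l \<in> carr U" "\<And>i. vnorm U (x i) \<le> c"
    and y: "vlim V y m G" "\<And>i. y i \<in> carr V" "m \<in> carr V"
  shows "vlim W (\<lambda>i. \<beta> (x i) (y i)) (\<beta> l m) G"
proof -
  interpret U: cnspace U by fact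
  interpret V: cnspace V by fact
  interpret W: cnspace W by fact
  show ?thesis
  proof (rule W.vlim_bound)
    show "((\<lambda>i. c * vnorm V (vdiff V (y i) m) + vnorm U (vdiff U (x i) l) * vnorm V m) \<longlongrightarrow> 0) G"
      using tendsto_add[OF tendsto_mult[OF tendsto_const[of c] y(1)[unfolded vlim_def]]
          tendsto_mult[OF x(1)[unfolded vlim_def] tendsto_const[of "vnorm V m"]]] by simp
    show "\<forall>\<^sub>F i in G. vnorm W (vdiff W (\<beta> (x i) (y i)) (\<beta> l m))
        \<le> c * vnorm V (vdiff V (y i) m) + vnorm U (vdiff U (x i) l) * vnorm V m"
    proof (rule always_eventually, rule allI)
      fix i
      have "vnorm W (vdiff W (\<beta> (x i) (y i)) (\<beta> (x i) m)) \<le> c * vnorm V (vdiff V (y i) m)"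
        using bound[of "x i" "vdiff V (y i) m"] x y
          mult_right_mono[OF x(4)[of i], of "vnorm V (vdiff V (y i) m)"]
        by (force simp: diff_right)
      moreover have "vnorm W (vdiff W (\<beta> (x i) m) (\<beta> l m)) \<le> vnorm U (vdiff U (x i) l) * vnorm V m"
        using bound[of "vdiff U (x i) l" m] x y by (simp add: diff_left)
      ultimately show "vnorm W (vdiff W (\<beta> (x i) (y i)) (\<beta> l m))
          \<le> c * vnorm V (vdiff V (y i) m) + vnorm U (vdiff U (x i) l) * vnorm V m"
        using W.norm_diff_triangle[of "\<beta> (x i) (y i)" "\<beta> (x i) m" "\<beta> l m"] x y closed by force
    qed
  qed (use x y closed in auto)
qed

lemma vlim_fst: "vlim E x l G \<Longrightarrow> vlim E (\<lambda>z. x (fst z)) l (G \<times>\<^sub>F H)"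
  unfolding vlim_def by (rule filterlim_compose[OF _ filterlim_fst])

lemma vlim_snd: "vlim E x l H \<Longrightarrow> vlim E (\<lambda>z. x (snd z)) l (G \<times>\<^sub>F H)"
  unfolding vlim_def by (rule filterlim_compose[OF _ filterlim_snd])

context cnspace_triple
begin

text \<open>Density is used in one factor at a time: with a generator \<open>s\<close> fixed the
  right factor runs through its closed span, then with \<open>y\<close> fixed the left one
  does.\<close>

lemma compose_closed_span:
  assumes S: "S \<subseteq> carr (Lop F H)" and T: "T \<subseteq> carr (Lop E F)" and W: "closed_subspace (Lop E H) W"
    and gen: "\<And>s t. s \<in> S \<Longrightarrow> t \<in> T \<Longrightarrow> compose (carr E) s t \<in> W"
    and x: "x \<in> closed_span (Lop F H) S" and y: "y \<in> closed_span (Lop E F) T"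
  shows "compose (carr E) x y \<in> W"
proof -
  interpret LFH: cnspace "Lop F H" by (rule FH.cnspace_Lop)
  interpret LEF: cnspace "Lop E F" by (rule EF.cnspace_Lop)
  interpret LEH: cnspace "Lop E H" by (rule EH.cnspace_Lop)
  interpret l: cnspace_pair "Lop E F" "Lop E H" ..
  interpret r: cnspace_pair "Lop F H" "Lop E H" ..
  have yc: "y \<in> carr (Lop E F)"
    using y LEF.closed_subspace_closed_span[OF T] LEF.subset_carr by (auto simp: closed_subspace_def)
  have s: "compose (carr E) s y \<in> W" if "s \<in> S" for s
  proof -
    have sc: "s \<in> carr (Lop F H)" using that S by blast
    have eq: "{t \<in> carr (Lop E F). compose (carr E) s t \<in> W}
        = {t \<in> carr (Lop E F). (\<lambda>t\<in>carr (Lop E F). compose (carr E) s t) t \<in> W}" by auto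
    have "closed_subspace (Lop E F) {t \<in> carr (Lop E F). compose (carr E) s t \<in> W}"
      unfolding eq by (rule l.closed_subspace_vimage[OF compose_left_Lop[OF sc] W])
    then show ?thesis
      by (rule LEF.closed_span_induct[OF y T]) (rule gen[OF that])
  qed
  have eq: "{s \<in> carr (Lop F H). compose (carr E) s y \<in> W}
      = {s \<in> carr (Lop F H). (\<lambda>s\<in>carr (Lop F H). compose (carr E) s y) s \<in> W}" by auto
  have "closed_subspace (Lop F H) {s \<in> carr (Lop F H). compose (carr E) s y \<in> W}"
    unfolding eq by (rule r.closed_subspace_vimage[OF compose_right_Lop[OF yc] W])
  then show ?thesis
    by (rule LFH.closed_span_induct[OF x S]) (rule s)
qed

lemma compose_left_closed_span:
  assumes s: "s \<in> carr (Lop F H)" and T: "T \<subseteq> carr (Lop E F)" and W: "closed_subspace (Lop E H) W"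
    and gen: "\<And>t. t \<in> T \<Longrightarrow> compose (carr E) s t \<in> W"
    and y: "y \<in> closed_span (Lop E F) T"
  shows "compose (carr E) s y \<in> W"
proof -
  interpret LFH: cnspace "Lop F H" by (rule FH.cnspace_Lop)
  show ?thesis
    by (rule compose_closed_span[OF _ T W _ _ y, of "{s}"])
      (use s gen LFH.closed_span_superset[of "{s}"] in auto)
qed

lemma compose_right_closed_span:
  assumes S: "S \<subseteq> carr (Lop F H)" and t: "t \<in> carr (Lop E F)" and W: "closed_subspace (Lop E H) W"
    and gen: "\<And>s. s \<in> S \<Longrightarrow> compose (carr E) s t \<in> W"
    and x: "x \<in> closed_span (Lop F H) S"
  shows "compose (carr E) x t \<in> W"
proof -
  interpret LEF: cnspace "Lop E F" by (rule EF.cnspace_Lop)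
  show ?thesis
    by (rule compose_closed_span[OF S _ W _ x, of "{t}"])
      (use t gen LEF.closed_span_superset[of "{t}"] in auto)
qed

lemma vlim_compose_left:
  assumes "vlim (Lop E F) T S G" "\<And>i. T i \<in> carr (Lop E F)" "S \<in> carr (Lop E F)" "R \<in> carr (Lop F H)"
  shows "vlim (Lop E H) (\<lambda>i. compose (carr E) R (T i)) (compose (carr E) R S) G"
proof -
  interpret l: cnspace_pair "Lop E F" "Lop E H"
    by (intro cnspace_pair.intro EF.cnspace_Lop EH.cnspace_Lop)
  show ?thesis using l.vlim_Lop[OF assms(1) compose_left_Lop[OF assms(4)] assms(2,3)] assms(2,3) by simp
qed

lemma vlim_compose_right:
  assumes "vlim (Lop F H) T S G" "\<And>i. T i \<in> carr (Lop F H)" "S \<in> carr (Lop F H)" "R \<in> carr (Lop E F)"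
  shows "vlim (Lop E H) (\<lambda>i. compose (carr E) (T i) R) (compose (carr E) S R) G"
proof -
  interpret r: cnspace_pair "Lop F H" "Lop E H"
    by (intro cnspace_pair.intro FH.cnspace_Lop EH.cnspace_Lop)
  show ?thesis using r.vlim_Lop[OF assms(1) compose_right_Lop[OF assms(4)] assms(2,3)] assms(2,3) by simp
qed

end

lemma op_tensor_eqI:
  assumes "t \<in> carr (Lop (tspace D) (tspace D'))"
    and "\<And>u v. u \<in> carr (lfactor D) \<Longrightarrow> v \<in> carr (rfactor D) \<Longrightarrow>
      t (tensor D u v) = tensor D' (a u) (b v)"
    and "\<And>s. s \<in> carr (Lop (tspace D) (tspace D')) \<Longrightarrow>
      (\<And>u v. u \<in> carr (lfactor D) \<Longrightarrow> v \<in> carr (rfactor D) \<Longrightarrow> s (tensor D u v) = t (tensor D u v)) \<Longrightarrow>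
      s = t"
  shows "op_tensor D D' a b = t"
  unfolding op_tensor_def
proof (rule the_equality)
  fix s assume s: "s \<in> carr (Lop (tspace D) (tspace D')) \<and>
    (\<forall>\<xi>\<in>carr (lfactor D). \<forall>\<eta>\<in>carr (rfactor D). s (tensor D \<xi> \<eta>) = tensor D' (a \<xi>) (b \<eta>))"
  show "s = t" by (rule assms(3)) (use s assms(2) in simp_all)
qed (use assms(1,2) in blast)

lemma tdecomp_simps [simp]:
  "lfactor (Lp_tdecomp p M N) = Lp p M" "rfactor (Lp_tdecomp p M N) = Lp p N"
  "tspace (Lp_tdecomp p M N) = Lp p (M \<Otimes>\<^sub>M N)"
  "lfactor (scalar_tdecomp H) = complex_space" "rfactor (scalar_tdecomp H) = H"
  "tspace (scalar_tdecomp H) = H" "tensor (scalar_tdecomp H) = vscale H"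
  by (simp_all add: Lp_tdecomp_def scalar_tdecomp_def)

section \<open>Explicit tensor operators and their products\<close>

context Lp_tensor
begin

definition col_tensor :: "(nat \<Rightarrow> complex) set \<Rightarrow> ('a, 'a) Lp_op \<Rightarrow> ('a, nat \<times> 'a) Lp_op" where
  "col_tensor z a = compose (carr E) (col z) a"

text \<open>\<open>\<phi>\<close> tensor \<open>b\<close> assembled from operators already at hand:
  the rank one operator writes \<open>\<phi> u\<close> into the first coordinate,
  \<open>slice\<close> reads that coordinate off, and \<open>b\<close> acts on the result.\<close>

definition row_tensor :: "((nat \<Rightarrow> complex) set \<Rightarrow> complex) \<Rightarrow> ('a, 'a) Lp_op \<Rightarrow> (nat \<times> 'a, 'a) Lp_op" where
  "row_tensor \<phi> b = compose (carr F) b (compose (carr F) slice (kron (rank_one (unit_vec 1) \<phi>)))"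

definition kron_tensor :: "((nat \<Rightarrow> complex) set \<Rightarrow> (nat \<Rightarrow> complex) set) \<Rightarrow> ('a, 'a) Lp_op
    \<Rightarrow> (nat \<times> 'a, nat \<times> 'a) Lp_op" where
  "kron_tensor k a = compose (carr F) (kron k) (amp a)"

lemma col_tensor_closed [simp]:
  "z \<in> carr ell \<Longrightarrow> a \<in> carr (Lop E E) \<Longrightarrow> col_tensor z a \<in> carr (Lop E F)"
  by (simp add: col_tensor_def)

lemma row_tensor_closed [simp]:
  "\<phi> \<in> ell_dual \<Longrightarrow> b \<in> carr (Lop E E) \<Longrightarrow> row_tensor \<phi> b \<in> carr (Lop F E)"
  by (simp add: row_tensor_def)

lemma kron_tensor_closed [simp]:
  "k \<in> ell_ops \<Longrightarrow> a \<in> carr (Lop E E) \<Longrightarrow> kron_tensor k a \<in> carr (Lop F F)"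
  by (simp add: kron_tensor_def)

lemma col_tensor_apply: "z \<in> carr ell \<Longrightarrow> a \<in> carr (Lop E E) \<Longrightarrow> v \<in> carr E \<Longrightarrow>
    col_tensor z a v = tens z (a v)"
  by (simp add: col_tensor_def compose_eq col_apply)

lemma rank_one_apply: "u \<in> carr ell \<Longrightarrow> rank_one z \<phi> u = vscale ell (\<phi> u) z"
  by (simp add: rank_one_def)

lemma row_tensor_tens: "\<phi> \<in> ell_dual \<Longrightarrow> b \<in> carr (Lop E E) \<Longrightarrow>
    u \<in> carr ell \<Longrightarrow> v \<in> carr E \<Longrightarrow> row_tensor \<phi> b (tens u v) = vscale E (\<phi> u) (b v)"
  by (simp add: row_tensor_def compose_eq kron_tens rank_one_apply slice_tens ellp_scale pEE.Lop_scale
      flip: One_nat_def)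

lemma kron_tensor_tens: "k \<in> ell_ops \<Longrightarrow> a \<in> carr (Lop E E) \<Longrightarrow>
    u \<in> carr ell \<Longrightarrow> v \<in> carr E \<Longrightarrow> kron_tensor k a (tens u v) = tens (k u) (a v)"
  by (simp add: kron_tensor_def compose_eq kron_tens amp_tens)

lemma op_tensor_column:
  assumes z: "z \<in> carr ell" and a: "a \<in> carr (Lop E E)"
  shows "op_tensor (scalar_tdecomp E) (Lp_tdecomp p counting \<mu>) (column_op p z) a = col_tensor z a"
proof (rule op_tensor_eqI)
  show "col_tensor z a \<in> carr (Lop (tspace (scalar_tdecomp E)) (tspace (Lp_tdecomp p counting \<mu>)))"
    using assms by simp
next
  fix c v assume "c \<in> carr (lfactor (scalar_tdecomp E))" "v \<in> carr (rfactor (scalar_tdecomp E))"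
  then show "col_tensor z a (tensor (scalar_tdecomp E) c v) = tens (column_op p z c) (a v)"
    using assms by (simp add: col_tensor_apply column_op_def tens_scale_left tens_scale_right pEE.Lop_scale)
next
  fix s assume s: "s \<in> carr (Lop (tspace (scalar_tdecomp E)) (tspace (Lp_tdecomp p counting \<mu>)))"
    and eq: "\<And>c v. c \<in> carr (lfactor (scalar_tdecomp E)) \<Longrightarrow> v \<in> carr (rfactor (scalar_tdecomp E)) \<Longrightarrow>
      s (tensor (scalar_tdecomp E) c v) = col_tensor z a (tensor (scalar_tdecomp E) c v)"
  show "s = col_tensor z a"
  proof (rule pEF.Lop_ext)
    \<comment> \<open>Over the scalar factor, 1 tensor \<open>u\<close> is \<open>u\<close> itself,
      so uniqueness is immediate.\<close>
    show "s u = col_tensor z a u" if "u \<in> carr E" for u using eq[of 1 u] that by simp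
  qed (use s assms in auto)
qed

lemma op_tensor_row:
  assumes \<phi>: "\<phi> \<in> ell_dual" and b: "b \<in> carr (Lop E E)"
  shows "op_tensor (Lp_tdecomp p counting \<mu>) (scalar_tdecomp E) \<phi> b = row_tensor \<phi> b"
  by (rule op_tensor_eqI)
    (use assms in \<open>auto simp: row_tensor_tens intro: Lop_eq_on_tens[OF E.cnspace_axioms]\<close>)

lemma op_tensor_kron:
  assumes k: "k \<in> ell_ops" and a: "a \<in> carr (Lop E E)"
  shows "op_tensor (Lp_tdecomp p counting \<mu>) (Lp_tdecomp p counting \<mu>) k a = kron_tensor k a"
  by (rule op_tensor_eqI)
    (use assms in \<open>auto simp: kron_tensor_tens intro: Lop_eq_on_tens[OF F.cnspace_axioms]\<close>)

lemma column_row: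
  assumes "z \<in> carr ell" "\<phi> \<in> ell_dual" "a \<in> carr (Lop E E)" "b \<in> carr (Lop E E)"
  shows "compose (carr F) (col_tensor z a) (row_tensor \<phi> b)
    = kron_tensor (rank_one z \<phi>) (compose (carr E) a b)"
  by (rule Lop_eq_on_tens[OF F.cnspace_axioms])
    (use assms in \<open>auto simp: compose_eq row_tensor_tens col_tensor_apply kron_tensor_tens rank_one_apply
      tens_scale_left tens_scale_right pEE.Lop_scale\<close>)

lemma kron_column:
  assumes "k \<in> ell_ops" "z \<in> carr ell" "a \<in> carr (Lop E E)" "b \<in> carr (Lop E E)"
  shows "compose (carr E) (kron_tensor k a) (col_tensor z b) = col_tensor (k z) (compose (carr E) a b)"
  by (rule pEF.Lop_ext)
    (use assms in \<open>auto simp: compose_eq col_tensor_apply kron_tensor_tens\<close>)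

lemma row_kron:
  assumes "k \<in> ell_ops" "\<phi> \<in> ell_dual"
    "a \<in> carr (Lop E E)" "b \<in> carr (Lop E E)"
  shows "compose (carr F) (row_tensor \<phi> a) (kron_tensor k b)
    = row_tensor (compose (carr ell) \<phi> k) (compose (carr E) a b)"
  by (rule Lop_eq_on_tens[OF E.cnspace_axioms])
    (use assms in \<open>auto simp: compose_eq row_tensor_tens kron_tensor_tens ellellC.compose_closed\<close>)

lemma kron_kron:
  assumes "k \<in> ell_ops" "l \<in> ell_ops"
    "a \<in> carr (Lop E E)" "b \<in> carr (Lop E E)"
  shows "compose (carr F) (kron_tensor k a) (kron_tensor l b)
    = kron_tensor (compose (carr ell) k l) (compose (carr E) a b)"
  by (rule Lop_eq_on_tens[OF F.cnspace_axioms])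
    (use assms in \<open>auto simp: compose_eq kron_tensor_tens ell3.compose_closed\<close>)

lemma compose_rank_one:
  assumes "k \<in> ell_ops" "z \<in> carr ell" "\<phi> \<in> ell_dual"
  shows "compose (carr ell) k (rank_one z \<phi>) = rank_one (k z) \<phi>"
  by (rule ellell.Lop_ext)
    (use assms in \<open>auto simp: compose_eq rank_one_apply ellell.Lop_scale ell3.compose_closed\<close>)

lemma kron_tensor_norm:
  assumes "k \<in> ell_ops" "a \<in> carr (Lop E E)"
  shows "vnorm (Lop F F) (kron_tensor k a) \<le> vnorm (Lop ell ell) k * vnorm (Lop E E) a"
proof -
  have "vnorm (Lop F F) (kron_tensor k a) \<le> vnorm (Lop F F) (kron k) * vnorm (Lop F F) (amp a)"
    unfolding kron_tensor_def using assms by (intro FFF.compose_opnorm) auto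
  also have "\<dots> \<le> vnorm (Lop ell ell) k * vnorm (Lop E E) a"
    using assms by (intro mult_mono norm_kron norm_amp ellell.opnorm_nonneg pFF.opnorm_nonneg) auto
  finally show ?thesis .
qed

sublocale LE: cnspace "Lop E E" by (rule pEE.cnspace_Lop)
sublocale LF: cnspace "Lop F F" by (rule pFF.cnspace_Lop)
sublocale Lell: cnspace "Lop ell ell" by (rule ellell.cnspace_Lop)
sublocale LEF: cnspace "Lop E F" by (rule pEF.cnspace_Lop)
sublocale LFE: cnspace "Lop F E" by (rule pFE.cnspace_Lop)

lemma tens_diff_left: "u \<in> carr ell \<Longrightarrow> u' \<in> carr ell \<Longrightarrow> v \<in> carr E \<Longrightarrow>
    tens (vdiff ell u u') v = vdiff F (tens u v) (tens u' v)"
  by (simp add: vdiff_def tens_add_left tens_scale_left)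

lemma tens_diff_right: "u \<in> carr ell \<Longrightarrow> v \<in> carr E \<Longrightarrow> v' \<in> carr E \<Longrightarrow>
    tens u (vdiff E v v') = vdiff F (tens u v) (tens u v')"
  by (simp add: vdiff_def tens_add_right tens_scale_right)

lemma kron_tensor_add_left:
  assumes "k \<in> ell_ops" "l \<in> ell_ops" "a \<in> carr (Lop E E)"
  shows "kron_tensor (vadd (Lop ell ell) k l) a = vadd (Lop F F) (kron_tensor k a) (kron_tensor l a)"
proof (rule Lop_eq_on_tens[OF F.cnspace_axioms])
  fix u v assume "u \<in> carr ell" "v \<in> carr E"
  with assms show "kron_tensor (vadd (Lop ell ell) k l) a (tens u v)
      = vadd (Lop F F) (kron_tensor k a) (kron_tensor l a) (tens u v)"
    by (simp add: kron_tensor_tens Lop_simps(2)[of _ _ "kron_tensor _ _"])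
      (simp add: Lop_simps(2) tens_add_left)
qed (use assms in auto)

lemma kron_tensor_diff_left:
  assumes "k \<in> ell_ops" "l \<in> ell_ops" "a \<in> carr (Lop E E)"
  shows "kron_tensor (vdiff (Lop ell ell) k l) a = vdiff (Lop F F) (kron_tensor k a) (kron_tensor l a)"
  by (rule Lop_eq_on_tens[OF F.cnspace_axioms])
    (use assms in \<open>auto simp: kron_tensor_tens pFF.Lop_diff_apply ellell.Lop_diff_apply tens_diff_left\<close>)

lemma kron_tensor_diff_right:
  assumes "k \<in> ell_ops" "a \<in> carr (Lop E E)" "b \<in> carr (Lop E E)"
  shows "kron_tensor k (vdiff (Lop E E) a b) = vdiff (Lop F F) (kron_tensor k a) (kron_tensor k b)"
  by (rule Lop_eq_on_tens[OF F.cnspace_axioms])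
    (use assms in \<open>auto simp: kron_tensor_tens pFF.Lop_diff_apply pEE.Lop_diff_apply tens_diff_right\<close>)

lemma kron_tensor_zero_left:
  assumes "a \<in> carr (Lop E E)"
  shows "kron_tensor (vzero (Lop ell ell)) a = vzero (Lop F F)"
  using kron_tensor_diff_left[of "vzero (Lop ell ell)" "vzero (Lop ell ell)" a] assms
  by (simp add: ellell.Lop_zero_closed)

text \<open>By \<open>kron_tensor_norm\<close> the tensor of operators is a contractive bilinear
  map, so both factors may vary at once.\<close>

lemma vlim_kron_tensor:
  assumes "vlim (Lop ell ell) k l G" "\<And>i. k i \<in> ell_ops" "l \<in> ell_ops"
    "\<And>i. vnorm (Lop ell ell) (k i) \<le> c"
    "vlim (Lop E E) a b G" "\<And>i. a i \<in> carr (Lop E E)" "b \<in> carr (Lop E E)"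
  shows "vlim (Lop F F) (\<lambda>i. kron_tensor (k i) (a i)) (kron_tensor l b) G"
  by (rule vlim_bilinear[of "Lop ell ell" "Lop E E" "Lop F F" kron_tensor k l G c a b])
    (simp_all add: assms Lell.cnspace_axioms LE.cnspace_axioms LF.cnspace_axioms
      kron_tensor_diff_left kron_tensor_diff_right kron_tensor_norm)

lemma vlim_tens:
  assumes "vlim ell u w G" "\<And>i. u i \<in> carr ell" "w \<in> carr ell" "\<And>i. vnorm ell (u i) \<le> c"
    "vlim E v x G" "\<And>i. v i \<in> carr E" "x \<in> carr E"
  shows "vlim F (\<lambda>i. tens (u i) (v i)) (tens w x) G"
  by (rule vlim_bilinear[of ell E F tens u w G c v x])
    (simp_all add: assms ell.cnspace_axioms E.cnspace_axioms F.cnspace_axioms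
      tens_diff_left tens_diff_right tens_norm)

end

section \<open>The standard module and its operator algebras\<close>

locale standard_module = Lp_conjugate p q + Lp_tensor p \<mu>
  for p :: real and q :: ennreal and \<mu> :: "'a measure" +
  fixes A :: "('a, 'a) Lp_op set" and e :: "'i \<Rightarrow> ('a, 'a) Lp_op" and \<F> :: "'i filter"
  assumes algebra: "Lp_operator_algebra p \<mu> A"
    and approx: "contractive_approximate_identity (op_algebra E) A e \<F>"
begin

abbreviation "X \<equiv> ellp_tensor p \<mu> A"
abbreviation "Y \<equiv> ellq_tensor p q \<mu> A"
abbreviation "B \<equiv> compact_tensor p \<mu> A"
abbreviation "K \<equiv> module_compacts E F Y X"

lemma A_Lop [simp]: "a \<in> A \<Longrightarrow> a \<in> carr (Lop E E)"
  using algebra by (auto simp: Lp_operator_algebra_def closed_subalgebra_def linear_subspace_def)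

lemma A_mult: "a \<in> A \<Longrightarrow> b \<in> A \<Longrightarrow> compose (carr E) a b \<in> A"
  using algebra by (auto simp: Lp_operator_algebra_def closed_subalgebra_def)

lemma F_nontrivial: "\<F> \<noteq> bot"
  and e_mem: "e i \<in> A"
  and e_norm: "vnorm (Lop E E) (e i) \<le> 1"
  using approx by (auto simp: contractive_approximate_identity_def)

lemma e_right: "a \<in> A \<Longrightarrow> vlim (Lop E E) (\<lambda>i. compose (carr E) a (e i)) a \<F>"
  and e_left: "a \<in> A \<Longrightarrow> vlim (Lop E E) (\<lambda>i. compose (carr E) (e i) a) a \<F>"
  using approx by (auto simp: contractive_approximate_identity_def vlim_def vdiff_def)

definition "X_gens = {col_tensor z a | z a. z \<in> carr ell \<and> a \<in> A}"
definition "Y_gens = {row_tensor \<phi> a | \<phi> a. \<phi> \<in> ell_dual \<and> a \<in> A}"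
definition "B_gens = {kron_tensor k a | k a. k \<in> compact_operators ell \<and> a \<in> A}"
text \<open>A smaller generating set than \<open>B_gens\<close>, closed under the products needed
  below by the explicit formulas \<open>column_row\<close>, \<open>kron_column\<close>,
  \<open>row_kron\<close> and \<open>kron_kron\<close>.\<close>

definition "rank_one_gens = {kron_tensor (rank_one z \<phi>) a | z \<phi> a.
  z \<in> carr ell \<and> \<phi> \<in> ell_dual \<and> a \<in> A}"

lemma X_eq: "X = closed_span (Lop E F) X_gens"
proof -
  have "{op_tensor (scalar_tdecomp E) (Lp_tdecomp p counting \<mu>) v x | v x. v \<in> column_op p ` carr ell \<and> x \<in> A} = X_gens"
    unfolding X_gens_def by (force simp: op_tensor_column)
  then show ?thesis by (simp add: ellp_tensor_def space_tensor_def)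
qed

lemma Y_eq: "Y = closed_span (Lop F E) Y_gens"
proof -
  have "{op_tensor (Lp_tdecomp p counting \<mu>) (scalar_tdecomp E) v x | v x. v \<in> row_op p ` ellq q \<and> x \<in> A} = Y_gens"
    unfolding Y_gens_def row_op_image by (force simp: op_tensor_row)
  then show ?thesis by (simp add: ellq_tensor_def space_tensor_def)
qed

lemma B_eq: "B = closed_span (Lop F F) B_gens"
proof -
  have "{op_tensor (Lp_tdecomp p counting \<mu>) (Lp_tdecomp p counting \<mu>) v x | v x. v \<in> compact_operators ell \<and> x \<in> A} = B_gens"
    unfolding B_gens_def by (force simp: op_tensor_kron compact_operators_Lop)
  then show ?thesis by (simp add: compact_tensor_def space_tensor_def)
qed

lemma X_gens_Lop: "X_gens \<subseteq> carr (Lop E F)" and Y_gens_Lop: "Y_gens \<subseteq> carr (Lop F E)"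
  and B_gens_Lop: "B_gens \<subseteq> carr (Lop F F)" and rank_one_gens_Lop: "rank_one_gens \<subseteq> carr (Lop F F)"
  by (auto simp: X_gens_def Y_gens_def B_gens_def rank_one_gens_def compact_operators_Lop)

lemma closed_X: "closed_subspace (Lop E F) X"
  unfolding X_eq by (rule LEF.closed_subspace_closed_span[OF X_gens_Lop])
lemma closed_Y: "closed_subspace (Lop F E) Y"
  unfolding Y_eq by (rule LFE.closed_subspace_closed_span[OF Y_gens_Lop])
lemma closed_rank_one_gens: "closed_subspace (Lop F F) (closed_span (Lop F F) rank_one_gens)"
  by (rule LF.closed_subspace_closed_span[OF rank_one_gens_Lop])

lemma X_Lop [simp]: "x \<in> X \<Longrightarrow> x \<in> carr (Lop E F)"
  using closed_X LEF.subset_carr by (auto simp: closed_subspace_def)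
lemma Y_Lop [simp]: "y \<in> Y \<Longrightarrow> y \<in> carr (Lop F E)"
  using closed_Y LFE.subset_carr by (auto simp: closed_subspace_def)

lemma col_tensor_X: "z \<in> carr ell \<Longrightarrow> a \<in> A \<Longrightarrow> col_tensor z a \<in> X"
  unfolding X_eq using LEF.closed_span_superset[OF X_gens_Lop] by (auto simp: X_gens_def)
lemma row_tensor_Y: "\<phi> \<in> ell_dual \<Longrightarrow> a \<in> A \<Longrightarrow> row_tensor \<phi> a \<in> Y"
  unfolding Y_eq using LFE.closed_span_superset[OF Y_gens_Lop] by (auto simp: Y_gens_def)
lemma rank_one_rank_one_gens: "z \<in> carr ell \<Longrightarrow> \<phi> \<in> ell_dual \<Longrightarrow> a \<in> A \<Longrightarrow>
    kron_tensor (rank_one z \<phi>) a \<in> closed_span (Lop F F) rank_one_gens"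
  using LF.closed_span_superset[OF rank_one_gens_Lop] by (auto simp: rank_one_gens_def)

text \<open>Induction on \<open>n\<close> along \<open>compose_proj_Suc\<close>. Arbitrary bounded
  \<open>k\<close> are allowed, so that the identity can be inserted in \<open>u_B\<close>.\<close>

lemma kron_tensor_proj_rank_one_gens:
  assumes k: "k \<in> ell_ops" and a: "a \<in> A"
  shows "kron_tensor (compose (carr ell) (proj n) k) a \<in> closed_span (Lop F F) rank_one_gens"
proof (induction n)
  case 0
  then show ?case
    using closed_rank_one_gens a by (simp add: compose_proj_0[OF k] kron_tensor_zero_left closed_subspace_def linear_subspace_def)
next
  case (Suc n)
  have c: "compose (carr ell) (coord (Suc n)) k \<in> ell_dual"
    by (intro ellellC.compose_closed coord_Lop k) simp
  have "kron_tensor (rank_one (unit_vec (Suc n)) (compose (carr ell) (coord (Suc n)) k)) a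
      \<in> closed_span (Lop F F) rank_one_gens"
    by (rule rank_one_rank_one_gens[OF unit_vec_closed c a])
  then show ?case
    using Suc closed_rank_one_gens a k c
    by (simp add: compose_proj_Suc[OF k] kron_tensor_add_left ell3.compose_closed closed_subspace_def
        linear_subspace_def)
qed

lemma B_eq_rank_one_gens: "B = closed_span (Lop F F) rank_one_gens"
proof
  show "closed_span (Lop F F) rank_one_gens \<subseteq> B"
    unfolding B_eq using LF.closed_span_superset[OF B_gens_Lop] B_gens_Lop
    by (intro LF.closed_span_mono) (auto simp: rank_one_gens_def B_gens_def intro: rank_one_compact_operators)
  show "B \<subseteq> closed_span (Lop F F) rank_one_gens"
    unfolding B_eq
  proof (intro LF.closed_span_mono rank_one_gens_Lop subsetI)
    fix b assume "b \<in> B_gens"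
    then obtain k a where b: "b = kron_tensor k a" and kc: "k \<in> compact_operators ell" and a: "a \<in> A"
      by (auto simp: B_gens_def)
    have k: "k \<in> ell_ops" by (rule compact_operators_Lop[OF kc])
    have "vnorm (Lop ell ell) (compose (carr ell) (proj n) k) \<le> vnorm (Lop ell ell) k" for n
      using ell3.compose_opnorm[OF proj_Lop[of n] k]
        mult_right_mono[OF norm_proj[of n] ellell.opnorm_nonneg[OF k]] by simp
    \<comment> \<open>Compactness of \<open>k\<close> gives norm convergence of its truncations, and
      the tensor product carries it over.\<close>
    then have "vlim (Lop F F) (\<lambda>n. kron_tensor (compose (carr ell) (proj n) k) a) (kron_tensor k a) sequentially"
      by (intro vlim_kron_tensor[OF proj_vlim_compact[OF kc]])
        (use k a in \<open>auto simp: ell3.compose_closed LE.vlim_const\<close>)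
    then show "b \<in> closed_span (Lop F F) rank_one_gens"
      unfolding b
      by (rule LF.closed_subspace_vlim[OF closed_rank_one_gens _ _ kron_tensor_proj_rank_one_gens[OF k a]]) (use k a in auto)
  qed
qed

lemma closed_B: "closed_subspace (Lop F F) B"
  unfolding B_eq_rank_one_gens by (rule closed_rank_one_gens)

lemma B_Lop [simp]: "b \<in> B \<Longrightarrow> b \<in> carr (Lop F F)"
  using closed_B LF.subset_carr by (auto simp: closed_subspace_def)

lemma rank_one_B: "z \<in> carr ell \<Longrightarrow> \<phi> \<in> ell_dual \<Longrightarrow> a \<in> A \<Longrightarrow>
    kron_tensor (rank_one z \<phi>) a \<in> B"
  unfolding B_eq_rank_one_gens by (rule rank_one_rank_one_gens)

lemma XY_B: "x \<in> X \<Longrightarrow> y \<in> Y \<Longrightarrow> compose (carr F) x y \<in> B"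
  unfolding X_eq Y_eq
  by (rule FEF.compose_closed_span[OF X_gens_Lop Y_gens_Lop closed_B])
    (auto simp: X_gens_def Y_gens_def column_row A_mult rank_one_B)

text \<open>A rank one operator applied to a vector gives a multiple of its range vector, so a
  product of generators is a generator again.\<close>

lemma BX_X:
  assumes b: "b \<in> B" and x: "x \<in> X"
  shows "compose (carr E) b x \<in> X"
proof (rule EFF.compose_closed_span[OF rank_one_gens_Lop X_gens_Lop closed_X _ b[unfolded B_eq_rank_one_gens] x[unfolded X_eq]])
  fix s t assume "s \<in> rank_one_gens" "t \<in> X_gens"
  then show "compose (carr E) s t \<in> X"
    by (auto simp: rank_one_gens_def X_gens_def kron_column A_mult rank_one_apply intro!: col_tensor_X)
qed

text \<open>A functional composed with an operator on \<open>l^p\<close> is a functional, so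
  generators multiply into generators.\<close>

lemma YB_Y:
  assumes y: "y \<in> Y" and b: "b \<in> B"
  shows "compose (carr F) y b \<in> Y"
proof (rule FFE.compose_closed_span[OF Y_gens_Lop rank_one_gens_Lop closed_Y _ y[unfolded Y_eq] b[unfolded B_eq_rank_one_gens]])
  fix s t assume "s \<in> Y_gens" "t \<in> rank_one_gens"
  then show "compose (carr F) s t \<in> Y"
    by (auto simp: rank_one_gens_def Y_gens_def row_kron A_mult intro!: row_tensor_Y ellellC.compose_closed)
qed

lemma BB_B:
  assumes b: "b \<in> B" and c: "c \<in> B"
  shows "compose (carr F) b c \<in> B"
proof (rule FFF.compose_closed_span[OF rank_one_gens_Lop rank_one_gens_Lop closed_B _ b[unfolded B_eq_rank_one_gens] c[unfolded B_eq_rank_one_gens]])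
  fix s t assume "s \<in> rank_one_gens" "t \<in> rank_one_gens"
  then show "compose (carr F) s t \<in> B"
    by (auto simp: rank_one_gens_def kron_kron A_mult compose_rank_one rank_one_apply intro!: rank_one_B)
qed

definition "compacts_gens = {compose (carr F) x y | x y. x \<in> X \<and> y \<in> Y}"

lemma K_eq: "K = closed_span (Lop F F) compacts_gens"
  by (simp add: module_compacts_def compacts_gens_def)

lemma compacts_gens_Lop: "compacts_gens \<subseteq> carr (Lop F F)"
  by (auto simp: compacts_gens_def)

lemma compacts_eq: "K = B"
proof
  show "K \<subseteq> B"
    unfolding K_eq by (rule LF.closed_span_minimal[OF closed_B]) (auto simp: compacts_gens_def XY_B)
  have cK: "closed_subspace (Lop F F) K"
    unfolding K_eq by (rule LF.closed_subspace_closed_span[OF compacts_gens_Lop])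
  show "B \<subseteq> K"
    unfolding B_eq_rank_one_gens
  proof (rule LF.closed_span_minimal[OF cK], rule subsetI)
    fix b assume "b \<in> rank_one_gens"
    then obtain z \<phi> a where b: "b = kron_tensor (rank_one z \<phi>) a"
        and m: "z \<in> carr ell" "\<phi> \<in> ell_dual" "a \<in> A"
      by (auto simp: rank_one_gens_def)
    \<comment> \<open>A generator with coefficient \<open>a\<close> need not be a product itself;
      with coefficient \<open>a\<close> times \<open>e i\<close> it is, and the right unit property
      of \<open>e\<close> in \<open>A\<close> recovers \<open>a\<close> in the limit.\<close>
    have "compose (carr F) (col_tensor z a) (row_tensor \<phi> (e i)) \<in> K" for i
      unfolding K_eq using LF.closed_span_superset[OF compacts_gens_Lop] col_tensor_X[OF m(1,3)]
        row_tensor_Y[OF m(2) e_mem[of i]] by (auto simp: compacts_gens_def)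
    then have mem: "kron_tensor (rank_one z \<phi>) (compose (carr E) a (e i)) \<in> K" for i
      using m e_mem by (simp add: column_row)
    have "vlim (Lop F F) (\<lambda>i. kron_tensor (rank_one z \<phi>) (compose (carr E) a (e i)))
        (kron_tensor (rank_one z \<phi>) a) \<F>"
      by (rule vlim_kron_tensor[OF _ _ _ order_refl e_right[OF m(3)]])
        (use m e_mem in \<open>auto simp: Lell.vlim_const\<close>)
    then show "b \<in> K"
      unfolding b by (rule LF.closed_subspace_vlim[OF cK _ F_nontrivial mem]) (use m in auto)
  qed
qed

lemma adjointables_eq: "module_adjointables E F Y X = spatial_multipliers F B"
proof
  show "module_adjointables E F Y X \<subseteq> spatial_multipliers F B"
  proof
    fix t assume "t \<in> module_adjointables E F Y X"
    \<comment> \<open>The defining condition quantifies over \<open>x\<close> and \<open>y\<close>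
      jointly, so each half is available only in the presence of both; the generators
      \<open>x\<close> times \<open>y\<close> provide the pair.\<close>
    then have t: "t \<in> carr (Lop F F)"
      and tx: "\<And>x y. x \<in> X \<Longrightarrow> y \<in> Y \<Longrightarrow> compose (carr E) t x \<in> X"
      and yt: "\<And>x y. x \<in> X \<Longrightarrow> y \<in> Y \<Longrightarrow> compose (carr F) y t \<in> Y"
      by (auto simp: module_adjointables_def)
    have "compose (carr F) t b \<in> B" "compose (carr F) b t \<in> B" if b: "b \<in> B" for b
    proof -
      have b': "b \<in> closed_span (Lop F F) compacts_gens" using b compacts_eq K_eq by simp
      have "compose (carr F) t (compose (carr F) x y) = compose (carr F) (compose (carr E) t x) y"
        if "x \<in> X" "y \<in> Y" for x y
        using that by (auto simp: compose_def pFE.Lop_closed intro!: restrict_ext)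
      then show "compose (carr F) t b \<in> B"
        by (intro FFF.compose_left_closed_span[OF t compacts_gens_Lop closed_B _ b'])
          (auto simp: compacts_gens_def intro!: XY_B tx)
      have "compose (carr F) (compose (carr F) x y) t = compose (carr F) x (compose (carr F) y t)"
        if "x \<in> X" "y \<in> Y" for x y
        using that t by (auto simp: compose_def pFF.Lop_closed intro!: restrict_ext)
      then show "compose (carr F) b t \<in> B"
        by (intro FFF.compose_right_closed_span[OF compacts_gens_Lop t closed_B _ b'])
          (auto simp: compacts_gens_def intro!: XY_B yt)
    qed
    then show "t \<in> spatial_multipliers F B" using t by (simp add: spatial_multipliers_def)
  qed
  show "spatial_multipliers F B \<subseteq> module_adjointables E F Y X"
  proof
    fix t assume "t \<in> spatial_multipliers F B"
    then have t: "t \<in> carr (Lop F F)"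
      and tb: "\<And>b. b \<in> B \<Longrightarrow> compose (carr F) t b \<in> B"
      and bt: "\<And>b. b \<in> B \<Longrightarrow> compose (carr F) b t \<in> B"
      by (auto simp: spatial_multipliers_def)
    have c1: "coord 1 \<in> ell_dual" by (rule coord_Lop) simp
    have tX: "compose (carr E) t x \<in> X" if x: "x \<in> X" for x
    proof (rule EFF.compose_left_closed_span[OF t X_gens_Lop closed_X _ x[unfolded X_eq]])
      fix g assume "g \<in> X_gens"
      then obtain z a where g: "g = col_tensor z a" and m: "z \<in> carr ell" "a \<in> A"
        by (auto simp: X_gens_def)
      \<comment> \<open>\<open>coord 1\<close> of the first unit vector is 1, so the left factor
        moves that vector to \<open>z\<close>. This places an element of \<open>B\<close> next to
        \<open>t\<close>, where the multiplier property applies, and \<open>BX_X\<close> brings the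
        product back into \<open>X\<close>.\<close>
      have fac: "col_tensor z (compose (carr E) (e i) a)
          = compose (carr E) (kron_tensor (rank_one z (coord 1)) (e i)) (col_tensor (unit_vec 1) a)" for i
        using m c1 e_mem by (simp add: kron_column rank_one_apply coord_def)
      have "compose (carr E) t (col_tensor z (compose (carr E) (e i) a))
          = compose (carr E) (compose (carr F) t (kron_tensor (rank_one z (coord 1)) (e i))) (col_tensor (unit_vec 1) a)" for i
        unfolding fac using m e_mem
        by (auto simp: compose_def pEF.Lop_closed intro!: restrict_ext)
      then have mem: "compose (carr E) t (col_tensor z (compose (carr E) (e i) a)) \<in> X" for i
        using m c1 e_mem by (simp add: BX_X tb rank_one_B col_tensor_X)
      have "vlim (Lop E F) (\<lambda>i. col_tensor z (compose (carr E) (e i) a)) (col_tensor z a) \<F>"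
        unfolding col_tensor_def
        by (rule EEF.vlim_compose_left[OF e_left[OF m(2)]]) (use m e_mem in auto)
      then have "vlim (Lop E F) (\<lambda>i. compose (carr E) t (col_tensor z (compose (carr E) (e i) a)))
          (compose (carr E) t (col_tensor z a)) \<F>"
        by (rule EFF.vlim_compose_left) (use m e_mem t in auto)
      then show "compose (carr E) t g \<in> X"
        unfolding g by (rule LEF.closed_subspace_vlim[OF closed_X _ F_nontrivial mem]) (use m t in auto)
    qed
    have Yt: "compose (carr F) y t \<in> Y" if y: "y \<in> Y" for y
    proof (rule FFE.compose_right_closed_span[OF Y_gens_Lop t closed_Y _ y[unfolded Y_eq]])
      fix g assume "g \<in> Y_gens"
      then obtain \<phi> a where g: "g = row_tensor \<phi> a" and m: "\<phi> \<in> ell_dual" "a \<in> A"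
        by (auto simp: Y_gens_def)
      \<comment> \<open>The mirror factorization for rows: \<open>\<phi>\<close> is
        \<open>coord 1\<close> after the rank one operator that stores \<open>\<phi>\<close> in the
        first coordinate. Now the approximate identity stands to the right of
        \<open>a\<close>.\<close>
      have "compose (carr ell) (coord 1) (rank_one (unit_vec 1) \<phi>) = \<phi>"
        by (rule ellC.Lop_ext)
          (use m c1 in \<open>auto simp: compose_eq rank_one_apply coord_def ellp_scale ellellC.compose_closed\<close>)
      then have fac: "row_tensor \<phi> (compose (carr E) a (e i))
          = compose (carr F) (row_tensor (coord 1) a) (kron_tensor (rank_one (unit_vec 1) \<phi>) (e i))" for i
        using m c1 e_mem by (simp add: row_kron)
      have "compose (carr F) (row_tensor \<phi> (compose (carr E) a (e i))) t
          = compose (carr F) (row_tensor (coord 1) a) (compose (carr F) (kron_tensor (rank_one (unit_vec 1) \<phi>) (e i)) t)" for i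
        unfolding fac using t by (auto simp: compose_def pFF.Lop_closed intro!: restrict_ext)
      then have mem: "compose (carr F) (row_tensor \<phi> (compose (carr E) a (e i))) t \<in> Y" for i
        using m c1 e_mem by (simp add: YB_Y bt rank_one_B row_tensor_Y)
      have "vlim (Lop F E) (\<lambda>i. row_tensor \<phi> (compose (carr E) a (e i))) (row_tensor \<phi> a) \<F>"
        unfolding row_tensor_def
        by (rule FEE.vlim_compose_right[OF e_right[OF m(2)]]) (use m e_mem in auto)
      then have "vlim (Lop F E) (\<lambda>i. compose (carr F) (row_tensor \<phi> (compose (carr E) a (e i))) t)
          (compose (carr F) (row_tensor \<phi> a) t) \<F>"
        by (rule FFE.vlim_compose_right) (use m e_mem t in auto)
      then show "compose (carr F) g t \<in> Y"
        unfolding g by (rule LFE.closed_subspace_vlim[OF closed_Y _ F_nontrivial mem]) (use m t in auto)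
    qed
    show "t \<in> module_adjointables E F Y X"
      using t tX Yt by (simp add: module_adjointables_def)
  qed
qed

section \<open>The left approximate identity of \<open>B\<close>\<close>

abbreviation (input) "u \<equiv> \<lambda>ni. kron_tensor (proj (fst ni)) (e (snd ni))"

text \<open>A truncation is itself a finite sum of rank one operators, namely the truncation of the
  identity.\<close>

lemma u_B: "kron_tensor (proj n) (e i) \<in> B"
proof -
  let ?I = "\<lambda>z\<in>carr ell. z"
  have I: "?I \<in> ell_ops" by (rule ellell.Lop_memI[of _ 1]) auto
  have "compose (carr ell) (proj n) ?I = proj n"
    by (rule ellell.Lop_ext) (use I in \<open>auto simp: compose_eq ell3.compose_closed\<close>)
  then show ?thesis using kron_tensor_proj_rank_one_gens[OF I e_mem, of n i] by (simp add: B_eq_rank_one_gens)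
qed

lemma u_norm: "vnorm (Lop F F) (kron_tensor (proj n) (e i)) \<le> 1"
proof -
  have "vnorm (Lop F F) (kron_tensor (proj n) (e i)) \<le> vnorm (Lop ell ell) (proj n) * vnorm (Lop E E) (e i)"
    using e_mem by (intro kron_tensor_norm) auto
  also have "\<dots> \<le> 1 * 1"
    using e_mem by (intro mult_mono norm_proj e_norm pEE.opnorm_nonneg) auto
  finally show ?thesis by simp
qed

text \<open>Left multiplications by the \<open>u z\<close> are contractions on the operator space,
  so \<open>closed_subspace_vlim_Lop\<close> leaves the generators only. There the two factors
  converge separately, which the product filter expresses.\<close>

lemma u_left:
  assumes b: "b \<in> B"
  shows "vlim (Lop F F) (\<lambda>z. compose (carr F) (u z) b) b (sequentially \<times>\<^sub>F \<F>)"
proof -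
  interpret LL: cnspace_pair "Lop F F" "Lop F F" ..
  have uL: "u z \<in> carr (Lop F F)" for z using e_mem by simp
  let ?T = "\<lambda>z. \<lambda>b\<in>carr (Lop F F). compose (carr F) (u z) b"
  let ?I = "\<lambda>b\<in>carr (Lop F F). b"
  have T: "?T z \<in> carr (Lop (Lop F F) (Lop F F))" for z by (rule FFF.compose_left_Lop[OF uL])
  have I: "?I \<in> carr (Lop (Lop F F) (Lop F F))" by (rule LL.Lop_memI[of _ 1]) auto
  have n: "vnorm (Lop (Lop F F) (Lop F F)) (?T z) \<le> 1" for z
  proof (rule LL.opnorm_le)
    fix b assume b: "b \<in> carr (Lop F F)"
    then show "vnorm (Lop F F) (?T z b) \<le> 1 * vnorm (Lop F F) b"
      using FFF.compose_opnorm[OF uL[of z] b] mult_right_mono[OF u_norm, of "vnorm (Lop F F) b" "fst z" "snd z"]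
      by simp
  qed simp
  have cl: "closed_subspace (Lop F F) {b \<in> carr (Lop F F). vlim (Lop F F) (\<lambda>z. ?T z b) (?I b) (sequentially \<times>\<^sub>F \<F>)}"
    by (rule LL.closed_subspace_vlim_Lop[OF T I n])
  have "vlim (Lop F F) (\<lambda>z. ?T z b) (?I b) (sequentially \<times>\<^sub>F \<F>)"
  proof (rule LF.closed_span_induct[OF b[unfolded B_eq_rank_one_gens] rank_one_gens_Lop cl])
    fix g assume "g \<in> rank_one_gens"
    then obtain z \<phi> a where g: "g = kron_tensor (rank_one z \<phi>) a"
        and m: "z \<in> carr ell" "\<phi> \<in> ell_dual" "a \<in> A"
      by (auto simp: rank_one_gens_def)
    let ?r = "rank_one z \<phi>"
    have r: "?r \<in> ell_ops" using m by simp
    have rn: "vnorm (Lop ell ell) (compose (carr ell) (proj n) ?r) \<le> vnorm (Lop ell ell) ?r" for n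
      using ell3.compose_opnorm[OF proj_Lop[of n] r]
        mult_right_mono[OF norm_proj[of n] ellell.opnorm_nonneg[OF r]] by simp
    \<comment> \<open>Truncation acts to the left of the compact operator and \<open>e\<close> to
      the left of \<open>a\<close>, so both factors converge in norm.\<close>
    have "vlim (Lop F F) (\<lambda>z. kron_tensor (compose (carr ell) (proj (fst z)) ?r) (compose (carr E) (e (snd z)) a))
        (kron_tensor ?r a) (sequentially \<times>\<^sub>F \<F>)"
      by (rule vlim_kron_tensor[OF vlim_fst[OF proj_vlim_compact[OF rank_one_compact_operators[OF m(1,2)]]]
            _ r rn vlim_snd[OF e_left[OF m(3)]]])
        (use r m e_mem in \<open>auto simp: ell3.compose_closed\<close>)
    then show "vlim (Lop F F) (\<lambda>z. ?T z g) (?I g) (sequentially \<times>\<^sub>F \<F>)"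
      using g r m e_mem by (simp add: kron_kron)
  qed
  then show ?thesis using b by simp
qed

text \<open>On vectors \<open>a w\<close> this is the left unit property evaluated at
  \<open>w\<close>; by nondegeneracy such vectors span a dense subspace, and contractivity extends
  the convergence.\<close>

lemma e_strong:
  assumes nd: "nondegenerate E A" and v: "v \<in> carr E"
  shows "vlim E (\<lambda>i. e i v) v \<F>"
proof -
  let ?S = "{a w | a w. a \<in> A \<and> w \<in> carr E}"
  let ?I = "\<lambda>w\<in>carr E. w"
  have eL: "e i \<in> carr (Lop E E)" for i using e_mem by simp
  have I: "?I \<in> carr (Lop E E)" by (rule pEE.Lop_memI[of _ 1]) auto
  have S: "?S \<subseteq> carr E" by auto
  have vS: "v \<in> closed_span E ?S" using nd v by (simp add: nondegenerate_def)
  have "vlim E (\<lambda>i. e i v) (?I v) \<F>"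
  proof (rule E.closed_span_induct[OF vS S pEE.closed_subspace_vlim_Lop[OF eL I e_norm]])
    fix g assume "g \<in> ?S"
    then obtain a w where g: "g = a w" and m: "a \<in> A" "w \<in> carr E" by blast
    have "vlim E (\<lambda>i. compose (carr E) (e i) a w) (a w) \<F>"
      by (rule pEE.vlim_Lop_apply[OF e_left[OF m(1)]]) (use m eL in auto)
    then show "vlim E (\<lambda>i. e i g) (?I g) \<F>" using m by (simp add: g compose_eq)
  qed
  then show ?thesis using v by simp
qed

text \<open>On an elementary tensor the two factors converge separately, by
  \<open>proj_strong\<close> and \<open>e_strong\<close>; density of these tensors and
  \<open>u_norm\<close> give the rest.\<close>

lemma u_strong:
  assumes nd: "nondegenerate E A" and f: "f \<in> carr F"
  shows "vlim F (\<lambda>z. u z f) f (sequentially \<times>\<^sub>F \<F>)"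
proof -
  let ?S = "{tens u v | u v. u \<in> carr ell \<and> v \<in> carr E}"
  let ?I = "\<lambda>w\<in>carr F. w"
  have uL: "u z \<in> carr (Lop F F)" for z using e_mem by simp
  have I: "?I \<in> carr (Lop F F)" by (rule pFF.Lop_memI[of _ 1]) auto
  have S: "?S \<subseteq> carr F" by auto
  have fS: "f \<in> closed_span F ?S" using f by (simp add: closed_span_tens)
  have "vlim F (\<lambda>z. u z f) (?I f) (sequentially \<times>\<^sub>F \<F>)"
  proof (rule F.closed_span_induct[OF fS S pFF.closed_subspace_vlim_Lop[OF uL I u_norm]])
    fix g assume "g \<in> ?S"
    then obtain z v where g: "g = tens z v" and m: "z \<in> carr ell" "v \<in> carr E" by blast
    have pn: "vnorm ell (proj n z) \<le> 1 * vnorm ell z" for n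
      by (rule ellell.norm_le_opnorm'[OF proj_Lop m(1) norm_proj])
    have "vlim F (\<lambda>x. tens (proj (fst x) z) (e (snd x) v)) (tens z v) (sequentially \<times>\<^sub>F \<F>)"
      by (rule vlim_tens[OF vlim_fst[OF proj_strong[OF m(1)]] _ m(1) pn vlim_snd[OF e_strong[OF nd m(2)]]])
        (use m e_mem in \<open>auto simp: ellell.Lop_closed\<close>)
    then show "vlim F (\<lambda>x. u x g) (?I g) (sequentially \<times>\<^sub>F \<F>)"
      using m e_mem by (simp add: g kron_tensor_tens)
  qed
  then show ?thesis using f by simp
qed

lemma multiplier_iso:
  assumes nd: "nondegenerate E A"
  shows "isometric_algebra_iso (centralizer_of F B)
    ((op_algebra F)\<lparr>carr := spatial_multipliers F B\<rparr>) (multiplier_algebra ((op_algebra F)\<lparr>carr := B\<rparr>))"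
proof -
  \<comment> \<open>Nondegeneracy of \<open>A\<close> enters through \<open>u_strong\<close>, and
    completeness of \<open>L^p\<close> provides the strong limits.\<close>
  interpret left_unital_algebra F B "\<lambda>z. kron_tensor (proj (fst z)) (e (snd z))" "sequentially \<times>\<^sub>F \<F>"
  proof
    show "linear_subspace (Lop F F) B" using closed_B by (simp add: closed_subspace_def)
    show "sequentially \<times>\<^sub>F \<F> \<noteq> bot" using F_nontrivial by (simp add: prod_filter_eq_bot)
  qed (use vcomplete_Lp BB_B u_B u_norm u_left u_strong[OF nd] in auto)
  show ?thesis by (rule centralizer_iso)
qed

end

theorem proposition3p25:
  fixes p :: real and q :: ennreal and \<mu> :: "'a measure"
    and A :: "('a, 'a) Lp_op set"
    and e :: "'i \<Rightarrow> ('a, 'a) Lp_op" and \<F> :: "'i filter"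
  assumes "1 \<le> p" and "1 / ennreal p + 1 / q = 1"
    and "Lp_operator_algebra p \<mu> A"
    and "contractive_approximate_identity (op_algebra (Lp p \<mu>)) A e \<F>"
  shows "let E = Lp p \<mu>; F = Lp p (counting \<Otimes>\<^sub>M \<mu>);
             Y = ellq_tensor p q \<mu> A; X = ellp_tensor p \<mu> A; B = compact_tensor p \<mu> A
         in module_compacts E F Y X = B \<and>
            (nondegenerate E A \<longrightarrow>
               module_adjointables E F Y X = spatial_multipliers F B \<and>
               isometric_algebra_iso (centralizer_of F B)
                 ((op_algebra F)\<lparr>carr := module_adjointables E F Y X\<rparr>)
                 (multiplier_algebra ((op_algebra F)\<lparr>carr := B\<rparr>)))"
proof -
  interpret standard_module p q \<mu> A e \<F>
    using assms by unfold_locales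
  show ?thesis
    using compacts_eq adjointables_eq multiplier_iso by (simp add: Let_def)
qed

end
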